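(* Let $k\ge1$ be odd, let $u_{\mathcal T}\in\mathcal U^k_D(\mathcal T)$ be the nonconforming finite element solution of order $k$, i.e. $(A\nabla_hu_{\mathcal T},\nabla_hv)=(f,v)-\langle g,v\rangle_{\Gamma_N}$ for all $v\in\mathcal U^k_D(\mathcal T)$, and let $\hat{\boldsymbol\sigma}_{\mathcal T}$ be the recovered flux, defined elementwise from $u_{\mathcal T}$ by $\hat{\boldsymbol\sigma}_{\mathcal T}|_K=\hat{\boldsymbol\sigma}_K$ (see context). Then $\hat{\boldsymbol\sigma}_{\mathcal T}\in\Sigma^{k-1}_f(\mathcal T)$; that is, $\hat{\boldsymbol\sigma}_{\mathcal T}\in RT^{k-1}(\mathcal T)$ (in particular $\hat{\boldsymbol\sigma}_{\mathcal T}\in H(\mathrm{div};\Omega)$), $\nabla\cdot\hat{\boldsymbol\sigma}_{\mathcal T}=f_{k-1}$ in $\Omega$, and $\hat{\boldsymbol\sigma}_{\mathcal T}\cdot\mathbf n_F=g$ on $\Gamma_N$.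
   Context: Problem: $\Omega\subset\mathbb R^2$ is a bounded polygonal domain with Lipschitz boundary $\partial\Omega=\overline\Gamma_D\cup\overline\Gamma_N$, $\overline\Gamma_D\cap\overline\Gamma_N=\emptyset$, $\mathrm{meas}_1(\Gamma_D)\neq0$; $f\in L^2(\Omega)$; $A$ is symmetric positive definite and piecewise constant on polygonal open subdomains $\Omega_i$, $\overline\Omega=\cup_i\overline\Omega_i$. Mesh: $\mathcal T$ is a regular triangulation of $\Omega$ whose elements are not cut by the interfaces $\partial\Omega_i\cap\partial\Omega_j$. $\mathcal E=\mathcal E_I\cup\mathcal E_D\cup\mathcal E_N$ is the set of edges (interior, on $\Gamma_D$, on $\Gamma_N$), $\mathcal E_K$ the set of edges of $K$. For $F\in\mathcal E$: $h_F$ is its length, $\mathbf n_F=(n_1,n_2)$ a unit normal (outward to $\partial\Omega$ for boundary edges), $\mathbf t_F=(-n_2,n_1)$, and $\mathbf s_F,\mathbf e_F$ are the endpoints with $\mathbf e_F-\mathbf s_F=h_F\mathbf t_F$. For $F\in\mathcal E_I$, $K_F^\pm$ are the two elements sharing $F$, the outward normal of $K_F^-$ on $F$ being $\mathbf n_F$; for boundary $F$, $K_F^-$ is the element having $F$. The jump is $[\![v]\!]|_F=v|_{K_F^-}-v|_{K_F^+}$ for $F\in\mathcal E_I$. $\mu_K(F)=1$ if the outward normal $\mathbf n_K$ of $K$ satisfies $\mathbf n_K|_F=\mathbf n_F$ and $\mu_K(F)=-1$ if $\mathbf n_K|_F=-\mathbf n_F$. $\nabla_h$ is the elementwise gradient.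 Assumption on Neumann data: $g|_F\in\mathbb P_{k-1}(F)$ for all $F\in\mathcal E_N$. $\mathbb P_m$ denotes polynomials of degree $\le m$ (zero space if $m<0$). Nonconforming space: $\mathcal U^k(\mathcal T)=\{v\in L^2(\Omega): v|_K\in\mathbb P_k(K)\ \forall K\in\mathcal T,\ \int_F[\![v]\!]p\,ds=0\ \forall p\in\mathbb P_{k-1}(F),\forall F\in\mathcal E_I\}$ and $\mathcal U^k_D(\mathcal T)=\{v\in\mathcal U^k(\mathcal T):\int_Fv\,p\,ds=0\ \forall p\in\mathbb P_{k-1}(F),\forall F\in\mathcal E_D\}$. Basis: $m_k=\dim\mathbb P_{k-3}(K)$ for $k\ge3$, $m_k=0$ for $k<3$; $\{\mathbf x_j\}_{j=1}^{m_k}$ are the interior Lagrange points of $\mathbb P_k(K)$ in $K$ and $P_{j,K}\in\mathbb P_{k-3}(K)$ satisfies $P_{j,K}(\mathbf x_i)=\delta_{ij}$. $L_{j,F}$ is the $j$th order Legendre polynomial on $F$ normalized by $L_{j,F}(\mathbf e_F)=1$. For $F\in\mathcal E$, $0\le i\le k-1$, $\phi_{i,F}\in\mathcal U^k(\mathcal T)$ is determined by $\int_K\phi_{i,F}P_{j,K}\,dx=0$ for all $K\in\mathcal T$, $1\le j\le m_k$, and $\int_{F'}\phi_{i,F}L_{j,F'}\,ds=\delta_{ij}\delta_{FF'}$ for all $F'\in\mathcal E$, $0\le j\le k-1$. Recovered flux: $\tilde{\boldsymbol\sigma}_{\mathcal T}=-A\nabla_hu_{\mathcal T}$. With $RT^{k-1}(K)=\mathbb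 P_{k-1}(K)^2+\mathbf x\,\mathbb P_{k-1}(K)$, $\hat{\boldsymbol\sigma}_K\in RT^{k-1}(K)$ is defined by $\int_K\hat{\boldsymbol\sigma}_K\cdot\boldsymbol\tau\,dx=\int_K\tilde{\boldsymbol\sigma}_{\mathcal T}\cdot\boldsymbol\tau\,dx$ for all $\boldsymbol\tau\in\mathbb P_{k-2}(K)^2$ and, for $i=0,\dots,k-1$, $$\int_F\hat{\boldsymbol\sigma}_K\cdot\mathbf n_F\,L_{i,F}\,ds=\mu_K(F)\|L_{i,F}\|_{0,F}^2\Big(\int_K\tilde{\boldsymbol\sigma}_{\mathcal T}\cdot\nabla\phi_{i,F}\,dx+\int_Kf\phi_{i,F}\,dx\Big),\quad F\in\mathcal E_K\setminus\mathcal E_N,$$ $$\int_F\hat{\boldsymbol\sigma}_K\cdot\mathbf n_F\,L_{i,F}\,ds=\mu_K(F)\|L_{i,F}\|_{0,F}^2\int_Fg\,\phi_{i,F}\,ds,\quad F\in\mathcal E_K\cap\mathcal E_N.$$ Target space: $f_{k-1}|_K$ is the $L^2(K)$ projection of $f$ onto $\mathbb P_{k-1}(K)$. $RT^{k-1}(\mathcal T)=\{\boldsymbol\tau\in H(\mathrm{div};\Omega):\boldsymbol\tau|_K\in RT^{k-1}(K)\ \forall K\in\mathcal T\}$ and $\Sigma_f^{k-1}(\mathcal T)=\{\boldsymbol\tau\in RT^{k-1}(\mathcal T):\nabla\cdot\boldsymbol\tau=f_{k-1}\text{ in }\Omega,\ \boldsymbol\tau\cdot\mathbf n_F=g\text{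 on }\Gamma_N\}$. *)

theory Defs
  imports "HOL-Analysis.Analysis" "HOL-Computational_Algebra.Polynomial"
begin

type_synonym point = "real ^ 2"

section \<open>Domain, boundary parts and coefficient\<close>

definition polygonal :: "point set \<Rightarrow> bool" where
  "polygonal D \<longleftrightarrow> open D \<and> bounded D \<and>
     (\<exists>S. finite S \<and> (\<forall>s\<in>S. \<exists>a b. a \<noteq> b \<and> s = closed_segment a b) \<and> frontier D = \<Union>S)"

text \<open>Near every boundary point the set lies, in rotated coordinates, strictly on one side of the
  graph of a Lipschitz function.\<close>

definition lipschitz_boundary :: "point set \<Rightarrow> bool" where
  "lipschitz_boundary D \<longleftrightarrow>
     (\<forall>x\<in>frontier D. \<exists>U R \<gamma> C. open U \<and> x \<in> U \<and> orthogonal_transformation (R :: point \<Rightarrow> point) \<and>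
        C-lipschitz_on UNIV (\<gamma> :: real \<Rightarrow> real) \<and>
        D \<inter> U = {y \<in> U. \<gamma> (R y $ 1) < R y $ 2})"

definition polygonal_lipschitz_domain :: "point set \<Rightarrow> bool" where
  "polygonal_lipschitz_domain \<Omega> \<longleftrightarrow>
     polygonal \<Omega> \<and> connected \<Omega> \<and> \<Omega> \<noteq> {} \<and> lipschitz_boundary \<Omega>"

text \<open>One-dimensional Hausdorff outer measure.\<close>

definition meas1 :: "point set \<Rightarrow> ennreal" where
  "meas1 S = (SUP \<delta>\<in>{0<..}.
     INF U\<in>{U :: nat \<Rightarrow> point set. (\<forall>i. bounded (U i) \<and> diameter (U i) \<le> \<delta>) \<and> S \<subseteq> (\<Union>i. U i)}.
       (\<Sum>i. ennreal (diameter (U i))))"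

definition boundary_decomposition :: "point set \<Rightarrow> point set \<Rightarrow> point set \<Rightarrow> bool" where
  "boundary_decomposition \<Omega> \<Gamma>D \<Gamma>N \<longleftrightarrow>
     frontier \<Omega> = closure \<Gamma>D \<union> closure \<Gamma>N \<and> closure \<Gamma>D \<inter> closure \<Gamma>N = {} \<and> meas1 \<Gamma>D \<noteq> 0"

definition spd :: "real ^ 2 ^ 2 \<Rightarrow> bool" where
  "spd M \<longleftrightarrow> transpose M = M \<and> (\<forall>\<xi>. \<xi> \<noteq> 0 \<longrightarrow> 0 < \<xi> \<bullet> (M *v \<xi>))"

definition piecewise_constant_spd ::
  "point set \<Rightarrow> point set set \<Rightarrow> (point \<Rightarrow> real ^ 2 ^ 2) \<Rightarrow> bool" where
  "piecewise_constant_spd \<Omega> \<D> A \<longleftrightarrow>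
     finite \<D> \<and> (\<forall>D\<in>\<D>. polygonal D \<and> D \<subseteq> \<Omega>) \<and> closure \<Omega> = (\<Union>D\<in>\<D>. closure D) \<and>
     (\<forall>D\<in>\<D>. \<exists>M. spd M \<and> (\<forall>x\<in>D. A x = M))"

text \<open>Functions are representatives of their almost-everywhere classes; Lebesgue (not only Borel)
  measurability is used, so that membership does not depend on values on null sets.\<close>

definition L2 :: "point set \<Rightarrow> (point \<Rightarrow> 'b::euclidean_space) \<Rightarrow> bool" where
  "L2 S v \<longleftrightarrow> set_borel_measurable lebesgue S v \<and> set_integrable lebesgue S (\<lambda>x. (norm (v x))\<^sup>2)"

definition grad :: "(point \<Rightarrow> real) \<Rightarrow> point \<Rightarrow> point" where
  "grad v x = (THE D. GDERIV v x :> D)"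


section \<open>Mesh\<close>

text \<open>Elements are closed triangles. Conformity (two elements meet in a common face, possibly
  empty) is part of the library notion \<open>triangulation\<close>. No element is cut by an interface.\<close>

definition mesh :: "point set \<Rightarrow> point set set \<Rightarrow> point set set \<Rightarrow> bool" where
  "mesh \<Omega> \<D> \<T> \<longleftrightarrow>
     triangulation \<T> \<and> (\<forall>K\<in>\<T>. 2 simplex K) \<and> \<Union>\<T> = closure \<Omega> \<and>
     (\<forall>K\<in>\<T>. \<forall>D\<in>\<D>. \<forall>D'\<in>\<D>. D \<noteq> D' \<longrightarrow> interior K \<inter> (frontier D \<inter> frontier D') = {})"

definition edges :: "point set set \<Rightarrow> point set set" where
  "edges \<T> = {F. \<exists>K\<in>\<T>. F edge_of K}"

definition interior_edges :: "point set \<Rightarrow> point set set \<Rightarrow> point set set" where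
  "interior_edges \<Omega> \<T> = {F \<in> edges \<T>. \<not> F \<subseteq> frontier \<Omega>}"

text \<open>Applied to \<open>\<Gamma>D\<close> and \<open>\<Gamma>N\<close>, which are parts of the boundary; edges are closed, hence the
  closure.\<close>

definition edges_on :: "point set \<Rightarrow> point set set \<Rightarrow> point set set" where
  "edges_on \<Gamma> \<T> = {F \<in> edges \<T>. F \<subseteq> closure \<Gamma>}"

text \<open>\<open>\<nu>\<close> is the unit outward normal of the element \<open>K\<close> on its edge \<open>F\<close>.\<close>

definition outward_normal :: "point set \<Rightarrow> point set \<Rightarrow> point \<Rightarrow> bool" where
  "outward_normal K F \<nu> \<longleftrightarrow> norm \<nu> = 1 \<and> (\<forall>x\<in>F. \<forall>y\<in>K. \<nu> \<bullet> (y - x) \<le> 0)"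

text \<open>A choice \<open>n\<close> of unit normals, outward on the boundary.\<close>

definition edge_normals :: "point set \<Rightarrow> point set set \<Rightarrow> (point set \<Rightarrow> point) \<Rightarrow> bool" where
  "edge_normals \<Omega> \<T> n \<longleftrightarrow>
     (\<forall>F\<in>edges \<T>. norm (n F) = 1 \<and> (\<forall>x\<in>F. \<forall>y\<in>F. n F \<bullet> (x - y) = 0)) \<and>
     (\<forall>F\<in>edges \<T>. F \<subseteq> frontier \<Omega> \<longrightarrow> (\<forall>K\<in>\<T>. F edge_of K \<longrightarrow> outward_normal K F (n F)))"

definition tangent :: "(point set \<Rightarrow> point) \<Rightarrow> point set \<Rightarrow> point" where
  "tangent n F = vector [- (n F $ 2), n F $ 1]"

text \<open>The length \<open>h\<^sub>F\<close> of an edge is its diameter.\<close>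

definition edge_start :: "(point set \<Rightarrow> point) \<Rightarrow> point set \<Rightarrow> point" where
  "edge_start n F = (THE s. \<exists>e. F = closed_segment s e \<and> e - s = diameter F *\<^sub>R tangent n F)"

definition edge_end :: "(point set \<Rightarrow> point) \<Rightarrow> point set \<Rightarrow> point" where
  "edge_end n F = (THE e. \<exists>s. F = closed_segment s e \<and> e - s = diameter F *\<^sub>R tangent n F)"

definition K_minus :: "point set set \<Rightarrow> (point set \<Rightarrow> point) \<Rightarrow> point set \<Rightarrow> point set" where
  "K_minus \<T> n F = (THE K. K \<in> \<T> \<and> F edge_of K \<and> outward_normal K F (n F))"

definition K_plus :: "point set set \<Rightarrow> (point set \<Rightarrow> point) \<Rightarrow> point set \<Rightarrow> point set" where
  "K_plus \<T> n F = (THE K. K \<in> \<T> \<and> F edge_of K \<and> outward_normal K F (- n F))"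

definition mu :: "(point set \<Rightarrow> point) \<Rightarrow> point set \<Rightarrow> point set \<Rightarrow> real" where
  "mu n K F = (if outward_normal K F (n F) then 1 else - 1)"

text \<open>\<open>\<integral>\<^sub>F v ds\<close>\<close>

definition edge_integral :: "(point set \<Rightarrow> point) \<Rightarrow> point set \<Rightarrow> (point \<Rightarrow> real) \<Rightarrow> real" where
  "edge_integral n F v =
     diameter F * (LINT t:{0..1}|lebesgue. v (linepath (edge_start n F) (edge_end n F) t))"

text \<open>Boundary values of \<open>v|\<^sub>K\<close>. Elementwise polynomial functions may take arbitrary values on the
  (null) skeleton, hence the limit from inside the element.\<close>

definition trace_from :: "point set \<Rightarrow> (point \<Rightarrow> 'b::t2_space) \<Rightarrow> point \<Rightarrow> 'b" where
  "trace_from K v x = Lim (at x within interior K) v"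

definition jump ::
  "point set set \<Rightarrow> (point set \<Rightarrow> point) \<Rightarrow> (point \<Rightarrow> real) \<Rightarrow> point set \<Rightarrow> point \<Rightarrow> real" where
  "jump \<T> n v F x = trace_from (K_minus \<T> n F) v x - trace_from (K_plus \<T> n F) v x"

definition grad_h :: "point set set \<Rightarrow> (point \<Rightarrow> real) \<Rightarrow> point \<Rightarrow> point" where
  "grad_h \<T> v x = (if \<exists>K\<in>\<T>. x \<in> interior K then grad v x else 0)"


section \<open>Polynomial spaces\<close>

text \<open>Bivariate polynomials of total degree at most \<open>m\<close>; only the zero function if \<open>m < 0\<close>.\<close>

definition polys :: "int \<Rightarrow> (point \<Rightarrow> real) set" where
  "polys m = {p. \<exists>c :: nat \<Rightarrow> nat \<Rightarrow> real.
     \<forall>x. p x = (\<Sum>(i, j) \<in> {(i, j). int (i + j) \<le> m}. c i j * (x $ 1) ^ i * (x $ 2) ^ j)}"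

text \<open>\<open>v|\<^sub>S\<close> is a polynomial of degree at most \<open>m\<close>. On a segment, restrictions of bivariate
  polynomials are exactly the polynomials of the arc length, of the same degree bound.\<close>

definition poly_on :: "int \<Rightarrow> point set \<Rightarrow> (point \<Rightarrow> real) \<Rightarrow> bool" where
  "poly_on m S v \<longleftrightarrow> (\<exists>p\<in>polys m. \<forall>x\<in>S. v x = p x)"

definition rt_on :: "int \<Rightarrow> point set \<Rightarrow> (point \<Rightarrow> point) \<Rightarrow> bool" where
  "rt_on m S \<tau> \<longleftrightarrow>
     (\<exists>p\<in>polys m. \<exists>q\<in>polys m. \<exists>r\<in>polys m. \<forall>x\<in>S. \<tau> x = vector [p x, q x] + r x *\<^sub>R x)"

text \<open>Legendre polynomials on \<open>[-1, 1]\<close> by Rodrigues' formula; their value at \<open>1\<close> is \<open>1\<close>.\<close>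

definition legendre :: "nat \<Rightarrow> real poly" where
  "legendre j = smult (1 / (2 ^ j * fact j)) ((pderiv ^^ j) ([:- 1, 0, 1:] ^ j))"

text \<open>The affine coordinate is \<open>-1\<close> at \<open>s\<^sub>F\<close> and \<open>1\<close> at \<open>e\<^sub>F\<close>.\<close>

definition legendre_edge :: "(point set \<Rightarrow> point) \<Rightarrow> nat \<Rightarrow> point set \<Rightarrow> point \<Rightarrow> real" where
  "legendre_edge n j F x =
     poly (legendre j) (2 * ((x - edge_start n F) \<bullet> tangent n F) / diameter F - 1)"

text \<open>Points of the principal lattice of order \<open>k\<close> all of whose barycentric coordinates are
  positive; there are none for \<open>k < 3\<close>.\<close>

definition interior_lagrange_points :: "nat \<Rightarrow> point set \<Rightarrow> point set" where
  "interior_lagrange_points k K =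
     (let V = {v. v extreme_point_of K} in
      {x. \<exists>\<alpha> :: point \<Rightarrow> nat. (\<forall>v\<in>V. 1 \<le> \<alpha> v) \<and> (\<Sum>v\<in>V. \<alpha> v) = k \<and>
            x = (\<Sum>v\<in>V. (real (\<alpha> v) / real k) *\<^sub>R v)})"

text \<open>The nodal functions \<open>P\<^bsub>j,K\<^esub>\<close>, indexed by the Lagrange point \<open>y\<close> instead of its number \<open>j\<close>.\<close>

definition lagrange_functions ::
  "point set set \<Rightarrow> nat \<Rightarrow> (point set \<Rightarrow> point \<Rightarrow> point \<Rightarrow> real) \<Rightarrow> bool" where
  "lagrange_functions \<T> k P \<longleftrightarrow>
     (\<forall>K\<in>\<T>. \<forall>y\<in>interior_lagrange_points k K. poly_on (int k - 3) K (P K y) \<and>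
        (\<forall>z\<in>interior_lagrange_points k K. P K y z = (if z = y then 1 else 0)))"


section \<open>Nonconforming discretization and flux recovery\<close>

definition nc_space ::
  "point set \<Rightarrow> point set set \<Rightarrow> (point set \<Rightarrow> point) \<Rightarrow> nat \<Rightarrow> (point \<Rightarrow> real) set" where
  "nc_space \<Omega> \<T> n k = {v. L2 \<Omega> v \<and> (\<forall>K\<in>\<T>. poly_on (int k) (interior K) v) \<and>
     (\<forall>F\<in>interior_edges \<Omega> \<T>. \<forall>p\<in>polys (int k - 1).
        edge_integral n F (\<lambda>x. jump \<T> n v F x * p x) = 0)}"

definition nc_space_D ::
  "point set \<Rightarrow> point set \<Rightarrow> point set set \<Rightarrow> (point set \<Rightarrow> point) \<Rightarrow> nat \<Rightarrow> (point \<Rightarrow> real) set" where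
  "nc_space_D \<Omega> \<Gamma>D \<T> n k = {v \<in> nc_space \<Omega> \<T> n k.
     \<forall>F\<in>edges_on \<Gamma>D \<T>. \<forall>p\<in>polys (int k - 1).
        edge_integral n F (\<lambda>x. trace_from (K_minus \<T> n F) v x * p x) = 0}"

definition nc_solution ::
  "point set \<Rightarrow> point set \<Rightarrow> point set \<Rightarrow> (point \<Rightarrow> real ^ 2 ^ 2) \<Rightarrow> (point \<Rightarrow> real) \<Rightarrow> (point \<Rightarrow> real) \<Rightarrow>
   point set set \<Rightarrow> (point set \<Rightarrow> point) \<Rightarrow> nat \<Rightarrow> (point \<Rightarrow> real) \<Rightarrow> bool" where
  "nc_solution \<Omega> \<Gamma>D \<Gamma>N A f g \<T> n k u \<longleftrightarrow>
     u \<in> nc_space_D \<Omega> \<Gamma>D \<T> n k \<and>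
     (\<forall>v\<in>nc_space_D \<Omega> \<Gamma>D \<T> n k.
        (LINT x:\<Omega>|lebesgue. (A x *v grad_h \<T> u x) \<bullet> grad_h \<T> v x) =
        (LINT x:\<Omega>|lebesgue. f x * v x) -
        (\<Sum>F\<in>edges_on \<Gamma>N \<T>. edge_integral n F (\<lambda>x. g x * trace_from (K_minus \<T> n F) v x)))"

text \<open>Members of \<open>nc_space\<close> have the same moments from both sides of an interior edge, so taking
  the trace from \<open>K_minus\<close> in \<open>\<integral>\<^bsub>F'\<^esub> \<phi> L ds\<close> is no restriction.\<close>

definition nc_basis ::
  "point set \<Rightarrow> point set set \<Rightarrow> (point set \<Rightarrow> point) \<Rightarrow> nat \<Rightarrow>
   (point set \<Rightarrow> point \<Rightarrow> point \<Rightarrow> real) \<Rightarrow> (nat \<Rightarrow> point set \<Rightarrow> point \<Rightarrow> real) \<Rightarrow> bool" where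
  "nc_basis \<Omega> \<T> n k P \<phi> \<longleftrightarrow>
     (\<forall>F\<in>edges \<T>. \<forall>i<k. \<phi> i F \<in> nc_space \<Omega> \<T> n k \<and>
        (\<forall>K\<in>\<T>. \<forall>y\<in>interior_lagrange_points k K.
           (LINT x:K|lebesgue. \<phi> i F x * P K y x) = 0) \<and>
        (\<forall>F'\<in>edges \<T>. \<forall>j<k.
           edge_integral n F' (\<lambda>x. trace_from (K_minus \<T> n F') (\<phi> i F) x * legendre_edge n j F' x) =
           (if i = j \<and> F = F' then 1 else 0)))"

definition numerical_flux ::
  "point set set \<Rightarrow> (point \<Rightarrow> real ^ 2 ^ 2) \<Rightarrow> (point \<Rightarrow> real) \<Rightarrow> point \<Rightarrow> point" where
  "numerical_flux \<T> A u x = - (A x *v grad_h \<T> u x)"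

definition local_recovered_flux ::
  "point set \<Rightarrow> (point \<Rightarrow> real) \<Rightarrow> (point \<Rightarrow> real) \<Rightarrow> point set set \<Rightarrow> (point set \<Rightarrow> point) \<Rightarrow> nat \<Rightarrow>
   (nat \<Rightarrow> point set \<Rightarrow> point \<Rightarrow> real) \<Rightarrow> (point \<Rightarrow> point) \<Rightarrow> point set \<Rightarrow> (point \<Rightarrow> point) \<Rightarrow> bool" where
  "local_recovered_flux \<Gamma>N f g \<T> n k \<phi> \<sigma>t K \<sigma>K \<longleftrightarrow>
     rt_on (int k - 1) K \<sigma>K \<and>
     (\<forall>p\<in>polys (int k - 2). \<forall>q\<in>polys (int k - 2).
        (LINT x:K|lebesgue. \<sigma>K x \<bullet> vector [p x, q x]) =
        (LINT x:K|lebesgue. \<sigma>t x \<bullet> vector [p x, q x])) \<and>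
     (\<forall>F. F edge_of K \<longrightarrow> F \<notin> edges_on \<Gamma>N \<T> \<longrightarrow> (\<forall>i<k.
        edge_integral n F (\<lambda>x. (\<sigma>K x \<bullet> n F) * legendre_edge n i F x) =
        mu n K F * edge_integral n F (\<lambda>x. (legendre_edge n i F x)\<^sup>2) *
          ((LINT x:K|lebesgue. \<sigma>t x \<bullet> grad_h \<T> (\<phi> i F) x) + (LINT x:K|lebesgue. f x * \<phi> i F x)))) \<and>
     (\<forall>F. F edge_of K \<longrightarrow> F \<in> edges_on \<Gamma>N \<T> \<longrightarrow> (\<forall>i<k.
        edge_integral n F (\<lambda>x. (\<sigma>K x \<bullet> n F) * legendre_edge n i F x) =
        mu n K F * edge_integral n F (\<lambda>x. (legendre_edge n i F x)\<^sup>2) *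
          edge_integral n F (\<lambda>x. g x * trace_from K (\<phi> i F) x)))"

definition recovered_flux ::
  "point set \<Rightarrow> (point \<Rightarrow> real ^ 2 ^ 2) \<Rightarrow> (point \<Rightarrow> real) \<Rightarrow> (point \<Rightarrow> real) \<Rightarrow> point set set \<Rightarrow>
   (point set \<Rightarrow> point) \<Rightarrow> nat \<Rightarrow> (nat \<Rightarrow> point set \<Rightarrow> point \<Rightarrow> real) \<Rightarrow> (point \<Rightarrow> real) \<Rightarrow>
   (point \<Rightarrow> point) \<Rightarrow> bool" where
  "recovered_flux \<Gamma>N A f g \<T> n k \<phi> u \<sigma> \<longleftrightarrow>
     (\<forall>K\<in>\<T>. \<exists>\<sigma>K. local_recovered_flux \<Gamma>N f g \<T> n k \<phi> (numerical_flux \<T> A u) K \<sigma>K \<and>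
        (\<forall>x\<in>interior K. \<sigma> x = \<sigma>K x))"


section \<open>Target space\<close>

primrec Ck :: "nat \<Rightarrow> (point \<Rightarrow> real) \<Rightarrow> bool" where
  "Ck 0 \<psi> = continuous_on UNIV \<psi>"
| "Ck (Suc m) \<psi> = ((\<forall>x. \<psi> differentiable (at x)) \<and> (\<forall>i. Ck m (\<lambda>x. grad \<psi> x $ i)))"

definition test_functions :: "point set \<Rightarrow> (point \<Rightarrow> real) set" where
  "test_functions \<Omega> =
     {\<psi>. (\<forall>m. Ck m \<psi>) \<and> compact (closure {x. \<psi> x \<noteq> 0}) \<and> closure {x. \<psi> x \<noteq> 0} \<subseteq> \<Omega>}"

text \<open>\<open>w\<close> is the divergence of \<open>\<tau>\<close> on \<open>\<Omega>\<close> in the sense of distributions.\<close>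

definition has_weak_div :: "point set \<Rightarrow> (point \<Rightarrow> point) \<Rightarrow> (point \<Rightarrow> real) \<Rightarrow> bool" where
  "has_weak_div \<Omega> \<tau> w \<longleftrightarrow>
     (\<forall>\<psi>\<in>test_functions \<Omega>.
        (LINT x:\<Omega>|lebesgue. \<tau> x \<bullet> grad \<psi> x) = - (LINT x:\<Omega>|lebesgue. w x * \<psi> x))"

definition H_div :: "point set \<Rightarrow> (point \<Rightarrow> point) set" where
  "H_div \<Omega> = {\<tau>. L2 \<Omega> \<tau> \<and> (\<exists>w. L2 \<Omega> w \<and> has_weak_div \<Omega> \<tau> w)}"

definition RT_space :: "point set \<Rightarrow> point set set \<Rightarrow> int \<Rightarrow> (point \<Rightarrow> point) set" where
  "RT_space \<Omega> \<T> m = {\<tau> \<in> H_div \<Omega>. \<forall>K\<in>\<T>. rt_on m (interior K) \<tau>}"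

definition L2_projection :: "int \<Rightarrow> point set \<Rightarrow> (point \<Rightarrow> real) \<Rightarrow> point \<Rightarrow> real" where
  "L2_projection m K f = (THE p. p \<in> polys m \<and>
     (\<forall>q\<in>polys m. (LINT x:K|lebesgue. p x * q x) = (LINT x:K|lebesgue. f x * q x)))"

definition broken_L2_projection ::
  "int \<Rightarrow> point set set \<Rightarrow> (point \<Rightarrow> real) \<Rightarrow> point \<Rightarrow> real" where
  "broken_L2_projection m \<T> f x = (\<Sum>K\<in>\<T>. indicator (interior K) x * L2_projection m K f x)"

text \<open>\<open>\<tau> \<bullet> n\<^sub>F = g\<close> is required in the relative interiors of the Neumann edges, because \<open>g\<close> need
  not be continuous at the vertices.\<close>

definition Sigma_f ::
  "point set \<Rightarrow> point set \<Rightarrow> (point \<Rightarrow> real) \<Rightarrow> (point \<Rightarrow> real) \<Rightarrow> point set set \<Rightarrow>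
   (point set \<Rightarrow> point) \<Rightarrow> int \<Rightarrow> (point \<Rightarrow> point) set" where
  "Sigma_f \<Omega> \<Gamma>N f g \<T> n m = {\<tau> \<in> RT_space \<Omega> \<T> m.
     has_weak_div \<Omega> \<tau> (broken_L2_projection m \<T> f) \<and>
     (\<forall>F\<in>edges_on \<Gamma>N \<T>. \<forall>x\<in>rel_interior F. trace_from (K_minus \<T> n F) \<tau> x \<bullet> n F = g x)}"

end

theory Submission
  imports Defs
begin

text \<open>
  Let \<open>flux\<close> denote \<open>- A \<nabla>u\<close>, taken elementwise, and let the residual of a function \<open>v\<close> on an element \<open>K\<close>
  be \<open>\<integral> flux \<bullet> \<nabla>v + \<integral> f v\<close> over \<open>K\<close>. The discrete equation says that, for each test function, the residuals
  of all elements add up to the Neumann term \<open>\<integral> g v\<close>. What makes the proof work is that test functions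
  can be very local: a piecewise polynomial is admissible as soon as its moments against polynomials
  of degree below \<open>k\<close> match across interior edges and vanish on Dirichlet edges
  (\<open>test_with_glued_polynomials\<close>). Two kinds of test functions suffice.

  A polynomial of degree at most \<open>k\<close> on one element whose edge moments all vanish can be extended by zero; its
  residual is \<open>0\<close> (\<open>residual_no_moments\<close>). Unless \<open>F\<close> is a Dirichlet edge, a basis function \<open>\<phi> i F\<close> can be restricted to the one or two elements
  that have the edge \<open>F\<close>, because its moments on the other edges vanish (\<open>residual_basis\<close>). If \<open>F\<close> is an
  interior edge, then its residuals on the two elements cancel. If \<open>F\<close> is a Neumann edge, then its residual is
  \<open>\<integral> g \<phi>\<close> over \<open>F\<close>, so that on every edge the moments of the recovered flux are, up to sign and normalization,
  residuals of basis functions.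

  Continuity of the normal component follows: on an edge, the normal component of a Raviart-Thomas field
  is a polynomial of degree below \<open>k\<close>, hence determined by its Legendre moments, and the moments from both sides
  agree by the cancellation. The Neumann condition follows in the same way. For the divergence, let \<open>p\<close> have degree
  below \<open>k\<close>. Green's formula expresses \<open>\<integral> (div \<sigma>) p\<close> by the interior moments of \<open>\<sigma>\<close>, which are those of
  \<open>flux\<close>, and by its edge moments. The latter sum up to the residual of a combination of basis functions
  that has the same edge moments as \<open>p\<close>, hence to the residual of \<open>p\<close> itself. What remains is \<open>\<integral> f p\<close>
  (\<open>local_flux_divergence\<close>). Finally, summation of Green's formula over the elements shows
  that the elementwise divergence is the weak one.

  The analytic tools are Gauss' theorem on a triangle, obtained from Fubini's theorem by an affine map
  (\<open>triangle_gauss\<close>), and orthogonality of the Legendre polynomials, obtained from Rodrigues' formula. The geometric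
  one is that an edge inside the domain has exactly one element on either side (\<open>opposite_element\<close>,
  \<open>same_side_triangles_eq\<close>).
\<close>

section \<open>Bivariate polynomials\<close>

lemma finite_exponents: "finite {(i, j). int (i + j) \<le> m}"
  by (rule finite_subset[of _ "{..nat m} \<times> {..nat m}"]) auto

lemma monomial_in_polys:
  assumes "int (i + j) \<le> m"
  shows "(\<lambda>x. c * (x $ 1) ^ i * (x $ 2) ^ j) \<in> polys m"
proof -
  have "(\<Sum>(i', j') \<in> {(i', j'). int (i' + j') \<le> m}.
           (if i' = i \<and> j' = j then c else 0) * (x $ 1) ^ i' * (x $ 2) ^ j')
        = c * (x $ 1) ^ i * (x $ 2) ^ j" for x :: point
  proof -
    have "(\<Sum>(i', j') \<in> {(i', j'). int (i' + j') \<le> m}.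
             (if i' = i \<and> j' = j then c else 0) * (x $ 1) ^ i' * (x $ 2) ^ j')
        = (\<Sum>z \<in> {(i', j'). int (i' + j') \<le> m}.
             if z = (i, j) then c * (x $ 1) ^ i * (x $ 2) ^ j else 0)"
      by (rule sum.cong) (auto split: if_splits)
    also have "\<dots> = c * (x $ 1) ^ i * (x $ 2) ^ j"
      using assms finite_exponents[of m] by simp
    finally show ?thesis .
  qed
  then show ?thesis
    unfolding polys_def by (auto intro!: exI[of _ "\<lambda>i' j'. if i' = i \<and> j' = j then c else 0"])
qed

lemma polys_0: "(\<lambda>x. 0) \<in> polys m"
  unfolding polys_def by (auto intro!: exI[of _ "\<lambda>i j. 0"])

lemma polys_add:
  assumes "p \<in> polys m" "q \<in> polys m"
  shows "(\<lambda>x. p x + q x) \<in> polys m"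
proof -
  from assms obtain c d where
    "\<And>x. p x = (\<Sum>(i, j) \<in> {(i, j). int (i + j) \<le> m}. c i j * (x $ 1) ^ i * (x $ 2) ^ j)"
    "\<And>x. q x = (\<Sum>(i, j) \<in> {(i, j). int (i + j) \<le> m}. d i j * (x $ 1) ^ i * (x $ 2) ^ j)"
    unfolding polys_def by blast
  then have "p x + q x = (\<Sum>(i, j) \<in> {(i, j). int (i + j) \<le> m}. (c i j + d i j) * (x $ 1) ^ i * (x $ 2) ^ j)" for x
    by (simp add: sum.distrib[symmetric] split_def distrib_right)
  then show ?thesis
    unfolding polys_def mem_Collect_eq by (intro exI[of _ "\<lambda>i j. c i j + d i j"] allI)
qed

text \<open>The monomials span the space, so a property that respects sums has to be checked on
  monomials only.\<close>

lemma polys_induct [consumes 1, case_names zero add monomial]: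
  assumes "p \<in> polys m"
    and zero: "Q (\<lambda>x. 0)"
    and add: "\<And>p q. p \<in> polys m \<Longrightarrow> q \<in> polys m \<Longrightarrow> Q p \<Longrightarrow> Q q \<Longrightarrow> Q (\<lambda>x. p x + q x)"
    and monomial: "\<And>c i j. int (i + j) \<le> m \<Longrightarrow> Q (\<lambda>x. c * (x $ 1) ^ i * (x $ 2) ^ j)"
  shows "Q p"
proof -
  obtain c where c:
    "\<And>x. p x = (\<Sum>(i, j) \<in> {(i, j). int (i + j) \<le> m}. c i j * (x $ 1) ^ i * (x $ 2) ^ j)"
    using assms(1) unfolding polys_def by blast
  have "(\<lambda>x. \<Sum>(i, j) \<in> S. c i j * (x $ 1) ^ i * (x $ 2) ^ j) \<in> polys m \<and>
        Q (\<lambda>x. \<Sum>(i, j) \<in> S. c i j * (x $ 1) ^ i * (x $ 2) ^ j)"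
    if "finite S" "S \<subseteq> {(i, j). int (i + j) \<le> m}" for S
    using that
  proof (induction S rule: finite_induct)
    case empty
    then show ?case using zero polys_0 by simp
  next
    case (insert z S)
    obtain i j where z: "z = (i, j)" by (cases z)
    then show ?case
      using insert add[OF monomial_in_polys[of i j m "c i j"]] monomial[of i j "c i j"]
        polys_add[OF monomial_in_polys[of i j m "c i j"]]
      by simp
  qed
  from this[OF finite_exponents subset_refl] show ?thesis
    using c by (metis (no_types, lifting) ext)
qed

lemma polys_mono: "p \<in> polys m \<Longrightarrow> m \<le> m' \<Longrightarrow> p \<in> polys m'"
  by (induction rule: polys_induct) (auto intro: polys_0 polys_add monomial_in_polys)

lemma polys_const: "0 \<le> m \<Longrightarrow> (\<lambda>x. c) \<in> polys m"
  using monomial_in_polys[of 0 0 m c] by simp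

lemma polys_coord: "(\<lambda>x. x $ i) \<in> polys 1"
  using monomial_in_polys[of 1 0 1 1] monomial_in_polys[of 0 1 1 1] exhaust_2[of i] by auto

lemma polys_mult:
  assumes "p \<in> polys m" "q \<in> polys m'"
  shows "(\<lambda>x. p x * q x) \<in> polys (m + m')"
  using assms(1)
proof (induction rule: polys_induct)
  case zero
  then show ?case using polys_0 by simp
next
  case (add p1 p2)
  then show ?case using polys_add by (simp add: distrib_right)
next
  case (monomial c i j)
  show ?case using assms(2)
  proof (induction rule: polys_induct)
    case zero
    then show ?case using polys_0 by simp
  next
    case (add p1 p2)
    then show ?case using polys_add by (simp add: distrib_left)
  next
    case (monomial c' i' j')
    have "int ((i + i') + (j + j')) \<le> m + m'"
      using monomial \<open>int (i + j) \<le> m\<close> by linarith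
    from monomial_in_polys[OF this, of "c * c'"] show ?case
      by (simp add: power_add algebra_simps)
  qed
qed

lemma polys_cmult: "p \<in> polys m \<Longrightarrow> (\<lambda>x. c * p x) \<in> polys m"
  using polys_mult[OF polys_const[of 0 c]] by simp

lemma polys_diff:
  assumes "p \<in> polys m" "q \<in> polys m"
  shows "(\<lambda>x. p x - q x) \<in> polys m"
  using polys_add[OF assms(1) polys_cmult[OF assms(2), of "-1"]] by simp

lemma polys_sum: "(\<And>i. i \<in> I \<Longrightarrow> p i \<in> polys m) \<Longrightarrow> (\<lambda>x. \<Sum>i\<in>I. p i x) \<in> polys m"
  by (induction I rule: infinite_finite_induct) (auto intro: polys_0 polys_add)

lemma polys_inner: "(\<lambda>x. v \<bullet> x) \<in> polys 1"
  unfolding inner_vec_def by (intro polys_sum) (auto intro: polys_cmult polys_coord)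

lemma polys_power: "p \<in> polys 1 \<Longrightarrow> (\<lambda>x. p x ^ j) \<in> polys (int j)"
proof (induction j)
  case 0
  then show ?case using polys_const by simp
next
  case (Suc j)
  then show ?case using polys_mult[of p 1 "\<lambda>x. p x ^ j" "int j"] by simp
qed

lemma polys_affine_comp:
  assumes "p \<in> polys 1" "degree q \<le> j"
  shows "(\<lambda>x. poly q (p x)) \<in> polys (int j)"
  unfolding poly_altdef
  by (intro polys_sum polys_cmult polys_mono[OF polys_power[OF assms(1)]]) (use assms in auto)

lemma vector_2_inner: "(vector [a, b] :: point) \<bullet> h = a * h $ 1 + b * h $ 2"
  by (simp add: inner_vec_def sum_2)

lemma polys_GDERIV:
  assumes "p \<in> polys m"
  shows "\<exists>q1\<in>polys (m - 1). \<exists>q2\<in>polys (m - 1). \<forall>x. GDERIV p x :> vector [q1 x, q2 x]"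
  using assms
proof (induction rule: polys_induct)
  case zero
  have "GDERIV (\<lambda>x::point. 0) x :> vector [0, 0]" for x
    by (simp add: gderiv_def vector_2_inner inner_commute[of _ "vector [0,0]"])
  then show ?case
    by (intro bexI[OF _ polys_0]) auto
next
  case (add p q)
  then obtain p1 p2 q1 q2 where
    *: "p1 \<in> polys (m - 1)" "p2 \<in> polys (m - 1)" "q1 \<in> polys (m - 1)" "q2 \<in> polys (m - 1)"
    "\<And>x. GDERIV p x :> vector [p1 x, p2 x]" "\<And>x. GDERIV q x :> vector [q1 x, q2 x]"
    by blast
  have "GDERIV (\<lambda>x. p x + q x) x :> vector [p1 x + q1 x, p2 x + q2 x]" for x
    unfolding gderiv_def
    by (rule has_derivative_eq_rhs[OF has_derivative_add[OF *(5)[unfolded gderiv_def] *(6)[unfolded gderiv_def]]])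
      (simp add: fun_eq_iff inner_commute[of _ "vector _"] vector_2_inner algebra_simps)
  then show ?case
    using * by (intro bexI[OF _ polys_add[of p1 _ q1]] bexI[OF _ polys_add[of p2 _ q2]]) auto
next
  case (monomial c i j)
  define q1 where "q1 = (\<lambda>x::point. (c * real i) * (x $ 1) ^ (i - 1) * (x $ 2) ^ j)"
  define q2 where "q2 = (\<lambda>x::point. (c * real j) * (x $ 1) ^ i * (x $ 2) ^ (j - 1))"
  have "q1 \<in> polys (m - 1)"
  proof (cases i)
    case 0
    then show ?thesis using polys_0 by (simp add: q1_def)
  next
    case (Suc i')
    then show ?thesis unfolding q1_def using monomial by (intro monomial_in_polys) auto
  qed
  moreover have "q2 \<in> polys (m - 1)"
  proof (cases j)
    case 0
    then show ?thesis using polys_0 by (simp add: q2_def)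
  next
    case (Suc j')
    then show ?thesis unfolding q2_def using monomial by (intro monomial_in_polys) auto
  qed
  moreover have "GDERIV (\<lambda>x. c * (x $ 1) ^ i * (x $ 2) ^ j) x :> vector [q1 x, q2 x]" for x
    unfolding gderiv_def q1_def q2_def
    by (auto intro!: derivative_eq_intros bounded_linear.has_derivative[OF bounded_linear_vec_nth] simp: inner_commute[of _ "vector _"] vector_2_inner
        fun_eq_iff algebra_simps)
  ultimately show ?case by blast
qed

lemma polys_continuous_on: "p \<in> polys m \<Longrightarrow> continuous_on S p"
  by (induction rule: polys_induct) (auto intro!: continuous_intros)

text \<open>Along a line a polynomial in two variables becomes univariate without gaining degree. This is
  how counting of roots and expansion in Legendre polynomials become available.\<close>

lemma polys_on_line:
  assumes "p \<in> polys m"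
  shows "\<exists>q. (q = 0 \<or> int (degree q) \<le> m) \<and> (\<forall>t. p (a + t *\<^sub>R v) = poly q t)"
  using assms
proof (induction rule: polys_induct)
  case zero
  then show ?case by (intro exI[of _ 0]) simp
next
  case (add p1 p2)
  then obtain q1 q2 where q: "q1 = 0 \<or> int (degree q1) \<le> m" "\<And>t. p1 (a + t *\<^sub>R v) = poly q1 t"
    "q2 = 0 \<or> int (degree q2) \<le> m" "\<And>t. p2 (a + t *\<^sub>R v) = poly q2 t"
    by blast
  have "int (degree (q1 + q2)) \<le> m" if "q1 \<noteq> 0" "q2 \<noteq> 0"
    using degree_add_le_max[of q1 q2] q(1,3) that by auto
  then have "q1 + q2 = 0 \<or> int (degree (q1 + q2)) \<le> m"
    using q(1,3) by (cases "q1 = 0"; cases "q2 = 0") auto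
  then show ?case
    using q by (intro exI[of _ "q1 + q2"]) simp
next
  case (monomial c i j)
  define q where "q = smult c ([:a $ 1, v $ 1:] ^ i * [:a $ 2, v $ 2:] ^ j)"
  have d: "degree ([:r, s:] ^ l) \<le> l" for r s :: real and l
    by (rule order_trans[OF degree_power_le]) (auto intro!: mult_le_mono1)
  have "degree q \<le> degree ([:a $ 1, v $ 1:] ^ i * [:a $ 2, v $ 2:] ^ j)"
    unfolding q_def by (rule degree_smult_le)
  also have "\<dots> \<le> i + j"
    by (rule order_trans[OF degree_mult_le add_mono[OF d d]])
  finally have "int (degree q) \<le> m"
    using monomial by linarith
  then show ?case
    by (intro exI[of _ q]) (simp add: q_def algebra_simps)
qed

text \<open>On the line through \<open>x\<close> and a point of \<open>S\<close> the polynomial has infinitely many zeros. Hence a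
  polynomial, as a function on the plane, is determined by its values on one element.\<close>

lemma polys_eq_0I:
  assumes "p \<in> polys m" "open S" "S \<noteq> {}" "\<And>x. x \<in> S \<Longrightarrow> p x = 0"
  shows "p x = 0"
proof -
  obtain a where a: "a \<in> S" using assms by blast
  obtain q where q: "\<And>t. p (a + t *\<^sub>R (x - a)) = poly q t"
    using polys_on_line[OF assms(1), of a "x - a"] by blast
  define U where "U = (\<lambda>t. a + t *\<^sub>R (x - a)) -` S"
  have "open U"
    unfolding U_def by (intro open_vimage assms continuous_intros)
  moreover have "0 \<in> U" by (simp add: U_def a)
  ultimately obtain e where e: "e > 0" "ball 0 e \<subseteq> U"
    using open_contains_ball by blast
  then have "infinite U"
    using uncountable_ball[of e "0 :: real"] countable_finite countable_subset by metis
  moreover have "U \<subseteq> {t. poly q t = 0}"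
    using assms(4) by (auto simp: U_def q[symmetric])
  ultimately have "q = 0"
    using poly_roots_finite[of q] finite_subset by blast
  then show ?thesis using q[of 1] by simp
qed


section \<open>Legendre polynomials\<close>

text \<open>The mean value over an edge: \<open>2 * t - 1\<close> is the coordinate on \<open>[-1, 1]\<close> in which the
  Legendre polynomials are given, while \<open>t\<close> is the parameter of the edge.\<close>

definition unit_integral :: "real poly \<Rightarrow> real" where
  "unit_integral p = (LINT t:{0..1}|lebesgue. poly p (2 * t - 1))"

lemma unit_integral_eq: "unit_integral p = integral {0..1} (\<lambda>t. poly p (2 * t - 1))"
  unfolding unit_integral_def
  by (rule set_lebesgue_integral_eq_integral(2), rule absolutely_integrable_continuous_real)
    (intro continuous_intros)

lemma unit_integral_add: "unit_integral (p + q) = unit_integral p + unit_integral q"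
  unfolding unit_integral_eq poly_add
  by (intro integral_add integrable_continuous_interval continuous_intros)

lemma unit_integral_smult: "unit_integral (smult c p) = c * unit_integral p"
  unfolding unit_integral_eq by simp

lemma unit_integral_sum: "unit_integral (\<Sum>i\<in>I. p i) = (\<Sum>i\<in>I. unit_integral (p i))"
  by (induction I rule: infinite_finite_induct) (simp_all add: unit_integral_add, simp_all add: unit_integral_eq)

lemma unit_integral_pderiv: "unit_integral (pderiv p) = (poly p 1 - poly p (- 1)) / 2"
proof -
  have "((\<lambda>t. poly (pderiv p) (2 * t - 1)) has_integral poly p (2 * 1 - 1) / 2 - poly p (2 * 0 - 1) / 2) {0..1}"
  proof (rule fundamental_theorem_of_calculus)
    fix t :: real
    have "((\<lambda>t. poly p (2 * t - 1) / 2) has_real_derivative poly (pderiv p) (2 * t - 1) * 2 / 2) (at t within {0..1})"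
      by (intro DERIV_cdivide DERIV_chain2[OF poly_DERIV]) (auto intro!: derivative_eq_intros)
    then show "((\<lambda>t. poly p (2 * t - 1) / 2) has_vector_derivative poly (pderiv p) (2 * t - 1)) (at t within {0..1})"
      by (simp add: has_real_derivative_iff_has_vector_derivative)
  qed simp
  then show ?thesis
    unfolding unit_integral_eq by (simp add: integral_unique diff_divide_distrib)
qed

lemma unit_integral_square_eq_0:
  assumes "unit_integral (q * q) = 0"
  shows "q = 0"
proof -
  have "poly q (2 * t - 1) = 0" if "t \<in> {0..1}" for t
  proof -
    have c: "continuous_on {0..1} (\<lambda>t. poly (q * q) (2 * t - 1))"
      by (intro continuous_intros)
    have nn: "0 \<le> poly (q * q) (2 * t - 1)" for t by simp
    have "poly (q * q) (2 * t - 1) = 0"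
      using integral_eq_0_iff[OF c zero_less_one nn] assms that unfolding unit_integral_eq by blast
    then show ?thesis by simp
  qed
  then have "{-1..1} \<subseteq> {x. poly q x = 0}"
  proof -
    assume *: "\<And>t. t \<in> {0..1} \<Longrightarrow> poly q (2 * t - 1) = 0"
    have "poly q x = 0" if "x \<in> {-1..1}" for x
      using *[of "(x + 1) / 2"] that by (simp add: field_simps)
    then show ?thesis by blast
  qed
  moreover have "infinite {-1..1::real}" by simp
  ultimately show ?thesis
    using poly_roots_finite[of q] finite_subset by blast
qed

lemma power_Suc_dvd_pderiv:
  fixes d :: "real poly"
  assumes "d ^ Suc m dvd p"
  shows "d ^ m dvd pderiv p"
proof -
  obtain r where r: "p = d ^ Suc m * r" using assms by (elim dvdE)
  show ?thesis
    unfolding r pderiv_mult pderiv_power_Suc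
    by (intro dvd_add) (auto intro: dvd_mult dvd_mult2 dvd_smult)
qed

lemma bump_power_dvd_derivative:
  "i \<le> j \<Longrightarrow> [:- 1, 0, 1:] ^ (j - i) dvd (pderiv ^^ i) ([:- 1, 0, 1 :: real:] ^ j)"
proof (induction i)
  case (Suc i)
  then have "[:- 1, 0, 1:] ^ Suc (j - Suc i) dvd (pderiv ^^ i) ([:- 1, 0, 1 :: real:] ^ j)"
    by (simp add: Suc_diff_Suc)
  then show ?case
    using power_Suc_dvd_pderiv by simp
qed simp

text \<open>Integration by parts moves the derivatives of \<open>(x\<^sup>2 - 1)\<^sup>j\<close> onto \<open>q\<close>, one after another, until \<open>q\<close> is
  exhausted. There are no boundary terms, since a derivative of order below \<open>j\<close> still has
  the factor \<open>x\<^sup>2 - 1\<close>. By Rodrigues' formula this is the orthogonality of the Legendre polynomials.\<close>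

lemma unit_integral_bump_derivative:
  assumes "i \<le> j" "degree q < i"
  shows "unit_integral ((pderiv ^^ i) ([:- 1, 0, 1:] ^ j) * q) = 0"
  using assms
proof (induction i arbitrary: q)
  case (Suc i)
  define w where "w = (pderiv ^^ i) ([:- 1, 0, 1 :: real:] ^ j)"
  have "[:- 1, 0, 1:] ^ (j - i) dvd w"
    unfolding w_def using Suc.prems by (intro bump_power_dvd_derivative) simp
  moreover have "[:- 1, 0, 1:] dvd ([:- 1, 0, 1:] :: real poly) ^ (j - i)"
    using Suc.prems by (intro dvd_power) auto
  ultimately have "[:- 1, 0, 1:] dvd w"
    by (rule dvd_trans[rotated])
  then obtain r where r: "w = [:- 1, 0, 1:] * r"
    by (rule dvdE)
  have ends: "poly w 1 = 0" "poly w (- 1) = 0"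
    unfolding r poly_mult by simp_all
  have "unit_integral (w * pderiv q) = 0"
  proof (cases "degree q = 0")
    case True
    then have "pderiv q = 0" by (simp add: pderiv_eq_0_iff)
    then show ?thesis by (simp add: unit_integral_eq)
  next
    case False
    then have "degree (pderiv q) < i" using Suc.prems by (simp add: degree_pderiv)
    then show ?thesis unfolding w_def using Suc by simp
  qed
  moreover have "unit_integral (pderiv (w * q)) = 0"
    unfolding unit_integral_pderiv by (simp add: ends)
  moreover have "pderiv (w * q) = w * pderiv q + pderiv w * q"
    by (simp add: pderiv_mult algebra_simps)
  ultimately have "unit_integral (pderiv w * q) = 0"
    by (simp add: unit_integral_add)
  then show ?case by (simp add: w_def)
qed simp

lemma degree_legendre: "degree (legendre j) = j"
proof -
  have "degree ((pderiv ^^ i) p) = degree p - i" for i and p :: "real poly"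
    by (induction i) (auto simp: degree_pderiv)
  moreover have "degree ([:- 1, 0, 1 :: real:] ^ j) = 2 * j"
    by (simp add: degree_power_eq)
  ultimately show ?thesis by (simp add: legendre_def)
qed

lemma legendre_neq_0: "legendre j \<noteq> 0"
proof (cases "j = 0")
  case False
  then show ?thesis using degree_legendre[of j] by auto
qed (simp add: legendre_def)

lemma unit_integral_legendre:
  assumes "degree q < j"
  shows "unit_integral (legendre j * q) = 0"
  using unit_integral_bump_derivative[OF order_refl assms]
  by (simp add: legendre_def unit_integral_smult)

lemma legendre_orthogonal:
  assumes "i \<noteq> j"
  shows "unit_integral (legendre i * legendre j) = 0"
  using assms unit_integral_legendre[of "legendre i" j] unit_integral_legendre[of "legendre j" i]
  by (auto simp: degree_legendre mult.commute linorder_neq_iff)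

text \<open>There is one Legendre polynomial of each degree, so leading terms can be removed successively.\<close>

lemma legendre_expansion:
  assumes "q = 0 \<or> degree q < k"
  shows "\<exists>c. q = (\<Sum>i<k. smult (c i) (legendre i))"
  using assms
proof (induction k arbitrary: q)
  case (Suc k)
  define a where "a = coeff q k / coeff (legendre k) k"
  define r where "r = q - smult a (legendre k)"
  have lc: "coeff (legendre k) k \<noteq> 0"
    using leading_coeff_neq_0[OF legendre_neq_0[of k]] by (simp add: degree_legendre)
  have "degree r \<le> k"
    unfolding r_def using Suc.prems
    by (intro degree_diff_le) (auto intro: order_trans[OF degree_smult_le] simp: degree_legendre)
  moreover have "coeff r k = 0"
    using lc by (simp add: r_def a_def)
  ultimately have "r = 0 \<or> degree r < k"
    using leading_coeff_0_iff[of r] by (cases "degree r = k") auto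
  then obtain c where c: "r = (\<Sum>i<k. smult (c i) (legendre i))"
    using Suc.IH by blast
  have "q = (\<Sum>i<Suc k. smult ((c(k := a)) i) (legendre i))"
    using c by (simp add: r_def algebra_simps)
  then show ?case by blast
qed simp

text \<open>Being a combination of the polynomials it is tested with, \<open>q\<close> satisfies \<open>\<integral> q\<^sup>2 = 0\<close>.\<close>

lemma legendre_moments_determine:
  assumes "q = 0 \<or> degree q < k" "\<And>i. i < k \<Longrightarrow> unit_integral (q * legendre i) = 0"
  shows "q = 0"
proof -
  obtain c where c: "q = (\<Sum>i<k. smult (c i) (legendre i))"
    using legendre_expansion[OF assms(1)] by blast
  have "unit_integral (q * q) = unit_integral (q * (\<Sum>i<k. smult (c i) (legendre i)))"
    using c by simp
  also have "\<dots> = (\<Sum>i<k. c i * unit_integral (q * legendre i))"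
    by (simp add: sum_distrib_left unit_integral_sum unit_integral_smult)
  finally show ?thesis
    using assms(2) by (intro unit_integral_square_eq_0) simp
qed

section \<open>Gauss' theorem on a triangle\<close>

lemma set_integrable_lebesgue_compact:
  fixes h :: "'a::euclidean_space \<Rightarrow> 'b::euclidean_space"
  assumes "compact S" "continuous_on S h"
  shows "set_integrable lebesgue S h"
proof -
  have *: "integrable lborel (\<lambda>x. indicator S x *\<^sub>R h x)"
    by (rule borel_integrable_compact[OF assms])
  show ?thesis
    unfolding set_integrable_def
    using integrable_completion[OF borel_measurable_integrable[OF *]] * by simp
qed

lemma LINT_lebesgue_lborel_compact:
  fixes h :: "'a::euclidean_space \<Rightarrow> 'b::euclidean_space"
  assumes "compact S" "continuous_on S h"
  shows "(LINT x:S|lebesgue. h x) = (LINT x:S|lborel. h x)"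
proof -
  have *: "integrable lborel (\<lambda>x. indicator S x *\<^sub>R h x)"
    by (rule borel_integrable_compact[OF assms])
  show ?thesis
    unfolding set_lebesgue_integral_def
    using integral_completion[OF borel_measurable_integrable[OF *]] by simp
qed

text \<open>The coordinates are exchanged so that, in Fubini's theorem for \<open>real \<times> real\<close>, the inner integral
  runs over the first coordinate of the point.\<close>

definition swapped_point :: "real \<times> real \<Rightarrow> point" where
  "swapped_point z = (\<chi> i. if i = 1 then snd z else fst z)"

lemma swapped_point_nth [simp]: "swapped_point z $ 1 = snd z" "swapped_point z $ 2 = fst z"
  by (simp_all add: swapped_point_def)

lemma swapped_point_measurable [measurable]: "swapped_point \<in> borel_measurable borel"
proof -
  have "continuous_on UNIV (\<lambda>z :: real \<times> real. if i = 1 then snd z else fst z)" for i :: 2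
    by (cases "i = 1") (auto intro!: continuous_intros)
  then show ?thesis
    unfolding swapped_point_def[abs_def]
    by (intro borel_measurable_continuous_onI continuous_on_vec_lambda)
qed

lemma Basis_real2: "(Basis :: point set) = {axis 1 1, axis 2 1}"
  by (auto simp: Basis_vec_def UNIV_2)

lemma prod_Basis_real2:
  fixes h :: "point \<Rightarrow> real"
  shows "prod h Basis = h (axis 1 1) * h (axis 2 1)"
proof -
  have "axis 1 (1 :: real) \<noteq> (axis 2 1 :: point)"
    by (simp add: axis_eq_axis)
  then show ?thesis unfolding Basis_real2 by simp
qed

lemma distr_swapped_point: "distr lborel borel swapped_point = lborel"
proof (rule lborel_eqI[symmetric])
  fix l u :: point
  assume le: "\<And>b. b \<in> Basis \<Longrightarrow> l \<bullet> b \<le> u \<bullet> b"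
  have le': "l $ 1 \<le> u $ 1" "l $ 2 \<le> u $ 2"
    using le[of "axis 1 1"] le[of "axis 2 1"] by (auto simp: Basis_real2 inner_axis)
  have "swapped_point -` box l u = box (l $ 2, l $ 1) (u $ 2, u $ 1)"
    by (auto simp: mem_box_cart forall_2 mem_box Basis_prod_def)
  moreover have "emeasure lborel (box (l $ 2, l $ 1) (u $ 2, u $ 1)) = ennreal ((u $ 2 - l $ 2) * (u $ 1 - l $ 1))"
    using le' by (subst emeasure_lborel_box) (auto simp: Basis_prod_def)
  ultimately show "emeasure (distr lborel borel swapped_point) (box l u) = (\<Prod>b\<in>Basis. (u - l) \<bullet> b)"
    by (simp add: emeasure_distr prod_Basis_real2 inner_axis mult.commute)
qed simp

definition unit_triangle :: "point set" where
  "unit_triangle = {y. 0 \<le> y $ 1 \<and> 0 \<le> y $ 2 \<and> y $ 1 + y $ 2 \<le> 1}"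

lemma compact_unit_triangle: "compact unit_triangle"
proof -
  have "closed unit_triangle"
    unfolding unit_triangle_def
    by (intro closed_Collect_conj closed_Collect_le continuous_intros)
  moreover have "unit_triangle \<subseteq> cbox 0 (\<chi> i. 1)"
    by (auto simp: unit_triangle_def mem_box_cart forall_2)
  ultimately show ?thesis
    using bounded_cbox bounded_subset compact_eq_bounded_closed by blast
qed

lemma LINT_unit_triangle:
  fixes h :: "point \<Rightarrow> real"
  assumes "continuous_on UNIV h"
  shows "(LINT y:unit_triangle|lebesgue. h y) =
         (LINT t:{0..1}|lborel. LINT s:{0..1 - t}|lborel. h (swapped_point (t, s)))"
proof -
  define H where "H = (\<lambda>y. indicator unit_triangle y *\<^sub>R h y)"
  have int: "integrable lborel H"
    unfolding H_def using assms
    by (intro borel_integrable_compact compact_unit_triangle) (rule continuous_on_subset, auto)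
  have [measurable]: "H \<in> borel_measurable borel"
    using borel_measurable_integrable[OF int] by simp
  have int2: "integrable (lborel \<Otimes>\<^sub>M lborel) (\<lambda>z. H (swapped_point z))"
    using int unfolding lborel_prod distr_swapped_point[symmetric]
    by (subst (asm) integrable_distr_eq) (auto simp: distr_swapped_point)
  have "(LINT y:unit_triangle|lebesgue. h y) = integral\<^sup>L lborel H"
    using assms unfolding H_def set_lebesgue_integral_def[symmetric]
    by (intro LINT_lebesgue_lborel_compact compact_unit_triangle) (rule continuous_on_subset, auto)
  also have "\<dots> = integral\<^sup>L (distr lborel borel swapped_point) H"
    by (simp add: distr_swapped_point)
  also have "\<dots> = (LINT z|(lborel \<Otimes>\<^sub>M lborel). H (swapped_point z))"
    unfolding lborel_prod by (subst integral_distr) auto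
  also have "\<dots> = (LINT t|lborel. LINT s|lborel. H (swapped_point (t, s)))"
    by (rule lborel_pair.integral_fst'[OF int2, symmetric])
  also have "\<dots> = (LINT t:{0..1}|lborel. LINT s:{0..1 - t}|lborel. h (swapped_point (t, s)))"
    unfolding set_lebesgue_integral_def
  proof (rule Bochner_Integration.integral_cong[OF refl])
    fix t :: real
    have "H (swapped_point (t, s)) = indicator {0..1} t * (indicator {0..1 - t} s * h (swapped_point (t, s)))" for s
      by (auto simp: H_def unit_triangle_def indicator_def)
    then show "(LINT s|lborel. H (swapped_point (t, s))) =
        indicator {0..1} t *\<^sub>R (LINT s|lborel. indicator {0..1 - t} s *\<^sub>R h (swapped_point (t, s)))"
      by simp
  qed
  finally show ?thesis .
qed

text \<open>The determinant with columns \<open>u\<close> and \<open>v\<close>: twice the signed area of the triangle spanned by them.\<close>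

definition cross2 :: "point \<Rightarrow> point \<Rightarrow> real" where
  "cross2 u v = u $ 1 * v $ 2 - u $ 2 * v $ 1"

text \<open>The affine map that sends the corners of the unit triangle to \<open>a\<close>, \<open>b\<close> and \<open>c\<close> has the constant
  Jacobian determinant \<open>cross2 (b - a) (c - a)\<close>. The integrand is a vector field paired with a fixed
  vector, since this is the form of a directional derivative.\<close>

lemma triangle_change_of_variables:
  fixes D :: "point \<Rightarrow> point"
  assumes "cross2 (b - a) (c - a) \<noteq> 0" "continuous_on UNIV D"
  shows "(LINT x:convex hull {a, b, c}|lebesgue. D x \<bullet> v) =
    \<bar>cross2 (b - a) (c - a)\<bar> *
    (LINT y:unit_triangle|lebesgue. D (a + y $ 1 *\<^sub>R (b - a) + y $ 2 *\<^sub>R (c - a)) \<bullet> v)"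
proof -
  define \<Phi> :: "point \<Rightarrow> point" where "\<Phi> = (\<lambda>y. a + y $ 1 *\<^sub>R (b - a) + y $ 2 *\<^sub>R (c - a))"
  define L :: "point \<Rightarrow> point" where "L = (\<lambda>h. h $ 1 *\<^sub>R (b - a) + h $ 2 *\<^sub>R (c - a))"
  have image: "\<Phi> ` unit_triangle = convex hull {a, b, c}"
  proof -
    have "a + s *\<^sub>R (b - a) + t *\<^sub>R (c - a) = \<Phi> (vector [s, t])" for s t
      by (simp add: \<Phi>_def)
    then show ?thesis
      unfolding convex_hull_3_alt unit_triangle_def
      by (auto simp: \<Phi>_def image_iff Bex_def intro!: exI[of _ "vector [_, _]"])
  qed
  have deriv: "(\<Phi> has_derivative L) (at y within S)" for y S
    unfolding \<Phi>_def L_def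
    by (auto intro!: derivative_eq_intros bounded_linear.has_derivative[OF bounded_linear_vec_nth])
  have det: "det (matrix L) = cross2 (b - a) (c - a)"
    by (simp add: det_2 matrix_def L_def cross2_def axis_def algebra_simps)
  have inj: "inj_on \<Phi> unit_triangle"
  proof (rule inj_onI)
    fix y z assume "\<Phi> y = \<Phi> z"
    define s t where "s = y $ 1 - z $ 1" and "t = y $ 2 - z $ 2"
    have "s *\<^sub>R (b - a) + t *\<^sub>R (c - a) = 0"
      using \<open>\<Phi> y = \<Phi> z\<close> by (simp add: \<Phi>_def s_def t_def algebra_simps)
    then have 1: "s * (b - a) $ 1 + t * (c - a) $ 1 = 0" and 2: "s * (b - a) $ 2 + t * (c - a) $ 2 = 0"
      by (auto simp: vec_eq_iff forall_2)
    have "s * cross2 (b - a) (c - a) = 0" "t * cross2 (b - a) (c - a) = 0"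
      unfolding cross2_def using 1 2 by algebra+
    then show "y = z"
      using assms(1) by (auto simp: s_def t_def vec_eq_iff forall_2)
  qed
  have cont: "continuous_on S (\<lambda>y. D (\<Phi> y))" for S
    unfolding \<Phi>_def by (intro continuous_on_compose2[OF assms(2)] continuous_intros) auto
  have intK: "set_integrable lebesgue (convex hull {a, b, c}) D"
    using assms(2) by (intro set_integrable_lebesgue_compact compact_convex_hull) (auto intro: continuous_on_subset)
  have intR: "set_integrable lebesgue unit_triangle (\<lambda>y. D (\<Phi> y))"
    by (intro set_integrable_lebesgue_compact compact_unit_triangle cont)
  have "integral (\<Phi> ` unit_triangle) D = integral unit_triangle (\<lambda>y. \<bar>det (matrix L)\<bar> *\<^sub>R D (\<Phi> y))"
    using has_absolute_integral_change_of_variables_compact[OF compact_unit_triangle deriv inj, of D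
        "integral unit_triangle (\<lambda>y. \<bar>det (matrix L)\<bar> *\<^sub>R D (\<Phi> y))"]
      absolutely_integrable_scaleR_left[OF intR] by blast
  then have eq: "(LINT x:convex hull {a, b, c}|lebesgue. D x) =
      \<bar>cross2 (b - a) (c - a)\<bar> *\<^sub>R (LINT y:unit_triangle|lebesgue. D (\<Phi> y))"
    unfolding image det
    by (simp add: set_lebesgue_integral_eq_integral[OF intK] set_lebesgue_integral_eq_integral[OF intR])
  have inner: "(LINT x:S|lebesgue. h x \<bullet> v) = (LINT x:S|lebesgue. h x) \<bullet> v"
    if "set_integrable lebesgue S h" for S :: "point set" and h :: "point \<Rightarrow> point"
  proof -
    have "(LINT x:S|lebesgue. h x \<bullet> v) = (LINT x|lebesgue. (indicator S x *\<^sub>R h x) \<bullet> v)"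
      by (simp add: set_lebesgue_integral_def)
    also have "\<dots> = (LINT x:S|lebesgue. h x) \<bullet> v"
      unfolding set_lebesgue_integral_def
      using that unfolding set_integrable_def by (intro integral_inner_left) 
    finally show ?thesis .
  qed
  show ?thesis
    unfolding inner[OF intK] eq using inner[OF intR] by (simp add: \<Phi>_def)
qed

text \<open>A line parallel to the side \<open>ab\<close> crosses the triangle from the side \<open>ac\<close> to the side \<open>bc\<close>. The
  fundamental theorem of calculus on these segments and Fubini's theorem give the difference of
  the mean values of \<open>w\<close> over the two sides.\<close>

lemma LINT_triangle_edge_derivative:
  fixes w :: "point \<Rightarrow> real"
  assumes nc: "cross2 (b - a) (c - a) \<noteq> 0"
    and w: "\<And>x. GDERIV w x :> D x" and D: "continuous_on UNIV D"
  shows "(LINT x:convex hull {a, b, c}|lebesgue. D x \<bullet> (b - a)) =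
    \<bar>cross2 (b - a) (c - a)\<bar> *
    ((LINT t:{0..1}|lebesgue. w (linepath b c t)) - (LINT t:{0..1}|lebesgue. w (linepath a c t)))"
proof -
  define \<Phi> :: "point \<Rightarrow> point" where "\<Phi> = (\<lambda>y. a + y $ 1 *\<^sub>R (b - a) + y $ 2 *\<^sub>R (c - a))"
  have contw: "continuous_on S w" for S
    using w unfolding gderiv_def
    by (intro has_derivative_continuous_on) (blast intro: has_derivative_at_withinI)
  have contD: "continuous_on UNIV (\<lambda>y. D (\<Phi> y) \<bullet> (b - a))"
    unfolding \<Phi>_def by (intro continuous_intros continuous_on_compose2[OF D]) auto
  have inner: "(LINT s:{0..1 - t}|lborel. D (\<Phi> (swapped_point (t, s))) \<bullet> (b - a)) =
      w (linepath b c t) - w (linepath a c t)" if t: "t \<in> {0..1}" for t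
  proof -
    define F where "F = (\<lambda>s. w (a + s *\<^sub>R (b - a) + t *\<^sub>R (c - a)))"
    have *: "\<Phi> (swapped_point (t, s)) = a + s *\<^sub>R (b - a) + t *\<^sub>R (c - a)" for s
      by (simp add: \<Phi>_def)
    have "(LINT s:{0..1 - t}|lborel. D (\<Phi> (swapped_point (t, s))) \<bullet> (b - a)) = F (1 - t) - F 0"
      unfolding set_lebesgue_integral_def *
    proof (rule integral_FTC_atLeastAtMost)
      show "0 \<le> 1 - t" using t by simp
    next
      fix s
      have "((\<lambda>s. a + s *\<^sub>R (b - a) + t *\<^sub>R (c - a)) has_derivative (\<lambda>h. h *\<^sub>R (b - a))) (at s within {0..1 - t})"
        by (auto intro!: derivative_eq_intros)
      from has_derivative_compose[OF this w[unfolded gderiv_def]]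
      show "(F has_vector_derivative D (a + s *\<^sub>R (b - a) + t *\<^sub>R (c - a)) \<bullet> (b - a)) (at s within {0..1 - t})"
        unfolding has_vector_derivative_def F_def by (simp add: inner_commute)
    next
      show "continuous_on {0..1 - t} (\<lambda>s. D (a + s *\<^sub>R (b - a) + t *\<^sub>R (c - a)) \<bullet> (b - a))"
        by (intro continuous_intros continuous_on_compose2[OF D]) auto
    qed
    then show ?thesis
      by (simp add: F_def linepath_def algebra_simps)
  qed
  have cont: "continuous_on S (\<lambda>t. w (linepath p q t))" for p q S
    by (intro continuous_on_compose2[OF contw[of UNIV]] continuous_intros) auto
  have "(LINT x:convex hull {a, b, c}|lebesgue. D x \<bullet> (b - a)) =
      \<bar>cross2 (b - a) (c - a)\<bar> * (LINT y:unit_triangle|lebesgue. D (\<Phi> y) \<bullet> (b - a))"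
    unfolding \<Phi>_def by (rule triangle_change_of_variables[OF nc D])
  also have "(LINT y:unit_triangle|lebesgue. D (\<Phi> y) \<bullet> (b - a)) =
      (LINT t:{0..1}|lborel. LINT s:{0..1 - t}|lborel. D (\<Phi> (swapped_point (t, s))) \<bullet> (b - a))"
    by (rule LINT_unit_triangle[OF contD])
  also have "\<dots> = (LINT t:{0..1}|lborel. w (linepath b c t) - w (linepath a c t))"
    by (rule set_lebesgue_integral_cong) (use inner in auto)
  also have "\<dots> = (LINT t:{0..1}|lebesgue. w (linepath b c t) - w (linepath a c t))"
    by (rule LINT_lebesgue_lborel_compact[symmetric]) (auto intro!: continuous_intros cont)
  also have "\<dots> = (LINT t:{0..1}|lebesgue. w (linepath b c t)) - (LINT t:{0..1}|lebesgue. w (linepath a c t))"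
    by (intro set_integral_diff set_integrable_lebesgue_compact cont) auto
  finally show ?thesis .
qed

lemma LINT_linepath_swap:
  fixes w :: "point \<Rightarrow> real"
  assumes "continuous_on (closed_segment a b) w"
  shows "(LINT t:{0..1}|lebesgue. w (linepath a b t)) = (LINT t:{0..1}|lebesgue. w (linepath b a t))"
proof -
  have cont: "continuous_on {0..1} (\<lambda>t. w (linepath p q t))" if "continuous_on (closed_segment p q) w" for p q
    by (intro continuous_on_compose2[OF that] continuous_intros) (auto simp: linepath_in_path)
  have "(LINT t:{0..1}|lebesgue. w (linepath a b t)) = integral {0..1} (\<lambda>t. w (linepath a b t))"
    by (rule set_lebesgue_integral_eq_integral, rule set_integrable_lebesgue_compact)
      (use cont assms in auto)
  also have "\<dots> = integral {0..1} (\<lambda>t. w (linepath b a (1 - t)))"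
    by (simp add: linepath_def add.commute)
  also have "\<dots> = integral {0..1} (\<lambda>t. w (linepath b a t))"
  proof (rule integral_unique)
    have "(\<lambda>t. w (linepath b a t)) integrable_on {0..1}"
      by (rule integrable_continuous_interval, rule cont) (use assms in \<open>auto simp: closed_segment_commute\<close>)
    then have "((\<lambda>t. w (linepath b a t)) has_integral integral {0..1} (\<lambda>t. w (linepath b a t))) (cbox 0 1)"
      by (simp add: integrable_integral)
    from has_integral_affinity[OF this, of "-1" 1]
    have "((\<lambda>t. w (linepath b a (1 - t))) has_integral integral {0..1} (\<lambda>t. w (linepath b a t)))
        ((\<lambda>x. 1 - x) ` {0..1})"
      by simp
    also have "(\<lambda>x. 1 - x) ` {0..1} = {0..1 :: real}"
      by simp
    finally show "((\<lambda>t. w (linepath b a (1 - t))) has_integral integral {0..1} (\<lambda>t. w (linepath b a t))) {0..1}" .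
  qed
  also have "\<dots> = (LINT t:{0..1}|lebesgue. w (linepath b a t))"
    by (rule set_lebesgue_integral_eq_integral(2)[symmetric], rule set_integrable_lebesgue_compact)
      (use cont assms in \<open>auto simp: closed_segment_commute\<close>)
  finally show ?thesis .
qed

section \<open>Triangles and their edges\<close>

lemma cross2_eq_0_imp_collinear:
  assumes "cross2 (b - a) (c - a) = 0"
  shows "collinear {a, b, c}"
proof -
  define u v where "u = b - a" and "v = c - a"
  have uv: "u $ 1 * v $ 2 = u $ 2 * v $ 1"
    using assms by (simp add: cross2_def u_def v_def)
  have "u = 0 \<or> (\<exists>r. v = r *\<^sub>R u)"
  proof (rule disjCI)
    assume *: "\<nexists>r. v = r *\<^sub>R u"
    show "u = 0"
    proof (rule ccontr)
      assume "u \<noteq> 0"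
      then consider "u $ 1 \<noteq> 0" | "u $ 2 \<noteq> 0"
        by (auto simp: vec_eq_iff forall_2)
      then show False
      proof cases
        case 1
        then have "v = (v $ 1 / u $ 1) *\<^sub>R u"
          using uv by (simp add: vec_eq_iff forall_2 field_simps)
        then show False using * by blast
      next
        case 2
        then have "v = (v $ 2 / u $ 2) *\<^sub>R u"
          using uv by (simp add: vec_eq_iff forall_2 field_simps)
        then show False using * by blast
      qed
    qed
  qed
  then have "collinear {0, u, v}"
    using collinear_lemma[of u v] by auto
  then have "collinear {b, a, c}"
    using collinear_3[of b a c] by (simp add: u_def v_def insert_commute)
  then show ?thesis by (simp add: insert_commute)
qed

lemma triangle_vertices:
  assumes "2 simplex (K :: point set)"
  obtains a b c where "K = convex hull {a, b, c}" "\<not> affine_dependent {a, b, c}"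
    "a \<noteq> b" "b \<noteq> c" "a \<noteq> c" "cross2 (b - a) (c - a) \<noteq> 0"
proof -
  obtain C where C: "\<not> affine_dependent C" "card C = 3" "K = convex hull C"
    using assms by (auto simp: simplex_def)
  then obtain a b c where abc: "C = {a, b, c}" "a \<noteq> b" "b \<noteq> c" "a \<noteq> c"
    by (auto simp: card_3_iff)
  then have "cross2 (b - a) (c - a) \<noteq> 0"
    using cross2_eq_0_imp_collinear[of b a c] C(1) collinear_3_eq_affine_dependent[of a b c] by auto
  then show thesis using that abc C by blast
qed

lemma edge_of_triangle_iff:
  assumes "\<not> affine_dependent {a, b, c}" "a \<noteq> b" "b \<noteq> c" "a \<noteq> (c :: point)"
  shows "F edge_of (convex hull {a, b, c}) \<longleftrightarrow>
    F \<in> {closed_segment a b, closed_segment b c, closed_segment a c}"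
proof -
  have dim: "aff_dim (convex hull C) = int (card C) - 1" if "C \<subseteq> {a, b, c}" for C
    using affine_independent_subset[OF assms(1) that] by (simp add: aff_dim_convex_hull aff_dim_affine_independent)
  show ?thesis
  proof
    assume "F edge_of (convex hull {a, b, c})"
    then obtain C where C: "C \<subseteq> {a, b, c}" "F = convex hull C" "aff_dim F = 1"
      unfolding edge_of_def face_of_convex_hull_affine_independent[OF assms(1)] by blast
    then have "card C = 2" using dim[OF C(1)] by simp
    then obtain p q where "C = {p, q}" "p \<noteq> q" by (auto simp: card_2_iff)
    then show "F \<in> {closed_segment a b, closed_segment b c, closed_segment a c}"
      using C by (auto simp: segment_convex_hull insert_commute)
  next
    assume F: "F \<in> {closed_segment a b, closed_segment b c, closed_segment a c}"
    then obtain p q where pq: "{p, q} \<subseteq> {a, b, c}" "p \<noteq> q" "F = convex hull {p, q}"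
      using assms by (auto simp: segment_convex_hull)
    then show "F edge_of (convex hull {a, b, c})"
      unfolding edge_of_def face_of_convex_hull_affine_independent[OF assms(1)]
      using dim[OF pq(1)] by (metis One_nat_def Suc_1 add_diff_cancel_right' card_2_iff int_ops(2) of_nat_Suc)
  qed
qed

lemma triangle_edge_vertices:
  assumes "2 simplex K" "F edge_of K"
  obtains a b c where "K = convex hull {a, b, c}" "F = closed_segment a b" "cross2 (b - a) (c - a) \<noteq> 0"
proof -
  obtain a b c where abc: "K = convex hull {a, b, c}" "\<not> affine_dependent {a, b, c}"
    "a \<noteq> b" "b \<noteq> c" "a \<noteq> c" "cross2 (b - a) (c - a) \<noteq> 0"
    using triangle_vertices[OF assms(1)] .
  have "F = closed_segment a b \<or> F = closed_segment b c \<or> F = closed_segment a c"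
    using edge_of_triangle_iff[OF abc(2-5)] assms(2) unfolding abc(1) by simp
  moreover have "cross2 (c - b) (a - b) \<noteq> 0" "cross2 (c - a) (b - a) \<noteq> 0"
    using abc(6) by (auto simp: cross2_def algebra_simps)
  moreover have "K = convex hull {b, c, a}" "K = convex hull {a, c, b}"
    unfolding abc(1) by (simp_all add: insert_commute)
  ultimately show thesis
    using that abc(1,6) by blast
qed

lemma cross2_distinct: "cross2 (b - a) (c - a) \<noteq> 0 \<Longrightarrow> a \<noteq> b"
  by (auto simp: cross2_def)

lemma cross2_decomposition:
  assumes "cross2 x y \<noteq> 0"
  shows "v = (cross2 v y / cross2 x y) *\<^sub>R x + (cross2 x v / cross2 x y) *\<^sub>R y"
proof -
  have "cross2 x y * v $ i = cross2 v y * x $ i + cross2 x v * y $ i" for i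
    using exhaust_2[of i] by (auto simp: cross2_def algebra_simps)
  then have "v $ i = (cross2 v y * x $ i + cross2 x v * y $ i) / cross2 x y" for i
    using assms by (simp add: eq_divide_eq mult.commute)
  then show ?thesis
    by (simp add: vec_eq_iff add_divide_distrib)
qed

text \<open>The vector \<open>d\<close> is \<open>\<plusminus> norm d\<close> times the quarter turn of \<open>\<nu>\<close>, and the inner product with \<open>\<nu>\<close> is the
  determinant with its quarter turn.\<close>

lemma perpendicular_cross2:
  assumes "norm \<nu> = 1" "\<nu> \<bullet> d = 0"
  shows "norm d * \<bar>\<nu> \<bullet> v\<bar> = \<bar>cross2 d v\<bar>"
proof -
  define e where "e = \<nu> $ 1 * d $ 2 - \<nu> $ 2 * d $ 1"
  have \<nu>: "\<nu> $ 1 * \<nu> $ 1 + \<nu> $ 2 * \<nu> $ 2 = 1"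
    using assms(1) by (simp add: norm_eq_1 inner_vec_def sum_2)
  have perp: "\<nu> $ 1 * d $ 1 + \<nu> $ 2 * d $ 2 = 0"
    using assms(2) by (simp add: inner_vec_def sum_2)
  have d: "d $ 1 = - e * \<nu> $ 2" "d $ 2 = e * \<nu> $ 1"
    unfolding e_def using \<nu> perp by algebra+
  have "norm d ^ 2 = e ^ 2"
  proof -
    have "norm d ^ 2 = e ^ 2 * (\<nu> $ 1 * \<nu> $ 1 + \<nu> $ 2 * \<nu> $ 2)"
      unfolding power2_norm_eq_inner inner_vec_def sum_2 inner_real_def d
      by (simp add: algebra_simps power2_eq_square)
    then show ?thesis unfolding \<nu> by simp
  qed
  then have "norm d = \<bar>e\<bar>"
    by (metis abs_norm_cancel power2_eq_iff abs_minus abs_eq_iff)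
  moreover have "cross2 d v = - e * (\<nu> \<bullet> v)"
    unfolding cross2_def d by (simp add: inner_vec_def sum_2 algebra_simps)
  ultimately show ?thesis by (simp add: abs_mult)
qed

lemma outward_normal_perpendicular:
  assumes "outward_normal (convex hull {a, b, c}) (closed_segment a b) \<nu>"
  shows "\<nu> \<bullet> (b - a) = 0"
proof -
  have "a \<in> convex hull {a, b, c}" "b \<in> convex hull {a, b, c}" by (auto intro: hull_inc)
  then have "\<nu> \<bullet> (b - a) \<le> 0" "\<nu> \<bullet> (a - b) \<le> 0"
    using assms unfolding outward_normal_def by auto
  then show ?thesis by (simp add: inner_diff_right)
qed

lemma outward_normal_iff:
  assumes "norm \<nu> = 1" "\<nu> \<bullet> (b - a) = 0"
  shows "outward_normal (convex hull {a, b, c}) (closed_segment a b) \<nu> \<longleftrightarrow> \<nu> \<bullet> (c - a) \<le> 0"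
proof
  assume "outward_normal (convex hull {a, b, c}) (closed_segment a b) \<nu>"
  moreover have "c \<in> convex hull {a, b, c}" by (auto intro: hull_inc)
  ultimately show "\<nu> \<bullet> (c - a) \<le> 0"
    unfolding outward_normal_def by auto
next
  assume c: "\<nu> \<bullet> (c - a) \<le> 0"
  have "\<nu> \<bullet> (y - x) \<le> 0" if x: "x \<in> closed_segment a b" and y: "y \<in> convex hull {a, b, c}" for x y
  proof -
    obtain u v where uv: "y = a + u *\<^sub>R (b - a) + v *\<^sub>R (c - a)" "0 \<le> v"
      using y unfolding convex_hull_3_alt by blast
    obtain t where t: "x = a + t *\<^sub>R (b - a)"
      using x unfolding in_segment by (auto simp: algebra_simps)
    have "\<nu> \<bullet> (y - x) = v * (\<nu> \<bullet> (c - a)) + (u - t) * (\<nu> \<bullet> (b - a))"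
      unfolding uv t by (simp add: algebra_simps)
    then show ?thesis using assms(2) c uv(2) by (simp add: mult_nonneg_nonpos)
  qed
  then show "outward_normal (convex hull {a, b, c}) (closed_segment a b) \<nu>"
    using assms(1) by (simp add: outward_normal_def)
qed

text \<open>The distance of \<open>c\<close> from the line through \<open>a\<close> and \<open>b\<close>, times the length of that side, is twice
  the area; the sign says that \<open>\<nu>\<close> points away from \<open>c\<close>.\<close>

lemma outward_normal_height:
  assumes "outward_normal (convex hull {a, b, c}) (closed_segment a b) \<nu>"
  shows "norm (b - a) * (\<nu> \<bullet> (c - a)) = - \<bar>cross2 (b - a) (c - a)\<bar>"
proof -
  have \<nu>: "norm \<nu> = 1" "\<nu> \<bullet> (b - a) = 0"
    using assms outward_normal_perpendicular by (auto simp: outward_normal_def)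
  then have "\<nu> \<bullet> (c - a) \<le> 0"
    using assms outward_normal_iff by blast
  then show ?thesis
    using perpendicular_cross2[OF \<nu>, of "c - a"] by simp
qed

lemma diameter_closed_segment: "diameter (closed_segment a b) = norm (b - a)" for a b :: point
proof (rule antisym)
  show "diameter (closed_segment a b) \<le> norm (b - a)"
  proof (rule diameter_le)
    fix x y assume "x \<in> closed_segment a b" "y \<in> closed_segment a b"
    then obtain s t where st: "x = (1 - s) *\<^sub>R a + s *\<^sub>R b" "y = (1 - t) *\<^sub>R a + t *\<^sub>R b"
      "0 \<le> s" "s \<le> 1" "0 \<le> t" "t \<le> 1"
      unfolding in_segment by blast
    have "x - y = (s - t) *\<^sub>R (b - a)" unfolding st by (simp add: algebra_simps)
    then have "norm (x - y) = \<bar>s - t\<bar> * norm (b - a)" by simp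
    also have "\<dots> \<le> 1 * norm (b - a)"
      using st by (intro mult_right_mono) auto
    finally show "norm (x - y) \<le> norm (b - a)" by simp
  qed simp
  show "norm (b - a) \<le> diameter (closed_segment a b)"
    using diameter_bounded_bound[of "closed_segment a b" b a] by (simp add: dist_norm bounded_closed_segment)
qed

text \<open>Both sides are linear in \<open>v\<close>, so it suffices to take two sides of the triangle for \<open>v\<close>. For these
  the left-hand side is known from \<open>LINT_triangle_edge_derivative\<close>, and \<open>outward_normal_height\<close> shows that
  length times normal component equals \<open>0\<close> or \<open>\<plusminus>\<close> twice the area on the right-hand side. Reversal
  of an edge does not change the integral over it, so each edge may be run through either way.\<close>

lemma triangle_gauss:
  fixes w :: "point \<Rightarrow> real"
  assumes K: "2 simplex K"
    and normal: "\<And>F. F edge_of K \<Longrightarrow> outward_normal K F (N F)"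
    and ends: "\<And>F. F edge_of K \<Longrightarrow> F = closed_segment (s F) (e F)"
    and w: "\<And>x. GDERIV w x :> D x" and D: "continuous_on UNIV D"
  shows "(LINT x:K|lebesgue. D x \<bullet> v) =
    (\<Sum>F | F edge_of K. diameter F * (LINT t:{0..1}|lebesgue. w (linepath (s F) (e F) t)) * (N F \<bullet> v))"
proof -
  obtain a b c where abc: "K = convex hull {a, b, c}" "\<not> affine_dependent {a, b, c}"
    "a \<noteq> b" "b \<noteq> c" "a \<noteq> c" "cross2 (b - a) (c - a) \<noteq> 0"
    using triangle_vertices[OF K] .
  define J where "J = \<bar>cross2 (b - a) (c - a)\<bar>"
  have J: "\<bar>cross2 (c - b) (a - b)\<bar> = J" "\<bar>cross2 (c - a) (b - a)\<bar> = J"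
    unfolding J_def cross2_def by (auto simp: algebra_simps abs_if)
  define I where "I = (\<lambda>p q. LINT t:{0..1}|lebesgue. w (linepath p q t))"
  have contw: "continuous_on S w" for S
    using w unfolding gderiv_def
    by (intro has_derivative_continuous_on) (blast intro: has_derivative_at_withinI)
  have I_swap: "I p q = I q p" for p q
    unfolding I_def by (rule LINT_linepath_swap[OF contw])
  have edges: "{F. F edge_of K} = {closed_segment a b, closed_segment b c, closed_segment a c}"
    unfolding abc(1) using edge_of_triangle_iff[OF abc(2-5)] by blast
  have dist: "closed_segment a b \<noteq> closed_segment b c" "closed_segment a b \<noteq> closed_segment a c"
    "closed_segment b c \<noteq> closed_segment a c"
    using abc(3-5) by (auto simp: closed_segment_eq doubleton_eq_iff)
  have I_edge: "(LINT t:{0..1}|lebesgue. w (linepath (s F) (e F) t)) = I p q"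
    if "F edge_of K" "F = closed_segment p q" for F p q
  proof -
    have "{s F, e F} = {p, q}"
      using ends[OF that(1)] that(2) closed_segment_eq by metis
    then have "s F = p \<and> e F = q \<or> s F = q \<and> e F = p"
      by (auto simp: doubleton_eq_iff)
    then show ?thesis
      using I_swap[of p q] by (auto simp: I_def)
  qed
  define Nab Nbc Nac where "Nab = N (closed_segment a b)" and "Nbc = N (closed_segment b c)"
    and "Nac = N (closed_segment a c)"
  have onab: "outward_normal (convex hull {a, b, c}) (closed_segment a b) Nab"
    and onbc: "outward_normal (convex hull {b, c, a}) (closed_segment b c) Nbc"
    and onac: "outward_normal (convex hull {a, c, b}) (closed_segment a c) Nac"
    using normal edges unfolding abc(1) Nab_def Nbc_def Nac_def by (auto simp: insert_commute)
  define R where "R = (\<lambda>v. norm (b - a) * I a b * (Nab \<bullet> v) + norm (c - b) * I b c * (Nbc \<bullet> v) +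
      norm (c - a) * I a c * (Nac \<bullet> v))"
  have RHS: "(\<Sum>F | F edge_of K. diameter F * (LINT t:{0..1}|lebesgue. w (linepath (s F) (e F) t)) * (N F \<bullet> v)) = R v"
    for v
  proof -
    have "closed_segment a b edge_of K" "closed_segment b c edge_of K" "closed_segment a c edge_of K"
      using edges by blast+
    then show ?thesis
      unfolding edges R_def Nab_def Nbc_def Nac_def using dist
      by (simp add: I_edge diameter_closed_segment norm_minus_commute)
  qed
  define L where "L = (\<lambda>v. LINT x:K|lebesgue. D x \<bullet> v)"
  have L_lin: "L (\<alpha> *\<^sub>R u + \<beta> *\<^sub>R v) = \<alpha> * L u + \<beta> * L v" for \<alpha> \<beta> u v
  proof -
    have int: "set_integrable lebesgue K (\<lambda>x. D x \<bullet> z)" for z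
      unfolding abc(1)
      by (intro set_integrable_lebesgue_compact compact_convex_hull continuous_intros continuous_on_subset[OF D]) auto
    have "L (\<alpha> *\<^sub>R u + \<beta> *\<^sub>R v) = (LINT x:K|lebesgue. \<alpha> * (D x \<bullet> u) + \<beta> * (D x \<bullet> v))"
      unfolding L_def by (simp add: inner_add_right)
    also have "\<dots> = \<alpha> * L u + \<beta> * L v"
      unfolding L_def using int by (subst set_integral_add) auto
    finally show ?thesis .
  qed
  have "L (b - a) = J * (I b c - I a c)" "L (c - a) = J * (I c b - I a b)"
    using LINT_triangle_edge_derivative[OF _ w D, of b a c] LINT_triangle_edge_derivative[OF _ w D, of c a b]
      abc(6) J unfolding L_def I_def J_def abc(1) by (auto simp: insert_commute)
  moreover have "R (b - a) = J * (I b c - I a c)" "R (c - a) = J * (I c b - I a b)"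
  proof -
    have ab: "Nab \<bullet> (b - a) = 0" "norm (b - a) * (Nab \<bullet> (c - a)) = - J"
      using outward_normal_perpendicular[OF onab] outward_normal_height[OF onab] by (auto simp: J_def)
    have bc: "Nbc \<bullet> (c - b) = 0" "norm (c - b) * (Nbc \<bullet> (a - b)) = - J"
      using outward_normal_perpendicular[OF onbc] outward_normal_height[OF onbc] J by auto
    have ac: "Nac \<bullet> (c - a) = 0" "norm (c - a) * (Nac \<bullet> (b - a)) = - J"
      using outward_normal_perpendicular[OF onac] outward_normal_height[OF onac] J by auto
    have bc': "norm (c - b) * (Nbc \<bullet> (b - a)) = J" "norm (c - b) * (Nbc \<bullet> (c - a)) = J"
    proof -
      have "Nbc \<bullet> (b - a) = - (Nbc \<bullet> (a - b))" "Nbc \<bullet> (c - a) = - (Nbc \<bullet> (a - b)) + Nbc \<bullet> (c - b)"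
        by (simp_all add: inner_diff_right)
      then show "norm (c - b) * (Nbc \<bullet> (b - a)) = J" "norm (c - b) * (Nbc \<bullet> (c - a)) = J"
        using bc by simp_all
    qed
    have "R (b - a) = norm (b - a) * I a b * (Nab \<bullet> (b - a)) + I b c * (norm (c - b) * (Nbc \<bullet> (b - a)))
        + I a c * (norm (c - a) * (Nac \<bullet> (b - a)))"
      unfolding R_def by (simp only: mult_ac)
    then show "R (b - a) = J * (I b c - I a c)"
      unfolding ab(1) bc'(1) ac(2) by (simp add: algebra_simps)
    have "R (c - a) = I a b * (norm (b - a) * (Nab \<bullet> (c - a))) + I b c * (norm (c - b) * (Nbc \<bullet> (c - a)))
        + norm (c - a) * I a c * (Nac \<bullet> (c - a))"
      unfolding R_def by (simp only: mult_ac)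
    then show "R (c - a) = J * (I c b - I a b)"
      unfolding ab(2) bc'(2) ac(1) I_swap[of c b] by (simp add: algebra_simps)
  qed
  moreover have "v = (cross2 v (c - a) / cross2 (b - a) (c - a)) *\<^sub>R (b - a) +
      (cross2 (b - a) v / cross2 (b - a) (c - a)) *\<^sub>R (c - a)"
    using cross2_decomposition[OF abc(6)] .
  moreover have "R (\<alpha> *\<^sub>R u + \<beta> *\<^sub>R z) = \<alpha> * R u + \<beta> * R z" for \<alpha> \<beta> u z
    unfolding R_def by (simp add: inner_add_right algebra_simps)
  ultimately have "L v = R v"
    using L_lin by metis
  then show ?thesis
    unfolding RHS by (simp add: L_def)
qed


section \<open>Triangulations\<close>

text \<open>Two triangles on the same side of a common edge overlap near the midpoint of this edge. In a
  triangulation their intersection is a common face, and a face that contains the edge properly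
  is the whole triangle.\<close>

lemma same_side_triangles_eq:
  assumes "2 simplex K" "2 simplex K'" "F edge_of K" "F edge_of K'"
    and on: "outward_normal K F \<nu>" "outward_normal K' F \<nu>"
    and faces: "(K \<inter> K') face_of K" "(K \<inter> K') face_of K'"
  shows "K = K'"
proof -
  obtain a b c where K: "K = convex hull {a, b, c}" "F = closed_segment a b" "cross2 (b - a) (c - a) \<noteq> 0"
    using triangle_edge_vertices assms by metis
  obtain a' b' c' where K': "K' = convex hull {a', b', c'}" "F = closed_segment a' b'" "cross2 (b' - a') (c' - a') \<noteq> 0"
    using triangle_edge_vertices assms by metis
  have "\<exists>d. K' = convex hull {a, b, d} \<and> cross2 (b - a) (d - a) \<noteq> 0"
  proof -
    have "{a, b} = {a', b'}" using K(2) K'(2) closed_segment_eq by metis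
    then consider "a' = a" "b' = b" | "a' = b" "b' = a" by (auto simp: doubleton_eq_iff)
    then show ?thesis
    proof cases
      case 2
      then have "K' = convex hull {a, b, c'}" "cross2 (b - a) (c' - a) \<noteq> 0"
        using K'(1,3) by (auto simp: insert_commute cross2_def algebra_simps)
      then show ?thesis by blast
    qed (use K' in auto)
  qed
  then obtain d where d: "K' = convex hull {a, b, d}" "cross2 (b - a) (d - a) \<noteq> 0" by blast
  have perp: "\<nu> \<bullet> (b - a) = 0"
    using outward_normal_perpendicular on(1) unfolding K by blast
  have neg: "\<nu> \<bullet> (c - a) < 0" "\<nu> \<bullet> (d - a) < 0"
    using outward_normal_height[of a b c \<nu>] outward_normal_height[of a b d \<nu>] on K d
    by (smt (verit, ccfv_SIG) mult_nonneg_nonneg norm_ge_zero zero_less_abs_iff)+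
  define \<alpha> \<beta> where "\<alpha> = cross2 (c - a) (d - a) / cross2 (b - a) (d - a)"
    and "\<beta> = cross2 (b - a) (c - a) / cross2 (b - a) (d - a)"
  have c: "c - a = \<alpha> *\<^sub>R (b - a) + \<beta> *\<^sub>R (d - a)"
    using cross2_decomposition[OF d(2)] unfolding \<alpha>_def \<beta>_def .
  have "\<nu> \<bullet> (c - a) = \<beta> * (\<nu> \<bullet> (d - a))"
    unfolding c using perp by (simp add: inner_add_right)
  then have \<beta>: "\<beta> > 0"
    using neg by (smt (verit) mult_nonneg_nonpos mult_nonpos_nonpos)
  \<comment> \<open>A point of both triangles close to the midpoint of the common edge; \<open>\<epsilon>\<close> is small enough for
    its barycentric coordinates in the second triangle to stay nonnegative.\<close>
  define \<epsilon> where "\<epsilon> = 1 / (2 * (1 + \<bar>\<alpha>\<bar> + \<beta>))"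
  define y where "y = a + (1 / 2) *\<^sub>R (b - a) + \<epsilon> *\<^sub>R (c - a)"
  have den: "0 < 1 + \<bar>\<alpha>\<bar> + \<beta>" using \<beta> by linarith
  then have \<epsilon>: "\<epsilon> > 0" "\<epsilon> * (1 + \<bar>\<alpha>\<bar> + \<beta>) = 1 / 2" by (simp_all add: \<epsilon>_def)
  then have expand: "\<epsilon> + \<epsilon> * \<bar>\<alpha>\<bar> + \<epsilon> * \<beta> = 1 / 2" by (simp add: algebra_simps)
  have pos: "0 \<le> \<epsilon> * \<bar>\<alpha>\<bar>" "0 < \<epsilon> * \<beta>" using \<epsilon> \<beta> by simp_all
  have abs: "\<epsilon> * \<alpha> \<le> \<epsilon> * \<bar>\<alpha>\<bar>" "- (\<epsilon> * \<alpha>) \<le> \<epsilon> * \<bar>\<alpha>\<bar>"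
    using \<epsilon>(1) by (auto simp: abs_if)
  have "1 / 2 + \<epsilon> \<le> 1" using expand pos by linarith
  then have "y \<in> K"
    unfolding K convex_hull_3_alt y_def using \<epsilon>(1)
    by (intro CollectI exI[of _ "1 / 2"] exI[of _ \<epsilon>] conjI) auto
  moreover have "y \<in> K'"
  proof -
    have "y = a + (1 / 2 + \<epsilon> * \<alpha>) *\<^sub>R (b - a) + (\<epsilon> * \<beta>) *\<^sub>R (d - a)"
      unfolding y_def c by (simp add: algebra_simps)
    moreover have "0 \<le> 1 / 2 + \<epsilon> * \<alpha>" "1 / 2 + \<epsilon> * \<alpha> + \<epsilon> * \<beta> \<le> 1"
      using \<epsilon>(1) expand pos abs by linarith+
    ultimately show ?thesis
      unfolding d(1) convex_hull_3_alt using pos(2)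
      by (intro CollectI exI[of _ "1 / 2 + \<epsilon> * \<alpha>"] exI[of _ "\<epsilon> * \<beta>"] conjI) auto
  qed
  moreover have "y \<notin> F"
  proof
    assume "y \<in> F"
    then obtain t where "y = a + t *\<^sub>R (b - a)"
      unfolding K in_segment by (auto simp: algebra_simps)
    then have "\<nu> \<bullet> (y - a) = 0" using perp by simp
    moreover have "\<nu> \<bullet> (y - a) = \<epsilon> * (\<nu> \<bullet> (c - a))"
      unfolding y_def using perp by (simp add: inner_add_right)
    ultimately show False using neg(1) \<epsilon>(1) by simp
  qed
  ultimately have neF: "K \<inter> K' \<noteq> F" by blast
  have top: "K0 = K \<inter> K'" if "2 simplex K0" "F edge_of K0" "(K \<inter> K') face_of K0" for K0
  proof (rule ccontr)
    assume "K0 \<noteq> K \<inter> K'"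
    then have lt: "aff_dim (K \<inter> K') < 2"
      using face_of_aff_dim_lt[of K0 "K \<inter> K'"] convex_simplex aff_dim_simplex that by fastforce
    have "F \<subseteq> K \<inter> K'"
      using assms(3,4) edge_of_imp_subset by blast
    moreover have "K \<inter> K' \<subseteq> K0" using that(3) face_of_imp_subset by blast
    ultimately have "F face_of (K \<inter> K')"
      using that(2) face_of_subset unfolding edge_of_def by blast
    then have "aff_dim F < aff_dim (K \<inter> K')"
      using face_of_aff_dim_lt[of "K \<inter> K'" F] neF face_of_imp_convex[OF that(3)] convex_simplex[OF that(1)] by auto
    then show False using lt assms(3) by (simp add: edge_of_def)
  qed
  show ?thesis
    using top[of K] top[of K'] assms by simp
qed

lemma segment_tangent:
  fixes n :: "point set \<Rightarrow> point"
  assumes "F = closed_segment a b" "a \<noteq> b" "norm (n F) = 1" "n F \<bullet> (b - a) = 0"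
  shows "b - a = diameter F *\<^sub>R tangent n F \<or> a - b = diameter F *\<^sub>R tangent n F"
proof -
  define d where "d = b - a"
  define e where "e = tangent n F \<bullet> d"
  have n: "n F $ 1 * n F $ 1 + n F $ 2 * n F $ 2 = 1"
    using assms(3) by (simp add: norm_eq_1 inner_vec_def sum_2)
  have perp: "n F $ 1 * d $ 1 + n F $ 2 * d $ 2 = 0"
    using assms(4) by (simp add: inner_vec_def sum_2 d_def)
  have t: "tangent n F $ 1 = - n F $ 2" "tangent n F $ 2 = n F $ 1"
    by (simp_all add: tangent_def)
  have e: "e = n F $ 1 * d $ 2 - n F $ 2 * d $ 1"
    by (simp add: e_def inner_vec_def sum_2 t)
  have "d $ 1 = - e * n F $ 2" "d $ 2 = e * n F $ 1"
    unfolding e using n perp by algebra+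
  then have d: "d = e *\<^sub>R tangent n F"
    by (simp add: vec_eq_iff forall_2 t)
  have "norm (tangent n F) = 1"
    using n by (simp add: norm_eq_1 inner_vec_def sum_2 t)
  then have "norm d = \<bar>e\<bar>"
    using d by (metis norm_scaleR mult.right_neutral)
  then have "diameter F = \<bar>e\<bar>"
    using assms(1) by (simp add: d_def diameter_closed_segment)
  then show ?thesis
    using d unfolding d_def by (cases "e \<ge> 0") (auto simp: algebra_simps minus_equation_iff)
qed

text \<open>The ends of a segment are determined up to their order, and the tangent fixes the order. So the
  definite descriptions that define start and end are meaningful.\<close>

lemma edge_start_end:
  fixes n :: "point set \<Rightarrow> point"
  assumes "F = closed_segment a b" "a \<noteq> b" "norm (n F) = 1" "n F \<bullet> (b - a) = 0"
  shows "F = closed_segment (edge_start n F) (edge_end n F)"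
    and "edge_end n F - edge_start n F = diameter F *\<^sub>R tangent n F"
proof -
  obtain s e where se: "F = closed_segment s e" "e - s = diameter F *\<^sub>R tangent n F"
    using segment_tangent[of F a b n, OF assms] assms(1) closed_segment_commute[of a b] by blast
  have uniq: "s' = s \<and> e' = e" if "F = closed_segment s' e'" "e' - s' = diameter F *\<^sub>R tangent n F" for s' e'
  proof -
    have "{s', e'} = {s, e}" using that(1) se(1) closed_segment_eq by metis
    then have "s' = s \<and> e' = e \<or> s' = e \<and> e' = s" by (auto simp: doubleton_eq_iff)
    moreover have "e' - s' = e - s" using that(2) se(2) by simp
    moreover have "e = s" if "s - e = e - s"
    proof -
      have "2 *\<^sub>R e = 2 *\<^sub>R s"
        using that by (simp add: scaleR_2 algebra_simps)
      then show ?thesis by simp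
    qed
    ultimately show ?thesis by auto
  qed
  have "edge_start n F = s"
    unfolding edge_start_def by (rule the_equality) (use se uniq in blast)+
  moreover have "edge_end n F = e"
    unfolding edge_end_def by (rule the_equality) (use se uniq in blast)+
  ultimately show "F = closed_segment (edge_start n F) (edge_end n F)"
    and "edge_end n F - edge_start n F = diameter F *\<^sub>R tangent n F"
    by (simp_all only: se)
qed

locale triangulated_domain =
  fixes \<Omega> :: "point set" and \<T> :: "point set set" and n :: "point set \<Rightarrow> point"
  assumes open_domain: "open \<Omega>"
    and triangulation: "triangulation \<T>"
    and triangles: "K \<in> \<T> \<Longrightarrow> 2 simplex K"
    and covering: "\<Union>\<T> = closure \<Omega>"
    and normals: "edge_normals \<Omega> \<T> n"
begin

lemma finite_elements: "finite \<T>"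
  using triangulation by (simp add: triangulation_def)

lemma intersection_face:
  assumes "K \<in> \<T>" "K' \<in> \<T>"
  shows "(K \<inter> K') face_of K" "(K \<inter> K') face_of K'"
proof -
  have *: "(T \<inter> T') face_of T" if "T \<in> \<T>" "T' \<in> \<T>" for T T'
    using triangulation that unfolding triangulation_def by blast
  show "(K \<inter> K') face_of K" "(K \<inter> K') face_of K'"
    using *[OF assms] *[OF assms(2,1)] by (simp_all add: Int_commute)
qed

lemma edgesI: "K \<in> \<T> \<Longrightarrow> F edge_of K \<Longrightarrow> F \<in> edges \<T>"
  unfolding edges_def by blast

lemma finite_edges_of_element:
  assumes "K \<in> \<T>"
  shows "finite {F. F edge_of K}"
proof -
  obtain a b c where abc: "K = convex hull {a, b, c}" "\<not> affine_dependent {a, b, c}"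
    "a \<noteq> b" "b \<noteq> c" "a \<noteq> c" "cross2 (b - a) (c - a) \<noteq> 0"
    using triangle_vertices[OF triangles[OF assms]] .
  have "{F. F edge_of K} = {closed_segment a b, closed_segment b c, closed_segment a c}"
    unfolding abc(1) using edge_of_triangle_iff[OF abc(2-5)] by blast
  then show ?thesis by simp
qed

lemma finite_edges: "finite (edges \<T>)"
proof -
  have "edges \<T> = (\<Union>K\<in>\<T>. {F. F edge_of K})"
    unfolding edges_def by blast
  then show ?thesis using finite_elements finite_edges_of_element by simp
qed

lemma normal:
  assumes "F \<in> edges \<T>"
  shows "norm (n F) = 1" "\<And>x y. x \<in> F \<Longrightarrow> y \<in> F \<Longrightarrow> n F \<bullet> (x - y) = 0"
  using normals assms unfolding edge_normals_def by blast+

lemma edge_ends: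
  assumes "F \<in> edges \<T>"
  shows "F = closed_segment (edge_start n F) (edge_end n F)"
    and "edge_end n F - edge_start n F = diameter F *\<^sub>R tangent n F"
    and "diameter F > 0"
    and "norm (tangent n F) = 1"
proof -
  obtain K where K: "K \<in> \<T>" "F edge_of K" using assms unfolding edges_def by blast
  obtain a b c where "K = convex hull {a, b, c}" and abc: "F = closed_segment a b" "cross2 (b - a) (c - a) \<noteq> 0"
    using triangle_edge_vertices[OF triangles[OF K(1)] K(2)] .
  have "a \<noteq> b" using cross2_distinct[OF abc(2)] .
  moreover have "n F \<bullet> (b - a) = 0" using normal(2)[OF assms] abc(1) by simp
  ultimately show "F = closed_segment (edge_start n F) (edge_end n F)"
    and "edge_end n F - edge_start n F = diameter F *\<^sub>R tangent n F"
    using edge_start_end[of F a b n, OF abc(1) _ normal(1)[OF assms]] by blast+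
  show "diameter F > 0"
    using \<open>a \<noteq> b\<close> unfolding abc(1) by (simp add: diameter_closed_segment)
  have "norm (tangent n F) = norm (n F)"
    by (simp add: norm_eq_sqrt_inner inner_vec_def sum_2 tangent_def add.commute)
  then show "norm (tangent n F) = 1" using normal(1)[OF assms] by simp
qed

lemma outward_normal_unique_sign:
  assumes "K \<in> \<T>" "F edge_of K" "outward_normal K F \<nu>"
  shows "\<not> outward_normal K F (- \<nu>)"
proof
  assume neg: "outward_normal K F (- \<nu>)"
  obtain a b c where abc: "K = convex hull {a, b, c}" "F = closed_segment a b" "cross2 (b - a) (c - a) \<noteq> 0"
    using triangle_edge_vertices[OF triangles[OF assms(1)] assms(2)] .
  show False
    using outward_normal_height[of a b c \<nu>] outward_normal_height[of a b c "- \<nu>"] assms(3) neg abc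
    by simp
qed

lemma outward_normal_mu:
  assumes "K \<in> \<T>" "F edge_of K"
  shows "outward_normal K F (mu n K F *\<^sub>R n F)"
proof -
  obtain a b c where abc: "K = convex hull {a, b, c}" "F = closed_segment a b" "cross2 (b - a) (c - a) \<noteq> 0"
    using triangle_edge_vertices[OF triangles[OF assms(1)] assms(2)] .
  have F: "F \<in> edges \<T>" using edgesI assms .
  have "norm (n F) = 1" "n F \<bullet> (b - a) = 0"
    using normal[OF F] abc(2) by auto
  then have "outward_normal K F (n F) \<or> outward_normal K F (- n F)"
    using outward_normal_iff[of "n F" b a c] outward_normal_iff[of "- n F" b a c] abc by auto
  then show ?thesis by (auto simp: mu_def)
qed

lemma mu_cases: "mu n K F = 1 \<or> mu n K F = - 1"
  by (simp add: mu_def)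

lemma element_unique:
  assumes "K \<in> \<T>" "K' \<in> \<T>" "F edge_of K" "F edge_of K'"
    "outward_normal K F \<nu>" "outward_normal K' F \<nu>"
  shows "K = K'"
  using same_side_triangles_eq[OF triangles[OF assms(1)] triangles[OF assms(2)] assms(3-6)]
    intersection_face[OF assms(1,2)] by blast

text \<open>Points that approach the edge from outside \<open>K0\<close>, near a relatively interior point of the edge
  that lies in the domain, belong to the domain. As there are finitely many elements, one of them
  contains infinitely many of these points, hence also their limit on the edge. It
  meets \<open>K0\<close> in a face that contains the edge and is not \<open>K0\<close>, that is, in the edge itself.\<close>

lemma opposite_element:
  assumes K0: "K0 \<in> \<T>" and F: "F edge_of K0" and interior: "\<not> F \<subseteq> frontier \<Omega>"
    and on: "outward_normal K0 F \<nu>"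
  obtains K' where "K' \<in> \<T>" "F edge_of K'" "outward_normal K' F (- \<nu>)"
proof -
  have simplex0: "2 simplex K0" using triangles K0 .
  have face: "F face_of K0" and dimF: "aff_dim F = 1" and sub: "F \<subseteq> K0"
    using F edge_of_imp_subset unfolding edge_of_def by blast+
  obtain x0 where x0: "x0 \<in> F" "x0 \<notin> frontier \<Omega>" using interior by blast
  then have "x0 \<in> closure \<Omega>" using sub covering K0 by blast
  then have "x0 \<in> \<Omega>" using x0(2) open_domain by (simp add: frontier_def interior_open)
  have "convex F" using face_of_imp_convex[OF face] convex_simplex[OF simplex0] by blast
  have "x0 \<in> closure (rel_interior F)"
    using convex_closure_rel_interior[OF \<open>convex F\<close>] x0(1) closure_subset by blast
  then have "\<Omega> \<inter> rel_interior F \<noteq> {}"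
    using open_Int_closure_eq_empty[OF open_domain] \<open>x0 \<in> \<Omega>\<close> by blast
  then obtain x where x: "x \<in> \<Omega>" "x \<in> rel_interior F" by blast
  then have "x \<in> F" using rel_interior_subset by blast
  obtain e where e: "e > 0" "ball x e \<subseteq> \<Omega>"
    using open_domain x(1) open_contains_ball by blast
  have norm_\<nu>: "norm \<nu> = 1" using on by (simp add: outward_normal_def)
  define y where "y = (\<lambda>m. x + (e / real (m + 2)) *\<^sub>R \<nu>)"
  have dist_y: "dist x (y m) = e / real (m + 2)" for m
    using e(1) norm_\<nu> by (simp add: y_def dist_norm)
  have "\<exists>K\<in>\<T>. y m \<in> K" for m
  proof -
    have "e * 1 < e * real (m + 2)" using e(1) by (intro mult_strict_left_mono) auto
    then have "e / real (m + 2) < e" by (simp add: divide_less_eq)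
    then have "y m \<in> \<Omega>" using e(2) dist_y by auto
    then show ?thesis using covering closure_subset by blast
  qed
  \<comment> \<open>Infinitely many of the points approaching the edge from outside \<open>K0\<close> share an element.\<close>
  then have "\<exists>K\<in>\<T>. infinite {m \<in> UNIV. y m \<in> K}"
    by (intro pigeonhole_infinite_rel finite_elements) auto
  then obtain K' where K': "K' \<in> \<T>" "infinite {m. y m \<in> K'}" by auto
  have simplex': "2 simplex K'" using triangles K'(1) .
  have "x \<in> closure K'"
    unfolding closure_approachable
  proof (intro allI impI)
    fix \<epsilon> :: real assume "\<epsilon> > 0"
    obtain N where N: "e / \<epsilon> < real N" using reals_Archimedean2 by blast
    obtain m where m: "m > N" "y m \<in> K'"
      using K'(2) unfolding infinite_nat_iff_unbounded by blast
    have "e / real (m + 2) < \<epsilon>"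
    proof -
      have "e / \<epsilon> < real (m + 2)" using N m(1) by linarith
      then show ?thesis using \<open>\<epsilon> > 0\<close> by (simp add: divide_less_eq mult.commute)
    qed
    then show "\<exists>z\<in>K'. dist z x < \<epsilon>"
      using m(2) dist_y by (metis dist_commute)
  qed
  then have "x \<in> K'" using closed_simplex[OF simplex'] by simp
  obtain m where m: "y m \<in> K'" using K'(2) not_finite_existsD by blast
  have pos: "\<nu> \<bullet> (y m - x) > 0"
    using e(1) norm_\<nu> by (simp add: y_def norm_eq_1)
  have "F \<subseteq> K0 \<inter> K'"
    using subset_of_face_of[OF intersection_face(1)[OF K0 K'(1)] sub] x(2) \<open>x \<in> K'\<close> \<open>x \<in> F\<close> sub by blast
  then have face': "F face_of (K0 \<inter> K')"
    using face_of_subset[OF face] by blast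
  have conv: "convex K0" "convex K'" "convex (K0 \<inter> K')"
    using convex_simplex simplex0 simplex' convex_Int by blast+
  have "K0 \<inter> K' \<noteq> K0"
  proof
    assume eq: "K0 \<inter> K' = K0"
    have "K0 = K'"
    proof (rule ccontr)
      assume "K0 \<noteq> K'"
      then have "aff_dim K0 < aff_dim K'"
        using face_of_aff_dim_lt[OF conv(2) intersection_face(2)[OF K0 K'(1)]] eq by simp
      then show False using aff_dim_simplex[OF simplex0] aff_dim_simplex[OF simplex'] by simp
    qed
    then show False
      using on pos m \<open>x \<in> F\<close> unfolding outward_normal_def by (meson not_le)
  qed
  then have "aff_dim (K0 \<inter> K') < 2"
    using face_of_aff_dim_lt[OF conv(1) intersection_face(1)[OF K0 K'(1)]] aff_dim_simplex[OF simplex0] by simp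
  then have "F = K0 \<inter> K'"
    using face_of_aff_dim_lt[OF conv(3) face'] dimF by fastforce
  then have edge': "F edge_of K'"
    using intersection_face(2)[OF K0 K'(1)] dimF by (simp add: edge_of_def)
  moreover have "outward_normal K' F (- \<nu>)"
  proof -
    obtain a b c where abc: "K' = convex hull {a, b, c}" "F = closed_segment a b" "cross2 (b - a) (c - a) \<noteq> 0"
      using triangle_edge_vertices[OF simplex' edge'] .
    have "a \<in> K0" "b \<in> K0" using sub abc(2) by auto
    then have "\<nu> \<bullet> (b - a) = 0"
      using on abc(2) unfolding outward_normal_def by (smt (verit) ends_in_segment inner_diff_right)
    moreover have "\<not> outward_normal K' F \<nu>"
      using pos m \<open>x \<in> F\<close> unfolding outward_normal_def by (meson not_le)
    ultimately show ?thesis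
      using outward_normal_iff[of \<nu> b a c] outward_normal_iff[of "- \<nu>" b a c] norm_\<nu> abc by auto
  qed
  ultimately show thesis using that K'(1) by blast
qed

text \<open>On a boundary edge the normal is outward by the choice of the normals; on an interior edge
  there is an element on either side. In both cases uniqueness comes from \<open>same_side_triangles_eq\<close>.\<close>

lemma K_minus:
  assumes "F \<in> edges \<T>"
  shows "K_minus \<T> n F \<in> \<T>" "F edge_of K_minus \<T> n F" "outward_normal (K_minus \<T> n F) F (n F)"
proof -
  obtain K where K: "K \<in> \<T>" "F edge_of K" using assms unfolding edges_def by blast
  have "\<exists>K. K \<in> \<T> \<and> F edge_of K \<and> outward_normal K F (n F)"
  proof (cases "F \<subseteq> frontier \<Omega>")
    case True
    then show ?thesis using normals K assms unfolding edge_normals_def by blast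
  next
    case False
    from mu_cases[of K F] show ?thesis
    proof
      assume "mu n K F = 1"
      then show ?thesis using outward_normal_mu[OF K] K by auto
    next
      assume "mu n K F = - 1"
      then have "outward_normal K F (- n F)" using outward_normal_mu[OF K] by simp
      from opposite_element[OF K False this] show ?thesis by auto
    qed
  qed
  then have "\<exists>!K. K \<in> \<T> \<and> F edge_of K \<and> outward_normal K F (n F)"
    using element_unique by blast
  from theI'[OF this] show "K_minus \<T> n F \<in> \<T>" "F edge_of K_minus \<T> n F"
    "outward_normal (K_minus \<T> n F) F (n F)"
    unfolding K_minus_def by blast+
qed

lemma K_plus:
  assumes "F \<in> interior_edges \<Omega> \<T>"
  shows "K_plus \<T> n F \<in> \<T>" "F edge_of K_plus \<T> n F" "outward_normal (K_plus \<T> n F) F (- n F)"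
proof -
  have F: "F \<in> edges \<T>" "\<not> F \<subseteq> frontier \<Omega>"
    using assms by (auto simp: interior_edges_def)
  have "\<exists>K. K \<in> \<T> \<and> F edge_of K \<and> outward_normal K F (- n F)"
    using opposite_element[OF K_minus(1,2)[OF F(1)] F(2) K_minus(3)[OF F(1)]] by blast
  then have "\<exists>!K. K \<in> \<T> \<and> F edge_of K \<and> outward_normal K F (- n F)"
    using element_unique by blast
  from theI'[OF this] show "K_plus \<T> n F \<in> \<T>" "F edge_of K_plus \<T> n F"
    "outward_normal (K_plus \<T> n F) F (- n F)"
    unfolding K_plus_def by blast+
qed

lemma mu_K_minus: "F \<in> edges \<T> \<Longrightarrow> mu n (K_minus \<T> n F) F = 1"
  using K_minus(3) by (simp add: mu_def)

lemma mu_K_plus: "F \<in> interior_edges \<Omega> \<T> \<Longrightarrow> mu n (K_plus \<T> n F) F = - 1"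
  using K_plus outward_normal_unique_sign[of "K_plus \<T> n F" F "- n F"] by (simp add: mu_def)

text \<open>If \<open>K\<close> lies on the side of the edge to which \<open>n F\<close> points, then \<open>F\<close> cannot be a boundary edge,
  because normals are outward there.\<close>

lemma element_of_edge_cases:
  assumes "K \<in> \<T>" "F edge_of K"
  shows "K = K_minus \<T> n F \<or> F \<in> interior_edges \<Omega> \<T> \<and> K = K_plus \<T> n F"
proof -
  have F: "F \<in> edges \<T>" using edgesI assms .
  from mu_cases[of K F] show ?thesis
  proof
    assume "mu n K F = 1"
    then show ?thesis
      using outward_normal_mu[OF assms] element_unique[OF assms(1) _ assms(2)] K_minus[OF F] by auto
  next
    assume "mu n K F = - 1"
    then have on: "outward_normal K F (- n F)" using outward_normal_mu[OF assms] by simp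
    then have "\<not> outward_normal K F (n F)" using outward_normal_unique_sign[OF assms on] by simp
    then have "\<not> F \<subseteq> frontier \<Omega>"
      using normals F assms unfolding edge_normals_def by blast
    then have "F \<in> interior_edges \<Omega> \<T>" using F by (simp add: interior_edges_def)
    then show ?thesis
      using on element_unique[OF assms(1) _ assms(2)] K_plus by blast
  qed
qed

lemma K_minus_neq_K_plus: "F \<in> interior_edges \<Omega> \<T> \<Longrightarrow> K_minus \<T> n F \<noteq> K_plus \<T> n F"
  using mu_K_minus[of F] mu_K_plus[of F] by (auto simp: interior_edges_def)

lemma elements_of_edge:
  assumes "F \<in> edges \<T>"
  shows "{K \<in> \<T>. F edge_of K} =
    (if F \<in> interior_edges \<Omega> \<T> then {K_minus \<T> n F, K_plus \<T> n F} else {K_minus \<T> n F})"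
  using element_of_edge_cases[of _ F] K_minus[OF assms] K_plus[of F] by auto

lemma sum_over_element_edges:
  fixes h :: "point set \<Rightarrow> point set \<Rightarrow> real"
  shows "(\<Sum>K\<in>\<T>. \<Sum>F | F edge_of K. h K F) =
    (\<Sum>F\<in>edges \<T>. h (K_minus \<T> n F) F + (if F \<in> interior_edges \<Omega> \<T> then h (K_plus \<T> n F) F else 0))"
proof -
  have "(\<Sum>K\<in>\<T>. \<Sum>F | F edge_of K. h K F) = (\<Sum>K\<in>\<T>. \<Sum>F | F \<in> edges \<T> \<and> F edge_of K. h K F)"
    by (intro sum.cong refl) (auto intro: edgesI)
  also have "\<dots> = (\<Sum>F\<in>edges \<T>. \<Sum>K | K \<in> \<T> \<and> F edge_of K. h K F)"
    by (rule sum.swap_restrict[OF finite_elements finite_edges])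
  also have "\<dots> = (\<Sum>F\<in>edges \<T>. h (K_minus \<T> n F) F + (if F \<in> interior_edges \<Omega> \<T> then h (K_plus \<T> n F) F else 0))"
    using K_minus_neq_K_plus by (intro sum.cong refl) (auto simp: elements_of_edge)
  finally show ?thesis .
qed

end

section \<open>Integrals up to null sets\<close>

lemma AE_lebesgue_negligible: "negligible N \<Longrightarrow> AE x in lebesgue. x \<notin> N"
  by (intro AE_not_in) (simp add: negligible_iff_null_sets)

text \<open>Lebesgue measure is complete, hence a function that agrees almost everywhere with a measurable
  one is measurable. This is why the functions may be arbitrary on null sets such as the skeleton
  of the mesh.\<close>

lemma LINT_lebesgue_cong_negligible:
  fixes h h' :: "'a::euclidean_space \<Rightarrow> 'b::euclidean_space"
  assumes "negligible N" "\<And>x. x \<notin> N \<Longrightarrow> indicator S x *\<^sub>R h x = indicator S' x *\<^sub>R h' x"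
  shows "(LINT x:S|lebesgue. h x) = (LINT x:S'|lebesgue. h' x)"
    and "set_integrable lebesgue S h \<longleftrightarrow> set_integrable lebesgue S' h'"
    and "set_borel_measurable lebesgue S h \<longleftrightarrow> set_borel_measurable lebesgue S' h'"
proof -
  define H H' where "H = (\<lambda>x. indicator S x *\<^sub>R h x)" and "H' = (\<lambda>x. indicator S' x *\<^sub>R h' x)"
  have ae: "AE x in lebesgue. H x = H' x"
    using AE_lebesgue_negligible[OF assms(1)] by eventually_elim (simp add: H_def H'_def assms(2))
  then have ae': "AE x in lebesgue. H' x = H x" by eventually_elim simp
  have meas: "H \<in> borel_measurable lebesgue \<longleftrightarrow> H' \<in> borel_measurable lebesgue"
    using borel_measurable_AE[OF _ ae] borel_measurable_AE[OF _ ae'] by blast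
  then show "set_borel_measurable lebesgue S h \<longleftrightarrow> set_borel_measurable lebesgue S' h'"
    by (simp add: set_borel_measurable_def H_def H'_def)
  have int: "integrable lebesgue H \<longleftrightarrow> integrable lebesgue H'"
    using meas integrable_cong_AE[OF _ _ ae] borel_measurable_integrable by blast
  then show "set_integrable lebesgue S h \<longleftrightarrow> set_integrable lebesgue S' h'"
    by (simp add: set_integrable_def H_def H'_def)
  have "integral\<^sup>L lebesgue H = integral\<^sup>L lebesgue H'"
  proof (cases "integrable lebesgue H")
    case True
    then show ?thesis
      using int ae by (intro integral_cong_AE borel_measurable_integrable) auto
  next
    case False
    then show ?thesis using int by (simp add: not_integrable_integral_eq)
  qed
  then show "(LINT x:S|lebesgue. h x) = (LINT x:S'|lebesgue. h' x)"
    by (simp add: set_lebesgue_integral_def H_def H'_def)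
qed

lemma frontier_triangle_negligible:
  "2 simplex (K :: point set) \<Longrightarrow> negligible (frontier K)"
  using convex_simplex negligible_convex_frontier by blast

lemma triangle_in_sets: "2 simplex (K :: point set) \<Longrightarrow> K \<in> sets lebesgue"
  by (metis borel_closed closed_simplex sets_completionI_sets sets_lborel)

lemma in_triangle_cases:
  assumes "2 simplex (K :: point set)" "x \<notin> frontier K"
  shows "x \<in> K \<longleftrightarrow> x \<in> interior K"
  using assms closed_simplex[OF assms(1)] interior_subset by (auto simp: frontier_def)

lemma LINT_triangle_cong:
  fixes h h' :: "point \<Rightarrow> 'b::euclidean_space"
  assumes "2 simplex K" "\<And>x. x \<in> interior K \<Longrightarrow> h x = h' x"
  shows "(LINT x:K|lebesgue. h x) = (LINT x:K|lebesgue. h' x)"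
    and "set_integrable lebesgue K h \<longleftrightarrow> set_integrable lebesgue K h'"
  using in_triangle_cases[OF assms(1)] assms(2)
  by (intro LINT_lebesgue_cong_negligible[OF frontier_triangle_negligible[OF assms(1)]];
      auto simp: indicator_def)+

text \<open>The set of the zeros of \<open>h\<close>, together with the complement of the interior of \<open>K\<close>, is closed and has
  full measure.\<close>

lemma LINT_square_eq_0_triangle:
  fixes h :: "point \<Rightarrow> real"
  assumes "2 simplex K" "continuous_on UNIV h" "(LINT x:K|lebesgue. h x * h x) = 0" "x \<in> interior K"
  shows "h x = 0"
proof (rule ccontr)
  assume "h x \<noteq> 0"
  have int: "set_integrable lebesgue K (\<lambda>x. h x * h x)"
    using compact_simplex[OF assms(1)]
    by (rule set_integrable_lebesgue_compact) (intro continuous_intros continuous_on_subset[OF assms(2)], auto)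
  then have "integrable lebesgue (\<lambda>x. indicator K x *\<^sub>R (h x * h x))"
    by (simp add: set_integrable_def)
  from integral_nonneg_eq_0_iff_AE[OF this] assms(3)
  have ae: "AE x in lebesgue. indicator K x * (h x * h x) = 0"
    unfolding set_lebesgue_integral_def by (simp add: indicator_def)
  define C where "C = {x. x \<in> interior K \<longrightarrow> h x = 0}"
  have "C = - (interior K \<inter> h -` (- {0}))" by (auto simp: C_def)
  moreover have "open (interior K \<inter> h -` (- {0}))"
    by (intro open_Int open_interior open_vimage assms(2)) auto
  ultimately have "closed C" by (simp add: closed_def)
  moreover have "AE x in lebesgue. x \<in> C"
    using ae by eventually_elim (use interior_subset in \<open>auto simp: C_def indicator_def split: if_splits\<close>)
  ultimately have "x \<in> C" by (rule mem_closed_if_AE_lebesgue)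
  then show False using assms(4) \<open>h x \<noteq> 0\<close> by (simp add: C_def)
qed


section \<open>Traces\<close>

lemma interior_triangle_nonempty:
  assumes "2 simplex (K :: point set)"
  shows "interior K \<noteq> {}"
proof -
  have "aff_dim K = int DIM(point)" using aff_dim_simplex[OF assms] by simp
  then have "rel_interior K = interior K"
    using rel_interior_interior aff_dim_eq_full by blast
  moreover have "K \<noteq> {}" using aff_dim_simplex[OF assms] by auto
  ultimately show ?thesis
    using rel_interior_eq_empty convex_simplex[OF assms] by metis
qed

lemma triangle_islimpt_interior:
  assumes "2 simplex (K :: point set)" "x \<in> K"
  shows "x islimpt interior K"
proof (cases "x \<in> interior K")
  case True
  then show ?thesis using interior_limit_point[of x "interior K"] by simp
next
  case False
  have "x \<in> closure (interior K)"
    using convex_closure_interior[OF convex_simplex[OF assms(1)] interior_triangle_nonempty[OF assms(1)]]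
      assms(2) closure_subset by blast
  then show ?thesis using False by (simp add: closure_def)
qed

lemma trace_from_eq:
  fixes v p :: "point \<Rightarrow> 'b::t2_space"
  assumes "2 simplex K" "continuous_on UNIV p" "\<And>y. y \<in> interior K \<Longrightarrow> v y = p y" "x \<in> K"
  shows "trace_from K v x = p x"
proof -
  have "(p \<longlongrightarrow> p x) (at x within interior K)"
    using assms(2) by (meson UNIV_I continuous_on_def subset_UNIV tendsto_within_subset)
  then have "(v \<longlongrightarrow> p x) (at x within interior K)"
    by (rule Lim_transform_eventually) (use assms(3) in \<open>auto simp: eventually_at_filter\<close>)
  moreover have "at x within interior K \<noteq> bot"
    using triangle_islimpt_interior[OF assms(1,4)] trivial_limit_within by blast
  ultimately show ?thesis
    unfolding trace_from_def by (intro tendsto_Lim)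
qed


section \<open>Moments on edges\<close>

text \<open>The end points of the edge form a null set. They are left out because Neumann data are
  controlled in the relative interior of an edge only.\<close>

lemma edge_integral_cong:
  assumes "\<And>t. 0 < t \<Longrightarrow> t < 1 \<Longrightarrow> v (linepath (edge_start n F) (edge_end n F) t) = w (linepath (edge_start n F) (edge_end n F) t)"
  shows "edge_integral n F v = edge_integral n F w"
  unfolding edge_integral_def
  by (rule arg_cong[of _ _ "\<lambda>y. diameter F * y"], rule LINT_lebesgue_cong_negligible(1)[of "{0, 1}"])
    (use assms in \<open>auto simp: indicator_def\<close>)

lemma edge_integral_0: "edge_integral n F (\<lambda>x. 0) = 0"
  by (simp add: edge_integral_def)

lemma continuous_on_linepath_comp:
  fixes v :: "point \<Rightarrow> real"
  shows "continuous_on UNIV v \<Longrightarrow> continuous_on S (\<lambda>t. v (linepath a b t))"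
  by (rule continuous_on_compose2[of UNIV v]) (auto intro: continuous_on_linepath)

lemma edge_integral_add:
  assumes "continuous_on UNIV v" "continuous_on UNIV w"
  shows "edge_integral n F (\<lambda>x. v x + w x) = edge_integral n F v + edge_integral n F w"
  unfolding edge_integral_def
  by (subst set_integral_add(2))
    (auto intro!: set_integrable_lebesgue_compact continuous_on_linepath_comp assms simp: distrib_left)

lemma edge_integral_cmult: "edge_integral n F (\<lambda>x. c * v x) = c * edge_integral n F v"
  unfolding edge_integral_def by simp

lemma edge_integral_diff:
  assumes "continuous_on UNIV v" "continuous_on UNIV w"
  shows "edge_integral n F (\<lambda>x. v x - w x) = edge_integral n F v - edge_integral n F w"
  using edge_integral_add[of "v" "\<lambda>x. - 1 * w x"] edge_integral_cmult[of n F "- 1" w] assms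
  by (simp add: continuous_on_minus)

lemma edge_integral_sum:
  assumes "\<And>i. i \<in> I \<Longrightarrow> continuous_on UNIV (v i)"
  shows "edge_integral n F (\<lambda>x. \<Sum>i\<in>I. v i x) = (\<Sum>i\<in>I. edge_integral n F (v i))"
  using assms
  by (induction I rule: infinite_finite_induct)
    (auto simp: edge_integral_0 edge_integral_add continuous_on_sum)

lemma polys_on_segment:
  assumes "p \<in> polys m"
  shows "\<exists>q. (q = 0 \<or> int (degree q) \<le> m) \<and> (\<forall>t. p (linepath a b t) = poly q (2 * t - 1))"
proof -
  obtain q where q: "q = 0 \<or> int (degree q) \<le> m"
    "\<And>t. p ((1 / 2) *\<^sub>R (a + b) + t *\<^sub>R ((1 / 2) *\<^sub>R (b - a))) = poly q t"
    using polys_on_line[OF assms] by blast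
  have "linepath a b t = (1 / 2) *\<^sub>R (a + b) + (2 * t - 1) *\<^sub>R ((1 / 2) *\<^sub>R (b - a))" for t
    by (simp add: linepath_def vec_eq_iff forall_2 field_simps)
  then show ?thesis using q by metis
qed

context triangulated_domain
begin

lemma linepath_in_edge:
  assumes "F \<in> edges \<T>" "0 \<le> t" "t \<le> 1"
  shows "linepath (edge_start n F) (edge_end n F) t \<in> F"
  using edge_ends(1)[OF assms(1)] linepath_in_path[of t "edge_start n F" "edge_end n F"] assms by auto

lemma edge_integral_cong_on:
  assumes "F \<in> edges \<T>" "\<And>x. x \<in> F \<Longrightarrow> v x = w x"
  shows "edge_integral n F v = edge_integral n F w"
  using assms linepath_in_edge[OF assms(1)] by (intro edge_integral_cong) simp

lemma edge_point:
  assumes "F \<in> edges \<T>" "x \<in> F"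
  obtains t where "0 \<le> t" "t \<le> 1" "x = linepath (edge_start n F) (edge_end n F) t"
proof -
  have "x \<in> closed_segment (edge_start n F) (edge_end n F)"
    using assms(2) by (subst (asm) edge_ends(1)[OF assms(1)])
  then show thesis using that by (auto simp: in_segment linepath_def)
qed

lemma rel_interior_edge:
  assumes "F \<in> edges \<T>" "0 < t" "t < 1"
  shows "linepath (edge_start n F) (edge_end n F) t \<in> rel_interior F"
proof -
  have "edge_start n F \<noteq> edge_end n F"
    using edge_ends[OF assms(1)] by auto
  then have "rel_interior F = open_segment (edge_start n F) (edge_end n F)"
    using edge_ends(1)[OF assms(1)] rel_interior_closed_segment by metis
  then show ?thesis
    using assms \<open>edge_start n F \<noteq> edge_end n F\<close> by (auto simp: in_segment linepath_def)
qed

abbreviation moment :: "point set \<Rightarrow> nat \<Rightarrow> (point \<Rightarrow> real) \<Rightarrow> real" where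
  "moment F j v \<equiv> edge_integral n F (\<lambda>x. v x * legendre_edge n j F x)"

lemma legendre_edge_linepath:
  assumes "F \<in> edges \<T>"
  shows "legendre_edge n j F (linepath (edge_start n F) (edge_end n F) t) = poly (legendre j) (2 * t - 1)"
proof -
  have "linepath (edge_start n F) (edge_end n F) t - edge_start n F = t *\<^sub>R (edge_end n F - edge_start n F)"
    by (simp add: linepath_def algebra_simps)
  also have "\<dots> = (t * diameter F) *\<^sub>R tangent n F"
    unfolding edge_ends(2)[OF assms] by simp
  finally have "(linepath (edge_start n F) (edge_end n F) t - edge_start n F) \<bullet> tangent n F = t * diameter F"
    using edge_ends(4)[OF assms] by (simp add: norm_eq_1)
  then show ?thesis
    using edge_ends(3)[OF assms] by (simp add: legendre_edge_def)
qed

lemma legendre_edge_polys: "legendre_edge n j F \<in> polys (int j)"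
proof -
  define p where "p = (\<lambda>x. 2 * ((x - edge_start n F) \<bullet> tangent n F) / diameter F - 1)"
  have "(\<lambda>x. (2 / diameter F) * (tangent n F \<bullet> x) + (- 2 * (edge_start n F \<bullet> tangent n F) / diameter F - 1)) \<in> polys 1"
    by (intro polys_add polys_cmult polys_inner polys_const) simp
  also have "(\<lambda>x. (2 / diameter F) * (tangent n F \<bullet> x) + (- 2 * (edge_start n F \<bullet> tangent n F) / diameter F - 1)) = p"
    by (auto simp: p_def fun_eq_iff inner_diff_left inner_commute diff_divide_distrib algebra_simps)
  finally have "p \<in> polys 1" .
  then have "(\<lambda>x. poly (legendre j) (p x)) \<in> polys (int j)"
    by (rule polys_affine_comp) (simp add: degree_legendre)
  moreover have "legendre_edge n j F = (\<lambda>x. poly (legendre j) (p x))"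
    by (simp add: fun_eq_iff legendre_edge_def p_def)
  ultimately show ?thesis by simp
qed

lemma legendre_edge_continuous: "continuous_on S (legendre_edge n j F)"
  using polys_continuous_on[OF legendre_edge_polys] .

lemma legendre_edge_orthogonal:
  assumes "F \<in> edges \<T>" "i \<noteq> j"
  shows "moment F j (legendre_edge n i F) = 0"
proof -
  have "moment F j (legendre_edge n i F) =
      diameter F * unit_integral (legendre i * legendre j)"
    unfolding edge_integral_def unit_integral_def by (simp add: legendre_edge_linepath[OF assms(1)])
  then show ?thesis using legendre_orthogonal[OF assms(2)] by simp
qed

lemma polys_edge_expansion:
  assumes "F \<in> edges \<T>" "p \<in> polys (int k - 1)"
  obtains c where "\<And>x. x \<in> F \<Longrightarrow> p x = (\<Sum>i<k. c i * legendre_edge n i F x)"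
proof -
  obtain q where q: "q = 0 \<or> int (degree q) \<le> int k - 1"
    "\<And>t. p (linepath (edge_start n F) (edge_end n F) t) = poly q (2 * t - 1)"
    using polys_on_segment[OF assms(2)] by blast
  obtain c where c: "q = (\<Sum>i<k. smult (c i) (legendre i))"
    using legendre_expansion[of q k] q(1) by auto
  have "p x = (\<Sum>i<k. c i * legendre_edge n i F x)" if x: "x \<in> F" for x
  proof -
    obtain t where t: "x = linepath (edge_start n F) (edge_end n F) t"
      using edge_point[OF assms(1) x] by blast
    show ?thesis
      unfolding t q(2) legendre_edge_linepath[OF assms(1)] by (simp add: c poly_sum)
  qed
  then show thesis using that by blast
qed

text \<open>In this form Legendre moments serve to identify normal components: two polynomials of degree
  below \<open>k\<close> on an edge that have the same moments are equal there.\<close>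

lemma edge_moments_determine:
  assumes "F \<in> edges \<T>" "p \<in> polys (int k - 1)"
    and "\<And>i. i < k \<Longrightarrow> moment F i p = 0"
    and "x \<in> F"
  shows "p x = 0"
proof -
  obtain q where q: "q = 0 \<or> int (degree q) \<le> int k - 1"
    "\<And>t. p (linepath (edge_start n F) (edge_end n F) t) = poly q (2 * t - 1)"
    using polys_on_segment[OF assms(2)] by blast
  have "unit_integral (q * legendre i) = 0" if "i < k" for i
  proof -
    have "moment F i p = diameter F * unit_integral (q * legendre i)"
      unfolding edge_integral_def unit_integral_def by (simp add: legendre_edge_linepath[OF assms(1)] q(2))
    then show ?thesis using assms(3)[OF that] edge_ends(3)[OF assms(1)] by simp
  qed
  then have "q = 0"
    using legendre_moments_determine[of q k] q(1) by auto
  then show ?thesis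
    using edge_point[OF assms(1,4)] q(2) by (metis poly_0)
qed

text \<open>Testing \<open>v\<close> with a polynomial amounts to knowing its Legendre moments. The function \<open>p\<close> may be
  a restricted bivariate polynomial or the Neumann data.\<close>

lemma edge_integral_expansion:
  assumes "continuous_on UNIV v" "F \<in> edges \<T>"
    and "\<And>t. 0 < t \<Longrightarrow> t < 1 \<Longrightarrow> p (linepath (edge_start n F) (edge_end n F) t) =
      (\<Sum>i<k. c i * legendre_edge n i F (linepath (edge_start n F) (edge_end n F) t))"
  shows "edge_integral n F (\<lambda>x. v x * p x) =
    (\<Sum>i<k. c i * moment F i v)"
proof -
  have "edge_integral n F (\<lambda>x. v x * p x) = edge_integral n F (\<lambda>x. \<Sum>i<k. c i * (v x * legendre_edge n i F x))"
    using assms(3) by (intro edge_integral_cong) (simp add: sum_distrib_left mult_ac)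
  also have "\<dots> = (\<Sum>i<k. c i * moment F i v)"
    by (subst edge_integral_sum)
      (auto intro!: continuous_intros assms(1) legendre_edge_continuous simp: edge_integral_cmult)
  finally show ?thesis .
qed

end


section \<open>Green's formula\<close>

text \<open>The classical divergence of a continuously differentiable field, by gradients of the
  components, since Gauss' theorem is applied to one component at a time.\<close>

definition has_C1_div :: "(point \<Rightarrow> point) \<Rightarrow> (point \<Rightarrow> real) \<Rightarrow> bool" where
  "has_C1_div G d \<longleftrightarrow> (\<exists>D1 D2. (\<forall>x. GDERIV (\<lambda>x. G x $ 1) x :> D1 x) \<and> (\<forall>x. GDERIV (\<lambda>x. G x $ 2) x :> D2 x) \<and>
     continuous_on UNIV D1 \<and> continuous_on UNIV D2 \<and> (\<forall>x. d x = D1 x $ 1 + D2 x $ 2))"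

lemma GDERIV_imp_continuous_on:
  assumes "\<And>x. GDERIV w x :> D x"
  shows "continuous_on S w"
  using assms unfolding gderiv_def
  by (intro has_derivative_continuous_on) (blast intro: has_derivative_at_withinI)

lemma GDERIV_unique_grad: "GDERIV w x :> D \<Longrightarrow> grad w x = D"
  unfolding grad_def
proof (rule the_equality)
  fix D' assume "GDERIV w x :> D" "GDERIV w x :> D'"
  then have "(\<lambda>h. h \<bullet> D) = (\<lambda>h. h \<bullet> D')"
    unfolding gderiv_def by (rule has_derivative_unique)
  then have "(D' - D) \<bullet> D = (D' - D) \<bullet> D'" by (rule fun_cong)
  then have "(D' - D) \<bullet> (D' - D) = 0"
    by (simp only: inner_diff_right[of "D' - D"] diff_self)
  then show "D' = D" by simp
qed

lemma polys_grad:
  assumes "p \<in> polys m"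
  shows "GDERIV p x :> grad p x" "continuous_on S (grad p)"
    and "(\<lambda>x. grad p x $ i) \<in> polys (m - 1)"
proof -
  obtain q1 q2 where q: "q1 \<in> polys (m - 1)" "q2 \<in> polys (m - 1)" "\<And>x. GDERIV p x :> vector [q1 x, q2 x]"
    using polys_GDERIV[OF assms] by blast
  have grad: "grad p = (\<lambda>x. vector [q1 x, q2 x])"
    using GDERIV_unique_grad[OF q(3)] by blast
  show "GDERIV p x :> grad p x" unfolding grad by (rule q(3))
  show comp: "(\<lambda>x. grad p x $ i) \<in> polys (m - 1)" for i
    unfolding grad using q(1,2) exhaust_2[of i] by auto
  have "continuous_on S (\<lambda>x. \<chi> i. grad p x $ i)"
    by (intro continuous_on_vec_lambda polys_continuous_on[OF comp])
  then show "continuous_on S (grad p)" by simp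
qed

lemma grad_eq_on_open:
  assumes "open S" "x \<in> S" "\<And>y. y \<in> S \<Longrightarrow> v y = p y" "GDERIV p x :> D"
  shows "grad v x = D"
proof (rule GDERIV_unique_grad)
  have "(v has_derivative (\<lambda>h. h \<bullet> D)) (at x)"
    using assms(4) unfolding gderiv_def
    by (rule has_derivative_transform_within_open[OF _ assms(1,2)]) (simp add: assms(3))
  then show "GDERIV v x :> D" by (simp add: gderiv_def)
qed

text \<open>The field \<open>r x\<close> has degree \<open>m + 1\<close>, but its divergence \<open>2 r + x \<bullet> \<nabla>r\<close> has only degree \<open>m\<close>.\<close>

lemma rt_field_divergence:
  assumes "p \<in> polys m" "q \<in> polys m" "r \<in> polys m"
  shows "\<exists>d\<in>polys m. has_C1_div (\<lambda>x. vector [p x, q x] + r x *\<^sub>R x) d"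
proof -
  define D1 D2 where "D1 = (\<lambda>x::point. grad p x + (x $ 1) *\<^sub>R grad r x + r x *\<^sub>R axis 1 1)"
    and "D2 = (\<lambda>x::point. grad q x + (x $ 2) *\<^sub>R grad r x + r x *\<^sub>R axis 2 1)"
  define d where "d = (\<lambda>x. D1 x $ 1 + D2 x $ 2)"
  have der: "(p has_derivative (\<lambda>h. h \<bullet> grad p x)) (at x)" "(q has_derivative (\<lambda>h. h \<bullet> grad q x)) (at x)"
    "(r has_derivative (\<lambda>h. h \<bullet> grad r x)) (at x)" for x
    using polys_grad(1) assms unfolding gderiv_def by blast+
  have "((\<lambda>x. p x + r x * x $ 1) has_derivative (\<lambda>h. h \<bullet> D1 x)) (at x)"
    "((\<lambda>x. q x + r x * x $ 2) has_derivative (\<lambda>h. h \<bullet> D2 x)) (at x)" for x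
    unfolding D1_def D2_def
    by (auto intro!: derivative_eq_intros der bounded_linear.has_derivative[OF bounded_linear_vec_nth]
        simp: fun_eq_iff inner_add_right inner_axis algebra_simps)
  then have "\<forall>x. GDERIV (\<lambda>x. (vector [p x, q x] + r x *\<^sub>R x) $ 1) x :> D1 x"
    "\<forall>x. GDERIV (\<lambda>x. (vector [p x, q x] + r x *\<^sub>R x :: point) $ 2) x :> D2 x"
    by (auto simp: gderiv_def)
  moreover have "continuous_on UNIV D1" "continuous_on UNIV D2"
    unfolding D1_def D2_def
    by (intro continuous_intros polys_grad(2)[OF assms(1)] polys_grad(2)[OF assms(2)] polys_grad(2)[OF assms(3)]
        polys_continuous_on[OF assms(3)])+
  ultimately have "has_C1_div (\<lambda>x. vector [p x, q x] + r x *\<^sub>R x) d"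
    unfolding has_C1_div_def d_def by blast
  moreover have "d \<in> polys m"
  proof -
    have low: "(\<lambda>x. grad s x $ i) \<in> polys m" "(\<lambda>x. x $ i * grad s x $ i) \<in> polys m" if "s \<in> polys m" for s i
      using polys_mono[OF polys_grad(3)[OF that]] polys_mult[OF polys_coord polys_grad(3)[OF that]] by simp_all
    have "(\<lambda>x. grad p x $ 1 + x $ 1 * grad r x $ 1 + r x + (grad q x $ 2 + x $ 2 * grad r x $ 2 + r x)) \<in> polys m"
      by (intro polys_add low assms)
    moreover have "d = (\<lambda>x. grad p x $ 1 + x $ 1 * grad r x $ 1 + r x + (grad q x $ 2 + x $ 2 * grad r x $ 2 + r x))"
      by (simp add: d_def D1_def D2_def fun_eq_iff)
    ultimately show ?thesis by simp
  qed
  ultimately show ?thesis by blast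
qed

lemma rt_field_continuous:
  assumes "p \<in> polys m" "q \<in> polys m" "r \<in> polys m"
  shows "continuous_on S (\<lambda>x. vector [p x, q x] + r x *\<^sub>R x :: point)"
proof -
  have "(\<lambda>x. vector [p x, q x] :: point) = (\<lambda>x. \<chi> i. if i = 1 then p x else q x)"
    by (auto simp: fun_eq_iff vec_eq_iff forall_2)
  moreover have "continuous_on S (\<lambda>x. if i = 1 then p x else q x)" for i :: 2
    using assms polys_continuous_on by (cases "i = 1") auto
  ultimately have "continuous_on S (\<lambda>x. vector [p x, q x] :: point)"
    by (simp only:) (intro continuous_on_vec_lambda)
  then show ?thesis
    by (intro continuous_intros polys_continuous_on[OF assms(3)])
qed

context triangulated_domain
begin

lemma element_gauss:
  fixes w :: "point \<Rightarrow> real"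
  assumes "K \<in> \<T>" "\<And>x. GDERIV w x :> D x" "continuous_on UNIV D"
  shows "(LINT x:K|lebesgue. D x \<bullet> v) = (\<Sum>F | F edge_of K. mu n K F * (n F \<bullet> v) * edge_integral n F w)"
proof -
  have "(LINT x:K|lebesgue. D x \<bullet> v) = (\<Sum>F | F edge_of K. diameter F *
      (LINT t:{0..1}|lebesgue. w (linepath (edge_start n F) (edge_end n F) t)) * ((mu n K F *\<^sub>R n F) \<bullet> v))"
    using edge_ends(1) edgesI[OF assms(1)] outward_normal_mu[OF assms(1)]
    by (intro triangle_gauss triangles assms) auto
  then show ?thesis
    by (simp add: edge_integral_def mult_ac)
qed

text \<open>Gauss' theorem for the two components of \<open>\<psi> G\<close>.\<close>

lemma green_formula:
  assumes K: "K \<in> \<T>" and G: "has_C1_div G d" and \<psi>: "\<And>x. GDERIV \<psi> x :> E x" "continuous_on UNIV E"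
  shows "(LINT x:K|lebesgue. d x * \<psi> x) + (LINT x:K|lebesgue. G x \<bullet> E x) =
    (\<Sum>F | F edge_of K. mu n K F * edge_integral n F (\<lambda>x. (G x \<bullet> n F) * \<psi> x))"
proof -
  obtain D1 D2 where D: "\<And>x. GDERIV (\<lambda>x. G x $ 1) x :> D1 x" "\<And>x. GDERIV (\<lambda>x. G x $ 2) x :> D2 x"
    "continuous_on UNIV D1" "continuous_on UNIV D2" "\<And>x. d x = D1 x $ 1 + D2 x $ 2"
    using G unfolding has_C1_div_def by blast
  have cont: "continuous_on UNIV \<psi>" "continuous_on UNIV (\<lambda>x. G x $ 1)" "continuous_on UNIV (\<lambda>x. G x $ 2)"
    using GDERIV_imp_continuous_on \<psi> D by blast+
  define W1 W2 where "W1 = (\<lambda>x. G x $ 1 *\<^sub>R E x + \<psi> x *\<^sub>R D1 x)" and "W2 = (\<lambda>x. G x $ 2 *\<^sub>R E x + \<psi> x *\<^sub>R D2 x)"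
  have W: "GDERIV (\<lambda>x. G x $ 1 * \<psi> x) x :> W1 x" "GDERIV (\<lambda>x. G x $ 2 * \<psi> x) x :> W2 x" for x
    unfolding W1_def W2_def using GDERIV_mult[OF D(1) \<psi>(1)] GDERIV_mult[OF D(2) \<psi>(1)] by blast+
  have contW: "continuous_on UNIV W1" "continuous_on UNIV W2"
    unfolding W1_def W2_def by (intro continuous_intros cont \<psi> D)+
  have int: "set_integrable lebesgue K h" if "continuous_on UNIV h" for h :: "point \<Rightarrow> real"
    using compact_simplex[OF triangles[OF K]] that
    by (intro set_integrable_lebesgue_compact) (auto intro: continuous_on_subset)
  have contd: "continuous_on UNIV d"
    unfolding D(5) by (intro continuous_intros D)
  have contG: "continuous_on UNIV (\<lambda>x. G x \<bullet> E x)"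
    unfolding inner_vec_def sum_2 inner_real_def by (intro continuous_intros cont \<psi>)
  have "(LINT x:K|lebesgue. d x * \<psi> x) + (LINT x:K|lebesgue. G x \<bullet> E x) =
      (LINT x:K|lebesgue. d x * \<psi> x + G x \<bullet> E x)"
    by (intro set_integral_add(2)[symmetric] int continuous_intros cont contd contG)
  also have "\<dots> = (LINT x:K|lebesgue. W1 x \<bullet> axis 1 1 + W2 x \<bullet> axis 2 1)"
  proof -
    have "d x * \<psi> x + G x \<bullet> E x = W1 x $ 1 + W2 x $ 2" for x
      by (simp add: D(5) W1_def W2_def inner_vec_def sum_2 algebra_simps)
    then show ?thesis by (simp add: inner_axis)
  qed
  also have "\<dots> = (LINT x:K|lebesgue. W1 x \<bullet> axis 1 1) + (LINT x:K|lebesgue. W2 x \<bullet> axis 2 1)"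
    by (intro set_integral_add(2) int continuous_intros contW)
  also have "\<dots> = (\<Sum>F | F edge_of K. mu n K F * n F $ 1 * edge_integral n F (\<lambda>x. G x $ 1 * \<psi> x)) +
      (\<Sum>F | F edge_of K. mu n K F * n F $ 2 * edge_integral n F (\<lambda>x. G x $ 2 * \<psi> x))"
    unfolding element_gauss[OF K W(1) contW(1)] element_gauss[OF K W(2) contW(2)]
    by (simp add: inner_axis)
  also have "\<dots> = (\<Sum>F | F edge_of K. mu n K F * edge_integral n F (\<lambda>x. (G x \<bullet> n F) * \<psi> x))"
  proof -
    have "edge_integral n F (\<lambda>x. (G x \<bullet> n F) * \<psi> x) =
        n F $ 1 * edge_integral n F (\<lambda>x. G x $ 1 * \<psi> x) + n F $ 2 * edge_integral n F (\<lambda>x. G x $ 2 * \<psi> x)" for F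
    proof -
      have "edge_integral n F (\<lambda>x. (G x \<bullet> n F) * \<psi> x) =
          edge_integral n F (\<lambda>x. n F $ 1 * (G x $ 1 * \<psi> x) + n F $ 2 * (G x $ 2 * \<psi> x))"
        unfolding inner_vec_def sum_2 by (simp add: algebra_simps)
      also have "\<dots> = n F $ 1 * edge_integral n F (\<lambda>x. G x $ 1 * \<psi> x) + n F $ 2 * edge_integral n F (\<lambda>x. G x $ 2 * \<psi> x)"
        by (subst edge_integral_add) (auto intro!: continuous_intros cont simp: edge_integral_cmult)
      finally show ?thesis .
    qed
    then show ?thesis by (simp add: sum.distrib[symmetric] algebra_simps)
  qed
  finally show ?thesis .
qed

text \<open>On the edge, \<open>x \<bullet> n F\<close> is constant, so the normal component of \<open>r x\<close> has degree \<open>m\<close> there, not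
  \<open>m + 1\<close>.\<close>

lemma rt_field_normal_component:
  assumes "F \<in> edges \<T>" "p \<in> polys m" "q \<in> polys m" "r \<in> polys m"
  shows "\<exists>b\<in>polys m. \<forall>x\<in>F. (vector [p x, q x] + r x *\<^sub>R x) \<bullet> n F = b x"
proof -
  define c where "c = edge_start n F \<bullet> n F"
  have "edge_start n F \<in> F"
    using edge_ends(1)[OF assms(1)] by (metis ends_in_segment(1))
  then have c: "x \<bullet> n F = c" if "x \<in> F" for x
    using normal(2)[OF assms(1) that, of "edge_start n F"] by (simp add: c_def inner_diff_right inner_commute)
  define b where "b = (\<lambda>x. n F $ 1 * p x + n F $ 2 * q x + c * r x)"
  have "b \<in> polys m"
    unfolding b_def by (intro polys_add polys_cmult assms)
  moreover have "(vector [p x, q x] + r x *\<^sub>R x) \<bullet> n F = b x" if "x \<in> F" for x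
    using c[OF that] by (simp add: inner_add_left vector_2_inner b_def algebra_simps)
  ultimately show ?thesis by blast
qed

end

section \<open>Piecewise integration over the mesh\<close>

lemma polygonal_frontier_negligible:
  assumes "polygonal D"
  shows "negligible (frontier D)"
proof -
  obtain S where S: "finite S" "\<forall>s\<in>S. \<exists>a b. a \<noteq> b \<and> s = closed_segment a b" "frontier D = \<Union>S"
    using assms unfolding polygonal_def by blast
  have "negligible (closed_segment a b)" for a b :: point
    using negligible_convex_interior[of "closed_segment a b"] interior_closed_segment_ge2[of a b] by simp
  then show ?thesis
    unfolding S(3) using S(1,2) by (intro negligible_Union) auto
qed

locale meshed_domain = triangulated_domain +
  assumes bounded_domain: "bounded \<Omega>"
    and frontier_negligible: "negligible (frontier \<Omega>)"
begin

definition skeleton :: "point set" where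
  "skeleton = frontier \<Omega> \<union> (\<Union>K\<in>\<T>. frontier K)"

lemma negligible_skeleton: "negligible skeleton"
  unfolding skeleton_def
  using frontier_negligible finite_elements frontier_triangle_negligible[OF triangles]
  by (intro negligible_Un negligible_Union) auto

lemma element_subset_closure: "K \<in> \<T> \<Longrightarrow> K \<subseteq> closure \<Omega>"
  using covering by blast

lemma off_skeleton_domain_iff:
  assumes "x \<notin> skeleton"
  shows "x \<in> \<Omega> \<longleftrightarrow> (\<exists>K\<in>\<T>. x \<in> interior K)"
proof -
  have "x \<in> \<Omega> \<longleftrightarrow> x \<in> closure \<Omega>"
    using assms open_domain closure_subset by (auto simp: skeleton_def frontier_def interior_open)
  also have "\<dots> \<longleftrightarrow> (\<exists>K\<in>\<T>. x \<in> K)" using covering by blast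
  also have "\<dots> \<longleftrightarrow> (\<exists>K\<in>\<T>. x \<in> interior K)"
    using in_triangle_cases[OF triangles] assms by (auto simp: skeleton_def)
  finally show ?thesis .
qed

lemma interiors_disjoint:
  assumes "K \<in> \<T>" "K' \<in> \<T>" "x \<in> interior K" "x \<in> interior K'"
  shows "K = K'"
proof -
  have "x \<in> K \<inter> K'" using assms interior_subset by blast
  then have "K \<inter> K' = K" "K \<inter> K' = K'"
    using face_of_disjoint_interior[OF intersection_face(1)[OF assms(1,2)]]
      face_of_disjoint_interior[OF intersection_face(2)[OF assms(1,2)]] assms by blast+
  then show ?thesis by simp
qed

lemma sum_indicator_elements:
  fixes h :: "point \<Rightarrow> 'b::real_vector"
  assumes "x \<notin> skeleton"
  shows "(\<Sum>K\<in>\<T>. indicator K x *\<^sub>R h x) = indicator \<Omega> x *\<^sub>R h x"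
proof (cases "x \<in> \<Omega>")
  case True
  then obtain K0 where K0: "K0 \<in> \<T>" "x \<in> interior K0"
    using off_skeleton_domain_iff[OF assms] by blast
  have "x \<in> K \<longleftrightarrow> K = K0" if K: "K \<in> \<T>" for K
  proof -
    have "x \<notin> frontier K" using assms K by (auto simp: skeleton_def)
    then have "x \<in> K \<longleftrightarrow> x \<in> interior K" by (rule in_triangle_cases[OF triangles[OF K]])
    then show ?thesis using interiors_disjoint[OF K K0(1) _ K0(2)] K0(2) by blast
  qed
  then have "indicator K x *\<^sub>R h x = (if K = K0 then h x else 0)" if "K \<in> \<T>" for K
    using that by (simp add: indicator_def)
  then have "(\<Sum>K\<in>\<T>. indicator K x *\<^sub>R h x) = (\<Sum>K\<in>\<T>. if K = K0 then h x else 0)"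
    by (intro sum.cong) auto
  then show ?thesis using True K0(1) finite_elements by simp
next
  case False
  have "x \<notin> K" if K: "K \<in> \<T>" for K
  proof -
    have "x \<notin> frontier K" using assms K by (auto simp: skeleton_def)
    then have "x \<in> K \<longleftrightarrow> x \<in> interior K" by (rule in_triangle_cases[OF triangles[OF K]])
    then show ?thesis using off_skeleton_domain_iff[OF assms] False K by blast
  qed
  then show ?thesis using False by (simp add: indicator_def)
qed

lemma LINT_domain:
  fixes h :: "point \<Rightarrow> 'b::euclidean_space"
  assumes "\<And>K. K \<in> \<T> \<Longrightarrow> set_integrable lebesgue K h"
  shows "set_integrable lebesgue \<Omega> h"
    and "(LINT x:\<Omega>|lebesgue. h x) = (\<Sum>K\<in>\<T>. (LINT x:K|lebesgue. h x))"
proof -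
  have int: "integrable lebesgue (\<lambda>x. \<Sum>K\<in>\<T>. indicator K x *\<^sub>R h x)"
    using assms by (intro Bochner_Integration.integrable_sum) (simp add: set_integrable_def)
  have eq: "indicator \<Omega> x *\<^sub>R h x = indicator UNIV x *\<^sub>R (\<Sum>K\<in>\<T>. indicator K x *\<^sub>R h x)" if "x \<notin> skeleton" for x
    using sum_indicator_elements[OF that, of h] by simp
  show "set_integrable lebesgue \<Omega> h"
    using LINT_lebesgue_cong_negligible(2)[OF negligible_skeleton eq] int by (simp add: set_integrable_def)
  have "(LINT x:\<Omega>|lebesgue. h x) = (LINT x|lebesgue. (\<Sum>K\<in>\<T>. indicator K x *\<^sub>R h x))"
    using LINT_lebesgue_cong_negligible(1)[OF negligible_skeleton eq] by (simp add: set_lebesgue_integral_def)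
  also have "\<dots> = (\<Sum>K\<in>\<T>. (LINT x:K|lebesgue. h x))"
    unfolding set_lebesgue_integral_def using assms
    by (intro Bochner_Integration.integral_sum) (simp add: set_integrable_def)
  finally show "(LINT x:\<Omega>|lebesgue. h x) = (\<Sum>K\<in>\<T>. (LINT x:K|lebesgue. h x))" .
qed

lemma set_integrable_element:
  fixes h :: "point \<Rightarrow> 'b::euclidean_space"
  assumes "K \<in> \<T>" "continuous_on UNIV p" "\<And>x. x \<in> interior K \<Longrightarrow> h x = p x"
  shows "set_integrable lebesgue K h"
proof -
  have "set_integrable lebesgue K p"
    using compact_simplex[OF triangles[OF assms(1)]] assms(2)
    by (intro set_integrable_lebesgue_compact) (auto intro: continuous_on_subset)
  then show ?thesis
    using LINT_triangle_cong(2)[OF triangles[OF assms(1)], of h p] assms(3) by blast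
qed

lemma L2_piecewise_continuous:
  fixes h :: "point \<Rightarrow> 'b::euclidean_space"
  assumes "\<And>K. K \<in> \<T> \<Longrightarrow> \<exists>p. continuous_on UNIV p \<and> (\<forall>x\<in>interior K. h x = p x)"
  shows "L2 \<Omega> h"
proof -
  have "set_integrable lebesgue K h" "set_integrable lebesgue K (\<lambda>x. (norm (h x))\<^sup>2)" if K: "K \<in> \<T>" for K
  proof -
    obtain p where p: "continuous_on UNIV p" "\<And>x. x \<in> interior K \<Longrightarrow> h x = p x"
      using assms[OF K] by blast
    show "set_integrable lebesgue K h"
      by (rule set_integrable_element[OF K p])
    have "continuous_on UNIV (\<lambda>x. (norm (p x))\<^sup>2)"
      by (intro continuous_intros p(1))
    then show "set_integrable lebesgue K (\<lambda>x. (norm (h x))\<^sup>2)"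
      by (rule set_integrable_element[OF K]) (simp add: p(2))
  qed
  then have "set_integrable lebesgue \<Omega> h" "set_integrable lebesgue \<Omega> (\<lambda>x. (norm (h x))\<^sup>2)"
    using LINT_domain(1) by blast+
  then show ?thesis
    unfolding L2_def set_borel_measurable_def
    using borel_measurable_integrable[of lebesgue "\<lambda>x. indicator \<Omega> x *\<^sub>R h x"]
    by (simp add: set_integrable_def)
qed

lemma trace_from_element:
  fixes v :: "point \<Rightarrow> 'b::t2_space"
  assumes "K \<in> \<T>" "F edge_of K" "continuous_on UNIV p" "\<And>y. y \<in> interior K \<Longrightarrow> v y = p y" "x \<in> F"
  shows "trace_from K v x = p x"
  using trace_from_eq[OF triangles[OF assms(1)] assms(3,4)] edge_of_imp_subset[OF assms(2)] assms(5) by blast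

lemma grad_h_interior: "K \<in> \<T> \<Longrightarrow> x \<in> interior K \<Longrightarrow> grad_h \<T> v x = grad v x"
  unfolding grad_h_def by auto

text \<open>All information is in the interiors of the elements: the skeleton, where the sum is \<open>0\<close>, is a
  null set.\<close>

definition glue :: "(point set \<Rightarrow> point \<Rightarrow> real) \<Rightarrow> point \<Rightarrow> real" where
  "glue V x = (\<Sum>K\<in>\<T>. indicator (interior K) x * V K x)"

lemma glue_interior:
  assumes "K \<in> \<T>" "x \<in> interior K"
  shows "glue V x = V K x"
proof -
  have "glue V x = (\<Sum>K'\<in>\<T>. if K' = K then V K x else 0)"
    unfolding glue_def
  proof (rule sum.cong[OF refl])
    fix K' assume "K' \<in> \<T>"
    then have "x \<in> interior K' \<longleftrightarrow> K' = K"
      using interiors_disjoint[OF _ assms(1) _ assms(2)] assms(2) by blast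
    then show "indicator (interior K') x * V K' x = (if K' = K then V K x else 0)"
      by (simp add: indicator_def)
  qed
  then show ?thesis using assms(1) finite_elements by simp
qed

end


section \<open>Local test functions\<close>

locale nc_discretization = meshed_domain \<Omega> \<T> n
  for \<Omega> \<T> n +
  fixes \<Gamma>D \<Gamma>N :: "point set" and \<D> :: "point set set" and A :: "point \<Rightarrow> real ^ 2 ^ 2"
    and f g u :: "point \<Rightarrow> real" and k :: nat
  assumes boundary: "boundary_decomposition \<Omega> \<Gamma>D \<Gamma>N"
    and coefficient: "piecewise_constant_spd \<Omega> \<D> A"
    and source: "L2 \<Omega> f"
    and neumann_data: "\<forall>F\<in>edges_on \<Gamma>N \<T>. poly_on (int k - 1) (rel_interior F) g"
    and solution: "nc_solution \<Omega> \<Gamma>D \<Gamma>N A f g \<T> n k u"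
begin

abbreviation flux :: "point \<Rightarrow> point" where
  "flux \<equiv> numerical_flux \<T> A u"

text \<open>The contribution of one element to the discrete equation. With \<open>flux\<close> being \<open>- A \<nabla>u\<close>, the
  equation says that these contributions add up to the Neumann term.\<close>

definition residual :: "point set \<Rightarrow> (point \<Rightarrow> real) \<Rightarrow> real" where
  "residual K v = (LINT x:K|lebesgue. flux x \<bullet> grad v x) + (LINT x:K|lebesgue. f x * v x)"

text \<open>The coefficient is unrestricted on the boundaries of the subdomains. These are null sets, and
  on the part of \<open>K\<close> in one subdomain the flux is a polynomial field.\<close>

lemma flux_integrable:
  assumes K: "K \<in> \<T>" and q: "continuous_on UNIV q"
  shows "set_integrable lebesgue K (\<lambda>x. flux x \<bullet> q x)"
proof -
  have "u \<in> nc_space \<Omega> \<T> n k"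
    using solution unfolding nc_solution_def nc_space_D_def by blast
  then obtain U where U: "U \<in> polys (int k)" "\<And>x. x \<in> interior K \<Longrightarrow> u x = U x"
    using K unfolding nc_space_def poly_on_def by blast
  have flux: "flux x = - (A x *v grad U x)" if "x \<in> interior K" for x
    unfolding numerical_flux_def grad_h_interior[OF K that]
    using grad_eq_on_open[OF open_interior that _ polys_grad(1)[OF U(1)], of u] U(2) by simp
  note coeff = coefficient[unfolded piecewise_constant_spd_def]
  have fin: "finite \<D>" and cov: "closure \<Omega> = (\<Union>D\<in>\<D>. closure D)"
    using coeff by simp_all
  have polyg: "polygonal D" and const: "\<exists>M. \<forall>x\<in>D. A x = M" if "D \<in> \<D>" for D
    using conjunct1[OF conjunct2[OF coeff]] conjunct2[OF conjunct2[OF conjunct2[OF coeff]]] that by blast+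
  have openD: "open D" if "D \<in> \<D>" for D
    using polyg[OF that] by (simp add: polygonal_def)
  have piece: "set_integrable lebesgue (interior K \<inter> D) (\<lambda>x. flux x \<bullet> q x)" if D: "D \<in> \<D>" for D
  proof -
    obtain M where M: "\<And>x. x \<in> D \<Longrightarrow> A x = M" using const[OF D] by blast
    have "continuous_on UNIV (\<lambda>x. - (M *v grad U x) \<bullet> q x)"
      by (intro continuous_intros q continuous_on_compose2[OF linear_continuous_on[OF matrix_vector_mul_bounded_linear] polys_grad(2)[OF U(1)]]) auto
    then have "set_integrable lebesgue K (\<lambda>x. - (M *v grad U x) \<bullet> q x)"
      by (rule set_integrable_element[OF K]) simp
    then have "set_integrable lebesgue (interior K \<inter> D) (\<lambda>x. - (M *v grad U x) \<bullet> q x)"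
    proof (rule set_integrable_subset)
      have "open (interior K \<inter> D)" using openD[OF D] by blast
      then show "interior K \<inter> D \<in> sets lebesgue"
        by (metis borel_open sets_completionI_sets sets_lborel)
      show "interior K \<inter> D \<subseteq> K" using interior_subset by blast
    qed
    then show ?thesis
      by (rule set_integrable_cong[THEN iffD1, rotated -1]) (auto simp: flux M)
  qed
  have union: "set_integrable lebesgue (\<Union>D\<in>\<D>. interior K \<inter> D) (\<lambda>x. flux x \<bullet> q x)"
  proof (rule set_integrable_UN[OF fin piece])
    fix D assume "D \<in> \<D>"
    then have "open (interior K \<inter> D)" using openD by blast
    then show "interior K \<inter> D \<in> sets lebesgue"
      by (metis borel_open sets_completionI_sets sets_lborel)
  qed
  \<comment> \<open>Outside this null set, the open subdomains cover the interior of the element.\<close>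
  define N where "N = frontier K \<union> (\<Union>D\<in>\<D>. frontier D)"
  have N: "negligible N"
    unfolding N_def using frontier_triangle_negligible[OF triangles[OF K]] fin polygonal_frontier_negligible polyg
    by (intro negligible_Un negligible_Union) auto
  have "x \<in> K \<longleftrightarrow> x \<in> (\<Union>D\<in>\<D>. interior K \<inter> D)" if "x \<notin> N" for x
  proof -
    have "x \<in> K \<longleftrightarrow> x \<in> interior K"
      using in_triangle_cases[OF triangles[OF K]] that by (simp add: N_def)
    moreover have "\<exists>D\<in>\<D>. x \<in> D" if x: "x \<in> interior K"
    proof -
      have "x \<in> closure \<Omega>" using x element_subset_closure[OF K] interior_subset by blast
      then obtain D where D: "D \<in> \<D>" "x \<in> closure D" using cov by blast
      then have "x \<in> D" using \<open>x \<notin> N\<close> openD[OF D(1)] by (auto simp: N_def frontier_def interior_open)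
      then show ?thesis using D by blast
    qed
    ultimately show ?thesis by blast
  qed
  then have eq: "indicator (\<Union>D\<in>\<D>. interior K \<inter> D) x *\<^sub>R (flux x \<bullet> q x) = indicator K x *\<^sub>R (flux x \<bullet> q x)" if "x \<notin> N" for x
    using that by (simp add: indicator_def)
  from LINT_lebesgue_cong_negligible(2)[OF N eq] union show ?thesis
    by (rule iffD1)
qed

text \<open>A square-integrable function on a bounded domain is integrable, by \<open>\<bar>f\<bar> \<le> 1 + f\<^sup>2\<close>.\<close>

lemma source_integrable:
  assumes K: "K \<in> \<T>" and q: "continuous_on UNIV q"
  shows "set_integrable lebesgue K (\<lambda>x. f x * q x)"
proof -
  have sets: "\<Omega> \<in> sets lebesgue"
    using open_domain by (metis borel_open sets_completionI_sets sets_lborel)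
  have "compact (closure \<Omega>)" using bounded_domain by simp
  then have "compact (q ` closure \<Omega>)"
    by (rule compact_continuous_image[OF continuous_on_subset[OF q subset_UNIV]])
  then have "bounded (q ` closure \<Omega>)" by (rule compact_imp_bounded)
  then obtain M where M: "\<And>x. x \<in> closure \<Omega> \<Longrightarrow> \<bar>q x\<bar> \<le> M"
    unfolding bounded_iff by auto
  have "set_integrable lebesgue \<Omega> (\<lambda>x. 1 :: real)"
  proof -
    have "emeasure lborel \<Omega> < \<infinity>" using emeasure_bounded_finite[OF bounded_domain] .
    then show ?thesis
      unfolding set_integrable_def using sets open_domain by (simp add: integrable_indicator_iff)
  qed
  moreover have sq: "set_integrable lebesgue \<Omega> (\<lambda>x. (f x)\<^sup>2)"
    using source by (simp add: L2_def)
  ultimately have dom: "set_integrable lebesgue \<Omega> (\<lambda>x. M * (1 + (f x)\<^sup>2))"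
    by (intro set_integrable_mult_right set_integral_add(1))
  have meas: "set_borel_measurable lebesgue \<Omega> (\<lambda>x. f x * q x)"
  proof -
    have "(\<lambda>x. indicator \<Omega> x *\<^sub>R f x) \<in> borel_measurable lebesgue"
      using source by (simp add: L2_def set_borel_measurable_def)
    moreover have "q \<in> borel_measurable lebesgue"
      using borel_measurable_continuous_onI[OF q] by (intro measurable_completion) simp
    ultimately have "(\<lambda>x. (indicator \<Omega> x *\<^sub>R f x) * q x) \<in> borel_measurable lebesgue"
      by (rule borel_measurable_times)
    then show ?thesis by (simp add: set_borel_measurable_def mult.assoc)
  qed
  have "set_integrable lebesgue \<Omega> (\<lambda>x. f x * q x)"
  proof (rule set_integrable_bound[OF dom meas])
    show "AE x in lebesgue. x \<in> \<Omega> \<longrightarrow> norm (f x * q x) \<le> norm (M * (1 + (f x)\<^sup>2))"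
    proof (intro AE_I2 impI)
      fix x assume "x \<in> \<Omega>"
      then have q: "\<bar>q x\<bar> \<le> M" using M closure_subset by blast
      then have "0 \<le> M" by linarith
      have "\<bar>f x\<bar> \<le> 1 + (f x)\<^sup>2"
        using zero_le_power2[of "\<bar>f x\<bar> - 1"] by (simp add: power2_eq_square algebra_simps)
      then have "\<bar>q x\<bar> * \<bar>f x\<bar> \<le> M * (1 + (f x)\<^sup>2)"
        using q \<open>0 \<le> M\<close> by (intro mult_mono) auto
      then show "norm (f x * q x) \<le> norm (M * (1 + (f x)\<^sup>2))"
        using \<open>0 \<le> M\<close> by (simp add: abs_mult mult.commute)
    qed
  qed
  then have int: "set_integrable lebesgue (K \<inter> \<Omega>) (\<lambda>x. f x * q x)"
    by (rule set_integrable_subset) (use sets triangle_in_sets[OF triangles[OF K]] in auto)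
  have "x \<in> K \<longleftrightarrow> x \<in> K \<inter> \<Omega>" if "x \<notin> frontier \<Omega>" for x
    using that element_subset_closure[OF K] open_domain by (auto simp: frontier_def interior_open)
  then have eq: "indicator (K \<inter> \<Omega>) x *\<^sub>R (f x * q x) = indicator K x *\<^sub>R (f x * q x)" if "x \<notin> frontier \<Omega>" for x
    using that by (simp add: indicator_def)
  from LINT_lebesgue_cong_negligible(2)[OF frontier_negligible eq] int show ?thesis
    by (rule iffD1)
qed

lemma residual_add:
  assumes "K \<in> \<T>" "v \<in> polys m" "w \<in> polys m"
  shows "residual K (\<lambda>x. v x + w x) = residual K v + residual K w"
proof -
  have "grad (\<lambda>x. v x + w x) x = grad v x + grad w x" for x
    by (rule GDERIV_unique_grad, rule GDERIV_add) (use polys_grad(1) assms in blast)+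
  then have "residual K (\<lambda>x. v x + w x) =
      (LINT x:K|lebesgue. flux x \<bullet> grad v x + flux x \<bullet> grad w x) + (LINT x:K|lebesgue. f x * v x + f x * w x)"
    by (simp add: residual_def inner_add_right distrib_left)
  also have "\<dots> = residual K v + residual K w"
    unfolding residual_def
      set_integral_add(2)[OF flux_integrable[OF assms(1) polys_grad(2)[OF assms(2)]] flux_integrable[OF assms(1) polys_grad(2)[OF assms(3)]]]
      set_integral_add(2)[OF source_integrable[OF assms(1) polys_continuous_on[OF assms(2)]] source_integrable[OF assms(1) polys_continuous_on[OF assms(3)]]]
    by simp
  finally show ?thesis .
qed

lemma residual_cmult:
  assumes "K \<in> \<T>" "v \<in> polys m"
  shows "residual K (\<lambda>x. c * v x) = c * residual K v"
proof -
  have "GDERIV (\<lambda>x. c * v x) x :> c *\<^sub>R grad v x" for x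
    using has_derivative_mult_right[OF polys_grad(1)[OF assms(2), unfolded gderiv_def], of c x]
    by (simp add: gderiv_def)
  then have "grad (\<lambda>x. c * v x) x = c *\<^sub>R grad v x" for x
    by (rule GDERIV_unique_grad)
  then have 1: "flux x \<bullet> grad (\<lambda>x. c * v x) x = c * (flux x \<bullet> grad v x)" for x
    by simp
  have 2: "f x * (c * v x) = c * (f x * v x)" for x by simp
  show ?thesis
    unfolding residual_def 1 2 by (simp add: distrib_left)
qed

lemma residual_diff:
  assumes "K \<in> \<T>" "v \<in> polys m" "w \<in> polys m"
  shows "residual K (\<lambda>x. v x - w x) = residual K v - residual K w"
  using residual_add[OF assms(1,2) polys_cmult[OF assms(3), of "- 1"]] residual_cmult[OF assms(1,3), of "- 1"]
  by simp

lemma residual_sum: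
  assumes "K \<in> \<T>" "\<And>i. i \<in> I \<Longrightarrow> v i \<in> polys m"
  shows "residual K (\<lambda>x. \<Sum>i\<in>I. v i x) = (\<Sum>i\<in>I. residual K (v i))"
proof -
  have zero: "residual K (\<lambda>x. 0) = 0"
    using residual_cmult[OF assms(1) polys_0, of 0] by simp
  show ?thesis
    using assms(2)
  proof (induction I rule: infinite_finite_induct)
    case (insert i I)
    then show ?case
      using residual_add[OF assms(1), of "v i" m "\<lambda>x. \<Sum>i\<in>I. v i x"] polys_sum[of I v m] by simp
  qed (simp_all add: zero)
qed

lemma interior_edge_not_on_boundary:
  assumes "F \<in> interior_edges \<Omega> \<T>"
  shows "F \<notin> edges_on \<Gamma>D \<T>" "F \<notin> edges_on \<Gamma>N \<T>"
  using assms boundary unfolding interior_edges_def edges_on_def boundary_decomposition_def by auto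

lemma dirichlet_neumann_disjoint:
  assumes "F \<in> edges_on \<Gamma>N \<T>"
  shows "F \<notin> edges_on \<Gamma>D \<T>"
proof
  assume "F \<in> edges_on \<Gamma>D \<T>"
  then have "F \<subseteq> closure \<Gamma>D \<inter> closure \<Gamma>N" "F \<in> edges \<T>" using assms by (auto simp: edges_on_def)
  moreover have "closure \<Gamma>D \<inter> closure \<Gamma>N = {}"
    using boundary unfolding boundary_decomposition_def by blast
  moreover have "edge_start n F \<in> F"
    using edge_ends(1)[OF \<open>F \<in> edges \<T>\<close>] by (metis ends_in_segment(1))
  ultimately show False by blast
qed

text \<open>Membership in the discrete test space constrains only moments on interior and Dirichlet edges.
  Test functions may thus be put together from unrelated polynomials on the elements, provided
  that these moments match. All later uses of the discrete equation are instances with very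
  small support.\<close>

lemma test_with_glued_polynomials:
  assumes V: "\<And>K. K \<in> \<T> \<Longrightarrow> V K \<in> polys (int k)"
    and jump: "\<And>F j. F \<in> interior_edges \<Omega> \<T> \<Longrightarrow> j < k \<Longrightarrow>
      moment F j (V (K_minus \<T> n F)) =
      moment F j (V (K_plus \<T> n F))"
    and dirichlet: "\<And>F j. F \<in> edges_on \<Gamma>D \<T> \<Longrightarrow> j < k \<Longrightarrow>
      moment F j (V (K_minus \<T> n F)) = 0"
  shows "(\<Sum>K\<in>\<T>. residual K (V K)) =
    (\<Sum>F\<in>edges_on \<Gamma>N \<T>. edge_integral n F (\<lambda>x. g x * V (K_minus \<T> n F) x))"
proof -
  define v where "v = glue V"
  have v: "v x = V K x" if "K \<in> \<T>" "x \<in> interior K" for K x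
    unfolding v_def by (rule glue_interior[OF that])
  have contV: "continuous_on S (V K)" if "K \<in> \<T>" for K S
    using polys_continuous_on[OF V[OF that]] .
  have traceV: "trace_from K v x = V K x" if "K \<in> \<T>" "F edge_of K" "x \<in> F" for K F x
    using trace_from_element[OF that(1,2) contV[OF that(1)], of v] v that by blast
  have minus: "trace_from (K_minus \<T> n F) v x = V (K_minus \<T> n F) x" if "F \<in> edges \<T>" "x \<in> F" for F x
    using traceV[OF K_minus(1,2)[OF that(1)] that(2)] .
  have plus: "trace_from (K_plus \<T> n F) v x = V (K_plus \<T> n F) x" if "F \<in> interior_edges \<Omega> \<T>" "x \<in> F" for F x
    using traceV[OF K_plus(1,2)[OF that(1)] that(2)] .
  have "v \<in> nc_space \<Omega> \<T> n k"
    unfolding nc_space_def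
  proof (intro CollectI conjI ballI)
    show "L2 \<Omega> v"
      using v contV by (intro L2_piecewise_continuous) blast
    show "poly_on (int k) (interior K) v" if "K \<in> \<T>" for K
      unfolding poly_on_def using V[OF that] v[OF that] by blast
    fix F p assume F: "F \<in> interior_edges \<Omega> \<T>" and p: "p \<in> polys (int k - 1)"
    then have Fe: "F \<in> edges \<T>" by (simp add: interior_edges_def)
    obtain c where c: "\<And>x. x \<in> F \<Longrightarrow> p x = (\<Sum>i<k. c i * legendre_edge n i F x)"
      using polys_edge_expansion[OF Fe p] by blast
    let ?m = "V (K_minus \<T> n F)" and ?p = "V (K_plus \<T> n F)"
    have cont: "continuous_on UNIV ?m" "continuous_on UNIV ?p"
      using contV K_minus(1)[OF Fe] K_plus(1)[OF F] by blast+
    have "edge_integral n F (\<lambda>x. jump \<T> n v F x * p x) = edge_integral n F (\<lambda>x. (?m x - ?p x) * p x)"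
      by (intro edge_integral_cong_on[OF Fe]) (simp add: jump_def minus[OF Fe] plus[OF F])
    also have "\<dots> = (\<Sum>i<k. c i * moment F i (\<lambda>x. ?m x - ?p x))"
      using c linepath_in_edge[OF Fe] cont by (intro edge_integral_expansion[OF _ Fe] continuous_intros) auto
    also have "\<dots> = 0"
    proof -
      have "moment F i (\<lambda>x. ?m x - ?p x) = 0" if "i < k" for i
        unfolding left_diff_distrib
        by (subst edge_integral_diff)
          (auto intro!: continuous_intros cont legendre_edge_continuous simp: jump[OF F that])
      then show ?thesis by simp
    qed
    finally show "edge_integral n F (\<lambda>x. jump \<T> n v F x * p x) = 0" .
  qed
  moreover have "edge_integral n F (\<lambda>x. trace_from (K_minus \<T> n F) v x * p x) = 0"
    if F: "F \<in> edges_on \<Gamma>D \<T>" and p: "p \<in> polys (int k - 1)" for F p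
  proof -
    have Fe: "F \<in> edges \<T>" using F by (simp add: edges_on_def)
    obtain c where c: "\<And>x. x \<in> F \<Longrightarrow> p x = (\<Sum>i<k. c i * legendre_edge n i F x)"
      using polys_edge_expansion[OF Fe p] by blast
    have "edge_integral n F (\<lambda>x. trace_from (K_minus \<T> n F) v x * p x) =
        edge_integral n F (\<lambda>x. V (K_minus \<T> n F) x * p x)"
      by (intro edge_integral_cong_on[OF Fe]) (simp add: minus[OF Fe])
    also have "\<dots> = (\<Sum>i<k. c i * moment F i (V (K_minus \<T> n F)))"
      using c linepath_in_edge[OF Fe] contV[OF K_minus(1)[OF Fe]] by (intro edge_integral_expansion[OF _ Fe]) auto
    also have "\<dots> = 0" using dirichlet[OF F] by simp
    finally show ?thesis .
  qed
  ultimately have "v \<in> nc_space_D \<Omega> \<Gamma>D \<T> n k"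
    unfolding nc_space_D_def by blast
  then have weak: "(LINT x:\<Omega>|lebesgue. (A x *v grad_h \<T> u x) \<bullet> grad_h \<T> v x) =
      (LINT x:\<Omega>|lebesgue. f x * v x) -
      (\<Sum>F\<in>edges_on \<Gamma>N \<T>. edge_integral n F (\<lambda>x. g x * trace_from (K_minus \<T> n F) v x))"
    using solution unfolding nc_solution_def by blast
  have gradv: "grad_h \<T> v x = grad (V K) x" if K: "K \<in> \<T>" "x \<in> interior K" for K x
    unfolding grad_h_interior[OF K]
    using grad_eq_on_open[OF open_interior K(2) _ polys_grad(1)[OF V[OF K(1)]], of v] v[OF K(1)] by blast
  have 1: "set_integrable lebesgue K (\<lambda>x. (A x *v grad_h \<T> u x) \<bullet> grad_h \<T> v x)"
    "(LINT x:K|lebesgue. (A x *v grad_h \<T> u x) \<bullet> grad_h \<T> v x) = - (LINT x:K|lebesgue. flux x \<bullet> grad (V K) x)"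
    if K: "K \<in> \<T>" for K
  proof -
    have eq: "(A x *v grad_h \<T> u x) \<bullet> grad_h \<T> v x = - (flux x \<bullet> grad (V K) x)" if "x \<in> interior K" for x
      unfolding gradv[OF K that] by (simp add: numerical_flux_def)
    have "set_integrable lebesgue K (\<lambda>x. - (flux x \<bullet> grad (V K) x))"
      using set_integrable_mult_right[OF flux_integrable[OF K polys_grad(2)[OF V[OF K]]], of "-1"] by simp
    then show "set_integrable lebesgue K (\<lambda>x. (A x *v grad_h \<T> u x) \<bullet> grad_h \<T> v x)"
      using LINT_triangle_cong(2)[OF triangles[OF K] eq] by simp
    show "(LINT x:K|lebesgue. (A x *v grad_h \<T> u x) \<bullet> grad_h \<T> v x) = - (LINT x:K|lebesgue. flux x \<bullet> grad (V K) x)"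
    proof -
      have "(LINT x:K|lebesgue. (A x *v grad_h \<T> u x) \<bullet> grad_h \<T> v x) = (LINT x:K|lebesgue. - (flux x \<bullet> grad (V K) x))"
        by (rule LINT_triangle_cong(1)[OF triangles[OF K] eq])
      then show ?thesis by (simp add: set_lebesgue_integral_def)
    qed
  qed
  have 2: "set_integrable lebesgue K (\<lambda>x. f x * v x)"
    "(LINT x:K|lebesgue. f x * v x) = (LINT x:K|lebesgue. f x * V K x)" if K: "K \<in> \<T>" for K
  proof -
    have eq: "f x * v x = f x * V K x" if "x \<in> interior K" for x using v[OF K that] by simp
    show "set_integrable lebesgue K (\<lambda>x. f x * v x)"
      using LINT_triangle_cong(2)[OF triangles[OF K] eq] source_integrable[OF K contV[OF K]] by simp
    show "(LINT x:K|lebesgue. f x * v x) = (LINT x:K|lebesgue. f x * V K x)"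
      by (rule LINT_triangle_cong(1)[OF triangles[OF K] eq])
  qed
  have "(\<Sum>F\<in>edges_on \<Gamma>N \<T>. edge_integral n F (\<lambda>x. g x * trace_from (K_minus \<T> n F) v x)) =
      (\<Sum>F\<in>edges_on \<Gamma>N \<T>. edge_integral n F (\<lambda>x. g x * V (K_minus \<T> n F) x))"
  proof (rule sum.cong[OF refl])
    fix F assume "F \<in> edges_on \<Gamma>N \<T>"
    then have Fe: "F \<in> edges \<T>" by (simp add: edges_on_def)
    show "edge_integral n F (\<lambda>x. g x * trace_from (K_minus \<T> n F) v x) =
        edge_integral n F (\<lambda>x. g x * V (K_minus \<T> n F) x)"
      by (intro edge_integral_cong_on[OF Fe]) (simp add: minus[OF Fe])
  qed
  moreover have "(LINT x:\<Omega>|lebesgue. (A x *v grad_h \<T> u x) \<bullet> grad_h \<T> v x) =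
      - (\<Sum>K\<in>\<T>. (LINT x:K|lebesgue. flux x \<bullet> grad (V K) x))"
    using LINT_domain(2)[OF 1(1)] 1(2) by (simp add: sum_negf)
  moreover have "(LINT x:\<Omega>|lebesgue. f x * v x) = (\<Sum>K\<in>\<T>. (LINT x:K|lebesgue. f x * V K x))"
    using LINT_domain(2)[OF 2(1)] 2(2) by simp
  ultimately show ?thesis
    using weak by (simp add: residual_def sum.distrib)
qed

lemma neumann_expansion:
  assumes "F \<in> edges_on \<Gamma>N \<T>"
  obtains c where "\<And>x. x \<in> rel_interior F \<Longrightarrow> g x = (\<Sum>i<k. c i * legendre_edge n i F x)"
proof -
  have Fe: "F \<in> edges \<T>" using assms by (simp add: edges_on_def)
  obtain p where p: "p \<in> polys (int k - 1)" "\<And>x. x \<in> rel_interior F \<Longrightarrow> g x = p x"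
    using neumann_data assms unfolding poly_on_def by blast
  obtain c where "\<And>x. x \<in> F \<Longrightarrow> p x = (\<Sum>i<k. c i * legendre_edge n i F x)"
    using polys_edge_expansion[OF Fe p(1)] by blast
  then have "g x = (\<Sum>i<k. c i * legendre_edge n i F x)" if "x \<in> rel_interior F" for x
    using p(2)[OF that] that rel_interior_subset by auto
  then show thesis using that by blast
qed

lemma neumann_integral_expansion:
  assumes "F \<in> edges_on \<Gamma>N \<T>" "continuous_on UNIV v"
    and "\<And>x. x \<in> rel_interior F \<Longrightarrow> g x = (\<Sum>i<k. c i * legendre_edge n i F x)"
  shows "edge_integral n F (\<lambda>x. g x * v x) = (\<Sum>i<k. c i * moment F i v)"
proof -
  have Fe: "F \<in> edges \<T>" using assms by (simp add: edges_on_def)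
  have "edge_integral n F (\<lambda>x. v x * g x) = (\<Sum>i<k. c i * moment F i v)"
    using assms(3) rel_interior_edge[OF Fe] by (intro edge_integral_expansion[OF assms(2) Fe]) auto
  then show ?thesis by (simp add: mult.commute)
qed

text \<open>This is where it matters that the Neumann data are polynomials of degree below \<open>k\<close>: they cannot
  see a function without moments.\<close>

lemma neumann_integral_zero:
  assumes "F \<in> edges_on \<Gamma>N \<T>" "continuous_on UNIV v"
    and "\<And>i. i < k \<Longrightarrow> moment F i v = 0"
  shows "edge_integral n F (\<lambda>x. g x * v x) = 0"
proof -
  obtain c where "\<And>x. x \<in> rel_interior F \<Longrightarrow> g x = (\<Sum>i<k. c i * legendre_edge n i F x)"
    using neumann_expansion[OF assms(1)] by blast
  from neumann_integral_expansion[OF assms(1,2) this] show ?thesis using assms(3) by simp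
qed

lemma finite_edges_on: "finite (edges_on \<Gamma> \<T>)"
  using finite_edges finite_subset[of "edges_on \<Gamma> \<T>" "edges \<T>"] by (auto simp: edges_on_def)

lemma K_minus_boundary:
  assumes "K \<in> \<T>" "F edge_of K" "F \<in> edges_on \<Gamma>N \<T> \<or> F \<in> edges_on \<Gamma>D \<T>"
  shows "K = K_minus \<T> n F"
  using element_of_edge_cases[OF assms(1,2)] interior_edge_not_on_boundary assms(3) by blast

text \<open>Extended by zero, \<open>b\<close> is a test function, and the Neumann term does not see it.\<close>

lemma residual_no_moments:
  assumes K: "K \<in> \<T>" and b: "b \<in> polys (int k)"
    and moments: "\<And>F j. F edge_of K \<Longrightarrow> j < k \<Longrightarrow> moment F j b = 0"
  shows "residual K b = 0"
proof -
  define V where "V = (\<lambda>K'. if K' = K then b else (\<lambda>x. 0))"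
  have mom: "moment F j (V K') = 0" if "F edge_of K'" "j < k" for F K' j
    using moments that by (cases "K' = K") (simp_all add: V_def edge_integral_0)
  have zero: "residual K' (\<lambda>x. 0) = 0" if "K' \<in> \<T>" for K'
    using residual_cmult[OF that polys_0, of 0] by simp
  have "(\<Sum>K'\<in>\<T>. residual K' (V K')) =
      (\<Sum>F\<in>edges_on \<Gamma>N \<T>. edge_integral n F (\<lambda>x. g x * V (K_minus \<T> n F) x))"
  proof (rule test_with_glued_polynomials)
    show "V K' \<in> polys (int k)" for K' using b polys_0 by (simp add: V_def)
    fix F j assume j: "j < k"
    show "moment F j (V (K_minus \<T> n F)) =
        moment F j (V (K_plus \<T> n F))" if "F \<in> interior_edges \<Omega> \<T>"
      using mom[OF K_plus(2)[OF that] j] mom[OF K_minus(2) j] that by (simp add: interior_edges_def)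
    show "moment F j (V (K_minus \<T> n F)) = 0" if "F \<in> edges_on \<Gamma>D \<T>"
      using mom[OF K_minus(2) j] that by (simp add: edges_on_def)
  qed
  also have "\<dots> = 0"
  proof (intro sum.neutral ballI)
    fix F assume F: "F \<in> edges_on \<Gamma>N \<T>"
    then have Fe: "F \<in> edges \<T>" by (simp add: edges_on_def)
    have "continuous_on UNIV (V (K_minus \<T> n F))"
      using polys_continuous_on[OF b] by (simp add: V_def)
    then show "edge_integral n F (\<lambda>x. g x * V (K_minus \<T> n F) x) = 0"
      using mom[OF K_minus(2)[OF Fe]] by (intro neumann_integral_zero[OF F]) auto
  qed
  also have "(\<Sum>K'\<in>\<T>. residual K' (V K')) = (\<Sum>K'\<in>\<T>. if K' = K then residual K b else 0)"
    using zero by (intro sum.cong) (auto simp: V_def)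
  also have "\<dots> = residual K b" using K finite_elements by simp
  finally show ?thesis .
qed

end

section \<open>Divergence and normal components of the recovered flux\<close>

locale flux_recovery = nc_discretization \<Omega> \<T> n \<Gamma>D \<Gamma>N \<D> A f g u k
  for \<Omega> \<T> n \<Gamma>D \<Gamma>N \<D> A f g u k +
  fixes P :: "point set \<Rightarrow> point \<Rightarrow> point \<Rightarrow> real" and \<phi> :: "nat \<Rightarrow> point set \<Rightarrow> point \<Rightarrow> real"
    and \<sigma> :: "point \<Rightarrow> point"
  assumes basis: "nc_basis \<Omega> \<T> n k P \<phi>"
    and recovered: "recovered_flux \<Gamma>N A f g \<T> n k \<phi> u \<sigma>"
begin

definition basis_poly :: "nat \<Rightarrow> point set \<Rightarrow> point set \<Rightarrow> point \<Rightarrow> real" where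
  "basis_poly i F K = (SOME p. p \<in> polys (int k) \<and> (\<forall>x\<in>interior K. \<phi> i F x = p x))"

lemma basis_in_nc_space:
  assumes "F \<in> edges \<T>" "i < k"
  shows "\<phi> i F \<in> nc_space \<Omega> \<T> n k"
  using basis assms unfolding nc_basis_def by simp

lemma basis_poly:
  assumes "F \<in> edges \<T>" "i < k" "K \<in> \<T>"
  shows "basis_poly i F K \<in> polys (int k)" "\<And>x. x \<in> interior K \<Longrightarrow> \<phi> i F x = basis_poly i F K x"
proof -
  have "poly_on (int k) (interior K) (\<phi> i F)"
    using basis_in_nc_space[OF assms(1,2)] assms(3) unfolding nc_space_def by simp
  then have "\<exists>p. p \<in> polys (int k) \<and> (\<forall>x\<in>interior K. \<phi> i F x = p x)"
    unfolding poly_on_def by auto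
  note * = someI_ex[OF this, folded basis_poly_def]
  show "basis_poly i F K \<in> polys (int k)" by (rule conjunct1[OF *])
  show "\<phi> i F x = basis_poly i F K x" if "x \<in> interior K" for x
    using conjunct2[OF *] that by (rule bspec)
qed

lemma basis_trace:
  assumes "F \<in> edges \<T>" "i < k" "K \<in> \<T>" "F' edge_of K" "x \<in> F'"
  shows "trace_from K (\<phi> i F) x = basis_poly i F K x"
  by (rule trace_from_element[OF assms(3,4) polys_continuous_on[OF basis_poly(1)[OF assms(1-3)]]
        basis_poly(2)[OF assms(1-3)] assms(5)])

lemma legendre_edge_polys_less: "j < k \<Longrightarrow> legendre_edge n j F \<in> polys (int k - 1)"
  using polys_mono[OF legendre_edge_polys] by simp

text \<open>The basis prescribes moments of the trace from one side. From the other side of an interior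
  edge they are the same, because the jump has no moments.\<close>

lemma basis_moment:
  assumes F: "F \<in> edges \<T>" and i: "i < k" and K: "K \<in> \<T>" and F': "F' edge_of K" and j: "j < k"
  shows "moment F' j (basis_poly i F K) =
    (if i = j \<and> F = F' then 1 else 0)"
proof -
  have F'e: "F' \<in> edges \<T>" using edgesI[OF K F'] .
  let ?M = "K_minus \<T> n F'"
  have M: "?M \<in> \<T>" "F' edge_of ?M" using K_minus[OF F'e] by simp_all
  have minus: "moment F' j (basis_poly i F ?M) = (if i = j \<and> F = F' then 1 else 0)"
  proof -
    have "moment F' j (basis_poly i F ?M) =
        edge_integral n F' (\<lambda>x. trace_from ?M (\<phi> i F) x * legendre_edge n j F' x)"
      using basis_trace[OF F i M] by (intro edge_integral_cong_on[OF F'e]) simp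
    then show ?thesis
      using basis F i F'e j unfolding nc_basis_def by simp
  qed
  from element_of_edge_cases[OF K F'] show ?thesis
  proof
    assume "K = ?M"
    then show ?thesis using minus by simp
  next
    assume plus: "F' \<in> interior_edges \<Omega> \<T> \<and> K = K_plus \<T> n F'"
    let ?L = "legendre_edge n j F'"
    have "edge_integral n F' (\<lambda>x. jump \<T> n (\<phi> i F) F' x * ?L x) = 0"
      using basis_in_nc_space[OF F i] plus legendre_edge_polys_less[OF j] unfolding nc_space_def by simp
    also have "edge_integral n F' (\<lambda>x. jump \<T> n (\<phi> i F) F' x * ?L x) =
        edge_integral n F' (\<lambda>x. basis_poly i F ?M x * ?L x - basis_poly i F K x * ?L x)"
      using basis_trace[OF F i M] basis_trace[OF F i K F'] plus
      by (intro edge_integral_cong_on[OF F'e]) (simp add: jump_def left_diff_distrib)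
    also have "\<dots> = moment F' j (basis_poly i F ?M) - moment F' j (basis_poly i F K)"
      using M K by (intro edge_integral_diff continuous_intros legendre_edge_continuous
          polys_continuous_on[OF basis_poly(1)[OF F i]]) auto
    finally show ?thesis using minus by simp
  qed
qed

text \<open>The restriction of a basis function to the elements that have its edge is still a test function:
  on all other edges of these elements its moments vanish, so they match those of the
  extension by zero. For an interior edge the two element contributions therefore cancel; for
  a Neumann edge the single contribution is the Neumann term of the basis function.\<close>

lemma residual_basis:
  assumes F: "F \<in> edges \<T>" and i: "i < k" and nD: "F \<notin> edges_on \<Gamma>D \<T>"
  shows "(\<Sum>K | K \<in> \<T> \<and> F edge_of K. residual K (basis_poly i F K)) =
    (if F \<in> edges_on \<Gamma>N \<T> then edge_integral n F (\<lambda>x. g x * basis_poly i F (K_minus \<T> n F) x) else 0)"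
proof -
  define V where "V = (\<lambda>K. if F edge_of K then basis_poly i F K else (\<lambda>x. 0))"
  have Vpoly: "V K \<in> polys (int k)" if "K \<in> \<T>" for K
    using basis_poly(1)[OF F i that] polys_0 by (simp add: V_def)
  have mom: "moment F' j (V K) = (if i = j \<and> F = F' then 1 else 0)"
    if "K \<in> \<T>" "F' edge_of K" "j < k" for K F' j
  proof (cases "F edge_of K")
    case True
    then show ?thesis using basis_moment[OF F i that] by (simp add: V_def)
  next
    case False
    then have "F \<noteq> F'" using that(2) by blast
    then show ?thesis using False by (simp add: V_def edge_integral_0)
  qed
  have zero: "residual K (\<lambda>x. 0) = 0" if "K \<in> \<T>" for K
    using residual_cmult[OF that polys_0, of 0] by simp
  have "(\<Sum>K\<in>\<T>. residual K (V K)) =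
      (\<Sum>F'\<in>edges_on \<Gamma>N \<T>. edge_integral n F' (\<lambda>x. g x * V (K_minus \<T> n F') x))"
  proof (rule test_with_glued_polynomials[OF Vpoly])
    fix F' j assume j: "j < k"
    show "moment F' j (V (K_minus \<T> n F')) =
        moment F' j (V (K_plus \<T> n F'))" if "F' \<in> interior_edges \<Omega> \<T>"
    proof -
      have "F' \<in> edges \<T>" using that by (simp add: interior_edges_def)
      then show ?thesis using mom[OF K_minus(1,2) j] mom[OF K_plus(1,2)[OF that] j] by simp
    qed
    show "moment F' j (V (K_minus \<T> n F')) = 0" if "F' \<in> edges_on \<Gamma>D \<T>"
    proof -
      have "F' \<in> edges \<T>" "F \<noteq> F'" using that nD by (auto simp: edges_on_def)
      then show ?thesis using mom[OF K_minus(1,2) j] by simp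
    qed
  qed
  also have "\<dots> = (\<Sum>F'\<in>edges_on \<Gamma>N \<T>. if F' = F then edge_integral n F (\<lambda>x. g x * basis_poly i F (K_minus \<T> n F) x) else 0)"
  proof (rule sum.cong[OF refl])
    fix F' assume F': "F' \<in> edges_on \<Gamma>N \<T>"
    then have F'e: "F' \<in> edges \<T>" by (simp add: edges_on_def)
    note M = K_minus(1,2)[OF F'e]
    show "edge_integral n F' (\<lambda>x. g x * V (K_minus \<T> n F') x) =
        (if F' = F then edge_integral n F (\<lambda>x. g x * basis_poly i F (K_minus \<T> n F) x) else 0)"
    proof (cases "F' = F")
      case True
      then show ?thesis using M by (simp add: V_def)
    next
      case False
      then have "edge_integral n F' (\<lambda>x. g x * V (K_minus \<T> n F') x) = 0"
        using mom[OF M] by (intro neumann_integral_zero[OF F' polys_continuous_on[OF Vpoly[OF M(1)]]]) auto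
      then show ?thesis using False by simp
    qed
  qed
  also have "\<dots> = (if F \<in> edges_on \<Gamma>N \<T> then edge_integral n F (\<lambda>x. g x * basis_poly i F (K_minus \<T> n F) x) else 0)"
    using finite_edges_on by simp
  also have "(\<Sum>K\<in>\<T>. residual K (V K)) = (\<Sum>K\<in>\<T>. if F edge_of K then residual K (basis_poly i F K) else 0)"
    using zero by (intro sum.cong) (auto simp: V_def)
  also have "\<dots> = (\<Sum>K | K \<in> \<T> \<and> F edge_of K. residual K (basis_poly i F K))"
    using finite_elements by (simp add: sum.inter_filter)
  finally show ?thesis .
qed

abbreviation legendre_norm2 :: "nat \<Rightarrow> point set \<Rightarrow> real" where
  "legendre_norm2 i F \<equiv> edge_integral n F (\<lambda>x. (legendre_edge n i F x)\<^sup>2)"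

text \<open>What is used of the recovered flux on one element, for a globally defined polynomial field \<open>G\<close>
  with divergence \<open>d\<close>. The edge moments have the same form for all edges here; on Neumann edges
  this is a consequence of the discrete equation.\<close>

definition is_local_flux :: "point set \<Rightarrow> (point \<Rightarrow> point) \<Rightarrow> (point \<Rightarrow> real) \<Rightarrow> bool" where
  "is_local_flux K G d \<longleftrightarrow>
     d \<in> polys (int k - 1) \<and> has_C1_div G d \<and> continuous_on UNIV G \<and>
     (\<forall>F\<in>edges \<T>. \<exists>b\<in>polys (int k - 1). \<forall>x\<in>F. G x \<bullet> n F = b x) \<and>
     (\<forall>x\<in>interior K. \<sigma> x = G x) \<and> rt_on (int k - 1) (interior K) \<sigma> \<and>
     (\<forall>p\<in>polys (int k - 1). (LINT x:K|lebesgue. G x \<bullet> grad p x) = (LINT x:K|lebesgue. flux x \<bullet> grad p x)) \<and>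
     (\<forall>F i. F edge_of K \<longrightarrow> i < k \<longrightarrow>
        moment F i (\<lambda>x. G x \<bullet> n F) =
        mu n K F * legendre_norm2 i F * residual K (basis_poly i F K))"

text \<open>On a Neumann edge the prescribed moment is a multiple of \<open>\<integral> g \<phi>\<close>, which \<open>residual_basis\<close> turns into
  the residual of the basis function.\<close>

lemma local_flux_exists:
  assumes K: "K \<in> \<T>"
  shows "\<exists>G d. is_local_flux K G d"
proof -
  obtain \<sigma>K where loc: "local_recovered_flux \<Gamma>N f g \<T> n k \<phi> flux K \<sigma>K" and \<sigma>: "\<And>x. x \<in> interior K \<Longrightarrow> \<sigma> x = \<sigma>K x"
    using recovered K unfolding recovered_flux_def by auto
  have rt: "rt_on (int k - 1) K \<sigma>K"
    and moments: "\<And>p q. p \<in> polys (int k - 2) \<Longrightarrow> q \<in> polys (int k - 2) \<Longrightarrow>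
        (LINT x:K|lebesgue. \<sigma>K x \<bullet> vector [p x, q x]) = (LINT x:K|lebesgue. flux x \<bullet> vector [p x, q x])"
    and edge: "\<And>F i. F edge_of K \<Longrightarrow> F \<notin> edges_on \<Gamma>N \<T> \<Longrightarrow> i < k \<Longrightarrow>
        moment F i (\<lambda>x. \<sigma>K x \<bullet> n F) =
        mu n K F * legendre_norm2 i F *
          ((LINT x:K|lebesgue. flux x \<bullet> grad_h \<T> (\<phi> i F) x) + (LINT x:K|lebesgue. f x * \<phi> i F x))"
    and edge_N: "\<And>F i. F edge_of K \<Longrightarrow> F \<in> edges_on \<Gamma>N \<T> \<Longrightarrow> i < k \<Longrightarrow>
        moment F i (\<lambda>x. \<sigma>K x \<bullet> n F) =
        mu n K F * legendre_norm2 i F * edge_integral n F (\<lambda>x. g x * trace_from K (\<phi> i F) x)"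
    using loc unfolding local_recovered_flux_def by auto
  obtain p q r where pqr: "p \<in> polys (int k - 1)" "q \<in> polys (int k - 1)" "r \<in> polys (int k - 1)"
    "\<And>x. x \<in> K \<Longrightarrow> \<sigma>K x = vector [p x, q x] + r x *\<^sub>R x"
    using rt unfolding rt_on_def by auto
  define G :: "point \<Rightarrow> point" where "G = (\<lambda>x. vector [p x, q x] + r x *\<^sub>R x)"
  obtain d where d: "d \<in> polys (int k - 1)" "has_C1_div G d"
    using rt_field_divergence[OF pqr(1-3)] unfolding G_def by auto
  have G\<sigma>: "\<sigma>K x = G x" if "x \<in> K" for x using pqr(4)[OF that] by (simp add: G_def)
  have int_G: "\<sigma> x = G x" if "x \<in> interior K" for x
    using \<sigma>[OF that] G\<sigma> that interior_subset by auto
  have "continuous_on UNIV G" unfolding G_def by (rule rt_field_continuous[OF pqr(1-3)])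
  moreover have "\<exists>b\<in>polys (int k - 1). \<forall>x\<in>F. G x \<bullet> n F = b x" if "F \<in> edges \<T>" for F
    unfolding G_def by (rule rt_field_normal_component[OF that pqr(1-3)])
  moreover have "rt_on (int k - 1) (interior K) \<sigma>"
    unfolding rt_on_def using pqr(1-3) int_G unfolding G_def by blast
  moreover have "(LINT x:K|lebesgue. G x \<bullet> grad s x) = (LINT x:K|lebesgue. flux x \<bullet> grad s x)"
    if s: "s \<in> polys (int k - 1)" for s
  proof -
    have "grad s x = vector [grad s x $ 1, grad s x $ 2]" for x
      by (simp add: vec_eq_iff forall_2)
    moreover have "(\<lambda>x. grad s x $ j) \<in> polys (int k - 2)" for j
      using polys_grad(3)[OF s, of j] by simp
    ultimately have "(LINT x:K|lebesgue. \<sigma>K x \<bullet> grad s x) = (LINT x:K|lebesgue. flux x \<bullet> grad s x)"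
      using moments[of "\<lambda>x. grad s x $ 1" "\<lambda>x. grad s x $ 2"] by simp
    moreover have "(LINT x:K|lebesgue. G x \<bullet> grad s x) = (LINT x:K|lebesgue. \<sigma>K x \<bullet> grad s x)"
    proof (rule LINT_triangle_cong(1)[OF triangles[OF K]])
      fix x assume "x \<in> interior K"
      then have "x \<in> K" using interior_subset by blast
      then show "G x \<bullet> grad s x = \<sigma>K x \<bullet> grad s x" by (simp only: G\<sigma>)
    qed
    ultimately show ?thesis by simp
  qed
  moreover have "moment F i (\<lambda>x. G x \<bullet> n F) =
      mu n K F * legendre_norm2 i F * residual K (basis_poly i F K)" if F: "F edge_of K" and i: "i < k" for F i
  proof -
    have Fe: "F \<in> edges \<T>" using edgesI[OF K F] .
    have "moment F i (\<lambda>x. G x \<bullet> n F) =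
        moment F i (\<lambda>x. \<sigma>K x \<bullet> n F)"
      using G\<sigma> edge_of_imp_subset[OF F] by (intro edge_integral_cong_on[OF Fe]) auto
    also have "\<dots> = mu n K F * legendre_norm2 i F * residual K (basis_poly i F K)"
    proof (cases "F \<in> edges_on \<Gamma>N \<T>")
      case False
      have "grad_h \<T> (\<phi> i F) x = grad (basis_poly i F K) x" if x: "x \<in> interior K" for x
        unfolding grad_h_interior[OF K x]
        by (rule grad_eq_on_open[OF open_interior x basis_poly(2)[OF Fe i K] polys_grad(1)[OF basis_poly(1)[OF Fe i K]]])
      then have "(LINT x:K|lebesgue. flux x \<bullet> grad_h \<T> (\<phi> i F) x) = (LINT x:K|lebesgue. flux x \<bullet> grad (basis_poly i F K) x)"
        by (intro LINT_triangle_cong(1)[OF triangles[OF K]]) simp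
      moreover have "(LINT x:K|lebesgue. f x * \<phi> i F x) = (LINT x:K|lebesgue. f x * basis_poly i F K x)"
        by (intro LINT_triangle_cong(1)[OF triangles[OF K]]) (simp add: basis_poly(2)[OF Fe i K])
      ultimately show ?thesis
        unfolding edge[OF F False i] residual_def by simp
    next
      case True
      have KM: "K = K_minus \<T> n F" using K_minus_boundary[OF K F] True by blast
      have "edge_integral n F (\<lambda>x. g x * trace_from K (\<phi> i F) x) = edge_integral n F (\<lambda>x. g x * basis_poly i F K x)"
        using basis_trace[OF Fe i K F] by (intro edge_integral_cong_on[OF Fe]) simp
      also have "\<dots> = (\<Sum>K | K \<in> \<T> \<and> F edge_of K. residual K (basis_poly i F K))"
        using residual_basis[OF Fe i] dirichlet_neumann_disjoint[OF True] True KM by simp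
      also have "\<dots> = residual K (basis_poly i F K)"
        using elements_of_edge[OF Fe] interior_edge_not_on_boundary(2)[of F] True KM by auto
      finally show ?thesis unfolding edge_N[OF F True i] by simp
    qed
    finally show ?thesis .
  qed
  ultimately have "is_local_flux K G d"
    unfolding is_local_flux_def using d int_G by blast
  then show ?thesis by blast
qed

text \<open>Integration by parts turns \<open>\<integral> d p\<close> into \<open>- \<integral> flux \<bullet> \<nabla>p\<close> plus edge terms. If \<open>p\<close> has the Legendre
  coefficients \<open>c F i\<close> on the edges, then the edge terms add up to the residual of the combination \<open>w\<close> of
  basis functions with the coefficients \<open>c F i \<parallel>L\<^sub>i\<parallel>\<^sup>2\<close>. By orthogonality \<open>w\<close> has the same edge moments
  as \<open>p\<close>, so \<open>w\<close> and \<open>p\<close> have the same residual, which is \<open>\<integral> flux \<bullet> \<nabla>p + \<integral> f p\<close>.\<close>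

lemma local_flux_divergence:
  assumes K: "K \<in> \<T>" and G: "is_local_flux K G d" and p: "p \<in> polys (int k - 1)"
  shows "(LINT x:K|lebesgue. d x * p x) = (LINT x:K|lebesgue. f x * p x)"
proof -
  have G1: "has_C1_div G d" "continuous_on UNIV G"
    and grads: "(LINT x:K|lebesgue. G x \<bullet> grad p x) = (LINT x:K|lebesgue. flux x \<bullet> grad p x)"
    and edge: "\<And>F i. F edge_of K \<Longrightarrow> i < k \<Longrightarrow> moment F i (\<lambda>x. G x \<bullet> n F) =
        mu n K F * legendre_norm2 i F * residual K (basis_poly i F K)"
    using G p unfolding is_local_flux_def by simp_all
  have "\<forall>F. \<exists>c. F edge_of K \<longrightarrow> (\<forall>x\<in>F. p x = (\<Sum>i<k. c i * legendre_edge n i F x))"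
    using polys_edge_expansion[OF edgesI[OF K] p] by metis
  then obtain c where c: "\<And>F x. F edge_of K \<Longrightarrow> x \<in> F \<Longrightarrow> p x = (\<Sum>i<k. c F i * legendre_edge n i F x)"
    by metis
  have expand: "edge_integral n F (\<lambda>x. v x * p x) = (\<Sum>i<k. c F i * moment F i v)"
    if F: "F edge_of K" and v: "continuous_on UNIV v" for F v
    using c[OF F] linepath_in_edge[OF edgesI[OF K F]]
    by (intro edge_integral_expansion[OF v edgesI[OF K F]]) auto
  have fin: "finite {F. F edge_of K}" using finite_edges_of_element[OF K] .
  \<comment> \<open>The factor \<open>\<parallel>L\<^sub>i\<parallel>\<^sup>2\<close> turns Legendre coefficients into moments, in which the basis is dual.\<close>
  define w where "w = (\<lambda>x. \<Sum>F | F edge_of K. \<Sum>i<k. c F i * legendre_norm2 i F * basis_poly i F K x)"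
  have bp: "basis_poly i F K \<in> polys (int k)" if "F edge_of K" "i < k" for i F
    using basis_poly(1)[OF edgesI[OF K that(1)] that(2) K] .
  have w_poly: "w \<in> polys (int k)"
    unfolding w_def by (intro polys_sum polys_cmult bp) auto
  have p_poly: "p \<in> polys (int k)" using polys_mono[OF p] by simp
  have "residual K (\<lambda>x. p x - w x) = 0"
  proof (rule residual_no_moments[OF K polys_diff[OF p_poly w_poly]])
    fix F' j assume F': "F' edge_of K" and j: "j < k"
    let ?L = "legendre_edge n j F'"
    have "edge_integral n F' (\<lambda>x. ?L x * p x) = (\<Sum>i<k. c F' i * moment F' i ?L)"
      by (rule expand[OF F' legendre_edge_continuous])
    also have "\<dots> = (\<Sum>i<k. if i = j then c F' j * legendre_norm2 j F' else 0)"
      using legendre_edge_orthogonal[OF edgesI[OF K F']] by (intro sum.cong) (auto simp: power2_eq_square)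
    finally have 1: "moment F' j p = c F' j * legendre_norm2 j F'"
      using j by (simp add: mult.commute)
    have "moment F' j w =
        edge_integral n F' (\<lambda>x. \<Sum>F | F edge_of K. \<Sum>i<k. c F i * legendre_norm2 i F * (basis_poly i F K x * ?L x))"
      by (simp add: w_def sum_distrib_right mult.assoc)
    also have "\<dots> = (\<Sum>F | F edge_of K. \<Sum>i<k. c F i * legendre_norm2 i F * moment F' j (basis_poly i F K))"
    proof -
      have cont: "continuous_on UNIV (\<lambda>x. c F i * legendre_norm2 i F * (basis_poly i F K x * ?L x))"
        if "F edge_of K" "i < k" for F i
        by (intro continuous_intros legendre_edge_continuous polys_continuous_on[OF bp[OF that]])
      have "edge_integral n F' (\<lambda>x. \<Sum>i<k. c F i * legendre_norm2 i F * (basis_poly i F K x * ?L x)) =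
          (\<Sum>i<k. c F i * legendre_norm2 i F * moment F' j (basis_poly i F K))" if "F edge_of K" for F
        by (subst edge_integral_sum) (use cont[OF that] in \<open>auto simp: edge_integral_cmult\<close>)
      then show ?thesis
        by (subst edge_integral_sum) (use cont in \<open>auto intro!: continuous_on_sum\<close>)
    qed
    also have "\<dots> = (\<Sum>F | F edge_of K. if F = F' then c F' j * legendre_norm2 j F' else 0)"
    proof (rule sum.cong[OF refl])
      fix F assume F: "F \<in> {F. F edge_of K}"
      have "(\<Sum>i<k. c F i * legendre_norm2 i F * moment F' j (basis_poly i F K)) =
          (\<Sum>i<k. if i = j then (if F = F' then c F' j * legendre_norm2 j F' else 0) else 0)"
        using basis_moment[OF edgesI[OF K] _ K F' j] F by (intro sum.cong) auto
      then show "(\<Sum>i<k. c F i * legendre_norm2 i F * moment F' j (basis_poly i F K)) =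
          (if F = F' then c F' j * legendre_norm2 j F' else 0)"
        using j by simp
    qed
    also have "\<dots> = c F' j * legendre_norm2 j F'" using F' fin by simp
    finally have 2: "moment F' j w = c F' j * legendre_norm2 j F'" .
    have "moment F' j (\<lambda>x. p x - w x) = moment F' j p - moment F' j w"
      unfolding left_diff_distrib
      by (intro edge_integral_diff continuous_intros legendre_edge_continuous polys_continuous_on[OF p] polys_continuous_on[OF w_poly])
    then show "moment F' j (\<lambda>x. p x - w x) = 0" using 1 2 by simp
  qed
  then have res: "residual K p = residual K w"
    using residual_diff[OF K p_poly w_poly] by simp
  have "residual K w = (\<Sum>F | F edge_of K. residual K (\<lambda>x. \<Sum>i<k. c F i * legendre_norm2 i F * basis_poly i F K x))"
    unfolding w_def by (rule residual_sum[OF K, of _ _ "int k"]) (auto intro!: polys_sum polys_cmult bp)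
  also have "\<dots> = (\<Sum>F | F edge_of K. \<Sum>i<k. c F i * legendre_norm2 i F * residual K (basis_poly i F K))"
  proof (rule sum.cong[OF refl])
    fix F assume F: "F \<in> {F. F edge_of K}"
    have "residual K (\<lambda>x. \<Sum>i<k. c F i * legendre_norm2 i F * basis_poly i F K x) =
        (\<Sum>i<k. residual K (\<lambda>x. c F i * legendre_norm2 i F * basis_poly i F K x))"
      using F by (intro residual_sum[OF K, of _ _ "int k"]) (auto intro!: polys_cmult bp)
    also have "\<dots> = (\<Sum>i<k. c F i * legendre_norm2 i F * residual K (basis_poly i F K))"
      using F by (intro sum.cong refl residual_cmult[OF K bp]) auto
    finally show "residual K (\<lambda>x. \<Sum>i<k. c F i * legendre_norm2 i F * basis_poly i F K x) =
        (\<Sum>i<k. c F i * legendre_norm2 i F * residual K (basis_poly i F K))" .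
  qed
  also have "\<dots> = (\<Sum>F | F edge_of K. mu n K F * edge_integral n F (\<lambda>x. (G x \<bullet> n F) * p x))"
  proof (rule sum.cong[OF refl])
    fix F assume "F \<in> {F. F edge_of K}"
    then have F: "F edge_of K" by simp
    have "edge_integral n F (\<lambda>x. (G x \<bullet> n F) * p x) =
        (\<Sum>i<k. c F i * moment F i (\<lambda>x. G x \<bullet> n F))"
      by (rule expand[OF F]) (intro continuous_intros G1(2))
    also have "\<dots> = (\<Sum>i<k. c F i * (mu n K F * legendre_norm2 i F * residual K (basis_poly i F K)))"
      using edge[OF F] by (intro sum.cong) auto
    also have "\<dots> = mu n K F * (\<Sum>i<k. c F i * legendre_norm2 i F * residual K (basis_poly i F K))"
      by (simp add: sum_distrib_left mult_ac)
    finally show "(\<Sum>i<k. c F i * legendre_norm2 i F * residual K (basis_poly i F K)) =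
        mu n K F * edge_integral n F (\<lambda>x. (G x \<bullet> n F) * p x)"
      using mu_cases[of K F] by auto
  qed
  also have "\<dots> = (LINT x:K|lebesgue. d x * p x) + (LINT x:K|lebesgue. G x \<bullet> grad p x)"
    by (rule green_formula[OF K G1(1) polys_grad(1,2)[OF p], symmetric])
  finally show ?thesis
    using res grads by (simp add: residual_def)
qed

text \<open>Both normal components are polynomials of degree below \<open>k\<close>, and their moments are the residuals
  of one basis function on the two elements, up to the orientation sign. These residuals cancel.\<close>

lemma normal_flux_continuous:
  assumes F: "F \<in> interior_edges \<Omega> \<T>"
    and G: "is_local_flux (K_minus \<T> n F) G d" and G': "is_local_flux (K_plus \<T> n F) G' d'" and x: "x \<in> F"
  shows "G x \<bullet> n F = G' x \<bullet> n F"
proof -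
  have Fe: "F \<in> edges \<T>" using F by (simp add: interior_edges_def)
  obtain b where b: "b \<in> polys (int k - 1)" "\<And>x. x \<in> F \<Longrightarrow> G x \<bullet> n F = b x"
    using G Fe unfolding is_local_flux_def by auto
  obtain b' where b': "b' \<in> polys (int k - 1)" "\<And>x. x \<in> F \<Longrightarrow> G' x \<bullet> n F = b' x"
    using G' Fe unfolding is_local_flux_def by auto
  have "b x - b' x = 0"
  proof (rule edge_moments_determine[OF Fe polys_diff[OF b(1) b'(1)] _ x])
    fix i assume i: "i < k"
    let ?L = "legendre_edge n i F"
    have "moment F i b = moment F i (\<lambda>x. G x \<bullet> n F)"
      using b(2) by (intro edge_integral_cong_on[OF Fe]) simp
    also have "\<dots> = legendre_norm2 i F * residual (K_minus \<T> n F) (basis_poly i F (K_minus \<T> n F))"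
      using G K_minus(2)[OF Fe] i mu_K_minus[OF Fe] unfolding is_local_flux_def by simp
    finally have 1: "moment F i b = \<dots>" .
    have "moment F i b' = moment F i (\<lambda>x. G' x \<bullet> n F)"
      using b'(2) by (intro edge_integral_cong_on[OF Fe]) simp
    also have "\<dots> = - (legendre_norm2 i F * residual (K_plus \<T> n F) (basis_poly i F (K_plus \<T> n F)))"
      using G' K_plus(2)[OF F] i mu_K_plus[OF F] unfolding is_local_flux_def by simp
    finally have 2: "moment F i b' = \<dots>" .
    have "residual (K_minus \<T> n F) (basis_poly i F (K_minus \<T> n F)) + residual (K_plus \<T> n F) (basis_poly i F (K_plus \<T> n F)) = 0"
      using residual_basis[OF Fe i interior_edge_not_on_boundary(1)[OF F]] interior_edge_not_on_boundary(2)[OF F]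
        elements_of_edge[OF Fe] K_minus_neq_K_plus[OF F] F by simp
    moreover have "moment F i (\<lambda>x. b x - b' x) = moment F i b - moment F i b'"
      unfolding left_diff_distrib
      by (intro edge_integral_diff continuous_intros legendre_edge_continuous polys_continuous_on[OF b(1)] polys_continuous_on[OF b'(1)])
    ultimately show "moment F i (\<lambda>x. b x - b' x) = 0"
      unfolding 1 2 by (simp add: distrib_left[symmetric])
  qed
  then show ?thesis using b(2)[OF x] b'(2)[OF x] by simp
qed

text \<open>Testing \<open>g\<close> with the dual basis function \<open>\<phi> i F\<close> gives its Legendre coefficient \<open>c i\<close>, and the
  factor \<open>\<parallel>L\<^sub>i\<parallel>\<^sup>2\<close> in the definition of the flux turns the coefficient into the moment.\<close>

lemma normal_flux_neumann:
  assumes F: "F \<in> edges_on \<Gamma>N \<T>" and G: "is_local_flux (K_minus \<T> n F) G d" and x: "x \<in> rel_interior F"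
  shows "G x \<bullet> n F = g x"
proof -
  have Fe: "F \<in> edges \<T>" using F by (simp add: edges_on_def)
  let ?K = "K_minus \<T> n F"
  note K = K_minus(1,2)[OF Fe]
  have xF: "x \<in> F" using x rel_interior_subset by blast
  obtain b where b: "b \<in> polys (int k - 1)" "\<And>x. x \<in> F \<Longrightarrow> G x \<bullet> n F = b x"
    using G Fe unfolding is_local_flux_def by auto
  obtain c where c: "\<And>x. x \<in> rel_interior F \<Longrightarrow> g x = (\<Sum>i<k. c i * legendre_edge n i F x)"
    using neumann_expansion[OF F] by blast
  define q where "q = (\<lambda>x. \<Sum>i<k. c i * legendre_edge n i F x)"
  have q: "q \<in> polys (int k - 1)"
    unfolding q_def by (intro polys_sum polys_cmult legendre_edge_polys_less) simp
  have "b x - q x = 0"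
  proof (rule edge_moments_determine[OF Fe polys_diff[OF b(1) q] _ xF])
    fix i assume i: "i < k"
    let ?L = "legendre_edge n i F"
    have "residual ?K (basis_poly i F ?K) = (\<Sum>K | K \<in> \<T> \<and> F edge_of K. residual K (basis_poly i F K))"
      using elements_of_edge[OF Fe] interior_edge_not_on_boundary(2)[of F] F by auto
    also have "\<dots> = edge_integral n F (\<lambda>x. g x * basis_poly i F ?K x)"
      using residual_basis[OF Fe i dirichlet_neumann_disjoint[OF F]] F by simp
    also have "\<dots> = (\<Sum>j<k. c j * moment F j (basis_poly i F ?K))"
      by (rule neumann_integral_expansion[OF F polys_continuous_on[OF basis_poly(1)[OF Fe i K(1)]] c])
    also have "\<dots> = (\<Sum>j<k. if j = i then c i else 0)"
      using basis_moment[OF Fe i K] by (intro sum.cong) auto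
    finally have res: "residual ?K (basis_poly i F ?K) = c i" using i by simp
    have "moment F i b = moment F i (\<lambda>x. G x \<bullet> n F)"
      using b(2) by (intro edge_integral_cong_on[OF Fe]) simp
    also have "\<dots> = legendre_norm2 i F * c i"
      using G K(2) i mu_K_minus[OF Fe] res unfolding is_local_flux_def by simp
    finally have 1: "moment F i b = legendre_norm2 i F * c i" .
    have "edge_integral n F (\<lambda>x. ?L x * q x) = (\<Sum>j<k. c j * moment F j ?L)"
      by (rule edge_integral_expansion[OF legendre_edge_continuous Fe]) (simp add: q_def)
    also have "\<dots> = (\<Sum>j<k. if j = i then c i * legendre_norm2 i F else 0)"
      using legendre_edge_orthogonal[OF Fe] by (intro sum.cong) (auto simp: power2_eq_square)
    finally have 2: "moment F i q = legendre_norm2 i F * c i"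
      using i by (simp add: mult.commute)
    have "moment F i (\<lambda>x. b x - q x) = moment F i b - moment F i q"
      unfolding left_diff_distrib
      by (intro edge_integral_diff continuous_intros legendre_edge_continuous polys_continuous_on[OF b(1)] polys_continuous_on[OF q])
    then show "moment F i (\<lambda>x. b x - q x) = 0" using 1 2 by simp
  qed
  then show ?thesis using b(2)[OF xF] c[OF x] by (simp add: q_def)
qed

text \<open>The divergence has the degree and the moments required of the projection. A second
  candidate differs by a polynomial \<open>e\<close> with \<open>\<integral> e\<^sup>2 = 0\<close>.\<close>

lemma L2_projection_local_flux:
  assumes K: "K \<in> \<T>" and G: "is_local_flux K G d"
  shows "L2_projection (int k - 1) K f = d"
  unfolding L2_projection_def
proof (rule the_equality)
  have d: "d \<in> polys (int k - 1)" using G unfolding is_local_flux_def by simp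
  then show "d \<in> polys (int k - 1) \<and> (\<forall>q\<in>polys (int k - 1). (LINT x:K|lebesgue. d x * q x) = (LINT x:K|lebesgue. f x * q x))"
    using local_flux_divergence[OF K G] by blast
  fix p assume p: "p \<in> polys (int k - 1) \<and> (\<forall>q\<in>polys (int k - 1). (LINT x:K|lebesgue. p x * q x) = (LINT x:K|lebesgue. f x * q x))"
  define e where "e = (\<lambda>x. p x - d x)"
  have e: "e \<in> polys (int k - 1)" unfolding e_def using polys_diff p d by blast
  have int: "set_integrable lebesgue K (\<lambda>x. v x * e x)" if "v \<in> polys (int k - 1)" for v
    by (rule set_integrable_element[OF K, of "\<lambda>x. v x * e x"])
      (intro continuous_intros polys_continuous_on[OF that] polys_continuous_on[OF e], simp)
  have "(LINT x:K|lebesgue. e x * e x) = (LINT x:K|lebesgue. p x * e x - d x * e x)"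
    by (simp add: e_def left_diff_distrib)
  also have "\<dots> = (LINT x:K|lebesgue. p x * e x) - (LINT x:K|lebesgue. d x * e x)"
    using int p d by (intro set_integral_diff(2)) auto
  also have "\<dots> = 0" using p e local_flux_divergence[OF K G e] by simp
  finally have "(LINT x:K|lebesgue. e x * e x) = 0" .
  then have "e x = 0" if "x \<in> interior K" for x
    using LINT_square_eq_0_triangle[OF triangles[OF K] polys_continuous_on[OF e] _ that] by blast
  then have "e x = 0" for x
    using polys_eq_0I[OF e open_interior interior_triangle_nonempty[OF triangles[OF K]]] by blast
  then show "p = d" by (simp add: fun_eq_iff e_def)
qed

lemma test_function_gradient:
  assumes "\<psi> \<in> test_functions \<Omega>"
  shows "GDERIV \<psi> x :> grad \<psi> x" "continuous_on UNIV (grad \<psi>)" "x \<notin> \<Omega> \<Longrightarrow> \<psi> x = 0"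
proof -
  have "Ck (Suc 0) \<psi>" and supp: "closure {x. \<psi> x \<noteq> 0} \<subseteq> \<Omega>"
    using assms unfolding test_functions_def by blast+
  then have diff: "\<psi> differentiable (at x)" and cont: "continuous_on UNIV (\<lambda>x. grad \<psi> x $ i)" for x i
    by auto
  obtain \<psi>' where \<psi>': "(\<psi> has_derivative \<psi>') (at x)"
    using diff unfolding differentiable_def by blast
  then have "linear \<psi>'" using has_derivative_linear by blast
  then have "\<psi>' = (\<lambda>h. h \<bullet> adjoint \<psi>' 1)"
    using adjoint_works[of \<psi>' _ "1 :: real"] by (simp add: fun_eq_iff)
  then have "GDERIV \<psi> x :> adjoint \<psi>' 1"
    using \<psi>' by (simp add: gderiv_def)
  then show "GDERIV \<psi> x :> grad \<psi> x"
    using GDERIV_unique_grad by metis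
  have "continuous_on UNIV (\<lambda>x. \<chi> i. grad \<psi> x $ i)"
    by (intro continuous_on_vec_lambda cont)
  then show "continuous_on UNIV (grad \<psi>)" by simp
  have "{x. \<psi> x \<noteq> 0} \<subseteq> \<Omega>"
    using closure_subset supp by (rule order_trans)
  then show "x \<notin> \<Omega> \<Longrightarrow> \<psi> x = 0" by auto
qed

text \<open>Green's formula on the elements yields the weak divergence up to edge terms. These cancel on
  interior edges by continuity of the normal component, and on boundary edges the test
  function vanishes.\<close>

lemma recovered_flux_in_Sigma: "\<sigma> \<in> Sigma_f \<Omega> \<Gamma>N f g \<T> n (int k - 1)"
proof -
  have "\<forall>K\<in>\<T>. \<exists>Gd. is_local_flux K (fst Gd) (snd Gd)"
    using local_flux_exists by auto
  then obtain Gd where Gd: "\<And>K. K \<in> \<T> \<Longrightarrow> is_local_flux K (fst (Gd K)) (snd (Gd K))"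
    by metis
  define G d where "G = (\<lambda>K. fst (Gd K))" and "d = (\<lambda>K. snd (Gd K))"
  have loc: "is_local_flux K (G K) (d K)" if "K \<in> \<T>" for K
    using Gd[OF that] by (simp add: G_def d_def)
  have G: "has_C1_div (G K) (d K)" "continuous_on UNIV (G K)" "continuous_on UNIV (d K)"
    "\<And>x. x \<in> interior K \<Longrightarrow> \<sigma> x = G K x" "rt_on (int k - 1) (interior K) \<sigma>" if "K \<in> \<T>" for K
    using loc[OF that] polys_continuous_on unfolding is_local_flux_def by auto
  define w where "w = broken_L2_projection (int k - 1) \<T> f"
  have w: "w x = d K x" if "K \<in> \<T>" "x \<in> interior K" for K x
  proof -
    have "w x = glue (\<lambda>K. L2_projection (int k - 1) K f) x"
      unfolding w_def broken_L2_projection_def glue_def ..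
    also have "\<dots> = d K x"
      using glue_interior[OF that] L2_projection_local_flux[OF that(1) loc[OF that(1)]] by simp
    finally show ?thesis .
  qed
  have "L2 \<Omega> \<sigma>" "L2 \<Omega> w"
    using G(2,3,4) w by (blast intro: L2_piecewise_continuous)+
  moreover have "has_weak_div \<Omega> \<sigma> w"
    unfolding has_weak_div_def
  proof
    fix \<psi> assume "\<psi> \<in> test_functions \<Omega>"
    note \<psi> = test_function_gradient[OF this]
    have cont\<psi>: "continuous_on UNIV \<psi>" by (rule GDERIV_imp_continuous_on[OF \<psi>(1)])
    have 1: "set_integrable lebesgue K (\<lambda>x. \<sigma> x \<bullet> grad \<psi> x)"
      "(LINT x:K|lebesgue. \<sigma> x \<bullet> grad \<psi> x) = (LINT x:K|lebesgue. G K x \<bullet> grad \<psi> x)" if K: "K \<in> \<T>" for K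
    proof -
      have "continuous_on UNIV (\<lambda>x. G K x \<bullet> grad \<psi> x)"
        by (intro continuous_intros G(2)[OF K] \<psi>(2))
      then show "set_integrable lebesgue K (\<lambda>x. \<sigma> x \<bullet> grad \<psi> x)"
        by (rule set_integrable_element[OF K]) (simp add: G(4)[OF K])
      show "(LINT x:K|lebesgue. \<sigma> x \<bullet> grad \<psi> x) = (LINT x:K|lebesgue. G K x \<bullet> grad \<psi> x)"
        by (rule LINT_triangle_cong(1)[OF triangles[OF K]]) (simp add: G(4)[OF K])
    qed
    have 2: "set_integrable lebesgue K (\<lambda>x. w x * \<psi> x)"
      "(LINT x:K|lebesgue. w x * \<psi> x) = (LINT x:K|lebesgue. d K x * \<psi> x)" if K: "K \<in> \<T>" for K
    proof -
      have "continuous_on UNIV (\<lambda>x. d K x * \<psi> x)"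
        by (intro continuous_intros G(3)[OF K] cont\<psi>)
      then show "set_integrable lebesgue K (\<lambda>x. w x * \<psi> x)"
        by (rule set_integrable_element[OF K]) (simp add: w[OF K])
      show "(LINT x:K|lebesgue. w x * \<psi> x) = (LINT x:K|lebesgue. d K x * \<psi> x)"
        by (rule LINT_triangle_cong(1)[OF triangles[OF K]]) (simp add: w[OF K])
    qed
    define h where "h = (\<lambda>K F. mu n K F * edge_integral n F (\<lambda>x. (G K x \<bullet> n F) * \<psi> x))"
    have "(LINT x:\<Omega>|lebesgue. w x * \<psi> x) + (LINT x:\<Omega>|lebesgue. \<sigma> x \<bullet> grad \<psi> x) =
        (\<Sum>K\<in>\<T>. (LINT x:K|lebesgue. d K x * \<psi> x) + (LINT x:K|lebesgue. G K x \<bullet> grad \<psi> x))"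
      using LINT_domain(2)[OF 1(1)] LINT_domain(2)[OF 2(1)] 1(2) 2(2) by (simp add: sum.distrib)
    also have "\<dots> = (\<Sum>K\<in>\<T>. \<Sum>F | F edge_of K. h K F)"
      unfolding h_def using green_formula[OF _ G(1) \<psi>(1,2)] by (intro sum.cong) auto
    also have "\<dots> = (\<Sum>F\<in>edges \<T>. h (K_minus \<T> n F) F + (if F \<in> interior_edges \<Omega> \<T> then h (K_plus \<T> n F) F else 0))"
      by (rule sum_over_element_edges)
    also have "\<dots> = 0"
    proof (intro sum.neutral ballI)
      fix F assume F: "F \<in> edges \<T>"
      show "h (K_minus \<T> n F) F + (if F \<in> interior_edges \<Omega> \<T> then h (K_plus \<T> n F) F else 0) = 0"
      proof (cases "F \<in> interior_edges \<Omega> \<T>")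
        case True
        have "edge_integral n F (\<lambda>x. (G (K_minus \<T> n F) x \<bullet> n F) * \<psi> x) = edge_integral n F (\<lambda>x. (G (K_plus \<T> n F) x \<bullet> n F) * \<psi> x)"
          using normal_flux_continuous[OF True loc[OF K_minus(1)[OF F]] loc[OF K_plus(1)[OF True]]]
          by (intro edge_integral_cong_on[OF F]) simp
        then show ?thesis using True mu_K_minus[OF F] mu_K_plus[OF True] by (simp add: h_def)
      next
        case False
        then have "F \<subseteq> frontier \<Omega>" using F by (simp add: interior_edges_def)
        then have "\<psi> x = 0" if "x \<in> F" for x
          using that \<psi>(3)[of x] open_domain by (auto simp: frontier_def interior_open)
        then have "edge_integral n F (\<lambda>x. (G (K_minus \<T> n F) x \<bullet> n F) * \<psi> x) = edge_integral n F (\<lambda>x. 0)"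
          by (intro edge_integral_cong_on[OF F]) simp
        then show ?thesis using False by (simp add: h_def edge_integral_0)
      qed
    qed
    finally show "(LINT x:\<Omega>|lebesgue. \<sigma> x \<bullet> grad \<psi> x) = - (LINT x:\<Omega>|lebesgue. w x * \<psi> x)"
      by simp
  qed
  moreover have "trace_from (K_minus \<T> n F) \<sigma> x \<bullet> n F = g x"
    if F: "F \<in> edges_on \<Gamma>N \<T>" and x: "x \<in> rel_interior F" for F x
  proof -
    have Fe: "F \<in> edges \<T>" using F by (simp add: edges_on_def)
    note K = K_minus(1,2)[OF Fe]
    have xF: "x \<in> F" using x rel_interior_subset by blast
    have "trace_from (K_minus \<T> n F) \<sigma> x = G (K_minus \<T> n F) x"
      by (rule trace_from_element[OF K G(2)[OF K(1)] _ xF]) (rule G(4)[OF K(1)])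
    then show ?thesis
      using normal_flux_neumann[OF F loc[OF K(1)] x] by simp
  qed
  ultimately show ?thesis
    unfolding Sigma_f_def RT_space_def H_div_def w_def using G(5) by blast
qed

end

theorem theorem4p6:
  fixes \<Omega> \<Gamma>D \<Gamma>N :: "(real ^ 2) set"
    and \<D> \<T> :: "(real ^ 2) set set"
    and A :: "real ^ 2 \<Rightarrow> real ^ 2 ^ 2"
    and f g u :: "real ^ 2 \<Rightarrow> real"
    and n :: "(real ^ 2) set \<Rightarrow> real ^ 2"
    and P :: "(real ^ 2) set \<Rightarrow> real ^ 2 \<Rightarrow> real ^ 2 \<Rightarrow> real"
    and \<phi> :: "nat \<Rightarrow> (real ^ 2) set \<Rightarrow> real ^ 2 \<Rightarrow> real"
    and \<sigma> :: "real ^ 2 \<Rightarrow> real ^ 2"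
    and k :: nat
  assumes "polygonal_lipschitz_domain \<Omega>"
    and "boundary_decomposition \<Omega> \<Gamma>D \<Gamma>N"
    and "piecewise_constant_spd \<Omega> \<D> A"
    and "L2 \<Omega> f"
    and "mesh \<Omega> \<D> \<T>"
    and "edge_normals \<Omega> \<T> n"
    and "1 \<le> k" and "odd k"
    and "\<forall>F\<in>edges_on \<Gamma>N \<T>. poly_on (int k - 1) (rel_interior F) g"
    and "lagrange_functions \<T> k P"
    and "nc_basis \<Omega> \<T> n k P \<phi>"
    and "nc_solution \<Omega> \<Gamma>D \<Gamma>N A f g \<T> n k u"
    and "recovered_flux \<Gamma>N A f g \<T> n k \<phi> u \<sigma>"
  shows "\<sigma> \<in> Sigma_f \<Omega> \<Gamma>N f g \<T> n (int k - 1)"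
proof -
  have polyg: "polygonal \<Omega>"
    using assms(1) by (simp add: polygonal_lipschitz_domain_def)
  have mesh: "triangulation \<T>" "\<forall>K\<in>\<T>. 2 simplex K" "\<Union>\<T> = closure \<Omega>"
    using assms(5) by (simp_all add: mesh_def)
  interpret flux_recovery \<Omega> \<T> n \<Gamma>D \<Gamma>N \<D> A f g u k P \<phi> \<sigma>
  proof unfold_locales
    show "open \<Omega>" "bounded \<Omega>" using polyg by (simp_all add: polygonal_def)
    show "negligible (frontier \<Omega>)" using polygonal_frontier_negligible[OF polyg] .
  qed (use mesh assms in blast)+
  show ?thesis by (rule recovered_flux_in_Sigma)
qed

end
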